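(* Let $g(\cdot,t)=u(\cdot,t)\,ds_p^2$, $t\in(-\infty,0)$, be an ancient solution of the Ricci flow $\partial_t g_{ij}=-2R_{ij}$ on $S^2$ which becomes singular at time $t=0$, where $u>0$ is smooth on $S^2\times(-\infty,0)$ and satisfies $u_t=\Delta_{S^2}\log u-2$ in $S^2\times(-\infty,0)$. Let $v=u^{-1}$. Assume that the coordinates $(\psi,\theta)$ on $S^2$ are chosen such that $\lim_{t\to-\infty}v(\psi,\theta,t)=C_0\cos^2\psi$ for all $|\psi|\le\pi/2$, $0\le\theta\le 2\pi$, with a constant $C_0>0$, and that there exist constants $0<a<3$, $T_0<0$ and $C>0$ such that $v_\theta^2\le C\,v^{1+a}\cos^2\psi$ on $S^2\times(-\infty,T_0]$. Then $v=v(\psi,t)$ is independent of $\theta$, and for any $t_0<0$ there exists a constant $C_2>0$ such that $$|v_{\psi\psi}|+|(\sec\psi)v_\psi|\le C_2\quad\text{on } S^2\quad\forall t\le t_0$$ (where $\sec\psi$ is undefined at the poles $\psi=\pm\pi/2$, the estimate is understood for $|\psi|<\pi/2$).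
   Context: $ds_p^2=d\psi^2+\cos^2\psi\,d\theta^2$ is the standard round metric on the unit sphere $S^2$ with latitude-longitude coordinates $(\psi,\theta)$, $-\pi/2\le\psi\le\pi/2$, $0\le\theta\le 2\pi$; the poles are $\psi=\pm\pi/2$. $\Delta_{S^2}$ is its Laplacian, $\Delta_{S^2}f=f_{\psi\psi}-(\tan\psi)f_\psi+(\sec^2\psi)f_{\theta\theta}$. "Ancient" means defined for all $t<0$. By known results, $v(\cdot,t)$ decreases as $t\to-\infty$ and converges in $C^{1,\alpha}(S^2)$ for every $0<\alpha<1$; after a conformal change of $S^2$ the limit has the form $C_0\cos^2\psi$ with $C_0\ge 0$, and the assumption on the coordinates refers to this normalization. Independence of $\theta$ under these assumptions is a separate theorem of the paper and is recalled only to justify the notation $v(\psi,t)$. *)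

theory Defs
  imports "HOL-Analysis.Analysis"
begin

primrec continuously_differentiable_on ::
    "nat \<Rightarrow> 'a::euclidean_space set \<Rightarrow> ('a \<Rightarrow> real) \<Rightarrow> bool" where
  "continuously_differentiable_on 0 S f \<longleftrightarrow> continuous_on S f"
| "continuously_differentiable_on (Suc n) S f \<longleftrightarrow>
     (\<forall>x\<in>S. f differentiable (at x)) \<and>
     (\<forall>w. continuously_differentiable_on n S (\<lambda>x. frechet_derivative f (at x) w))"

text \<open>
  Smoothness on an arbitrary subset of a Euclidean space is the local extension property.  On an
  embedded submanifold, such as the product of the unit sphere and an open interval, this is
  smoothness with respect to the submanifold structure.
\<close>

definition smooth_on :: "'a::euclidean_space set \<Rightarrow> ('a \<Rightarrow> real) \<Rightarrow> bool" where
  "smooth_on X f \<longleftrightarrow>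
     (\<forall>x\<in>X. \<exists>U F. open U \<and> x \<in> U \<and> (\<forall>k. continuously_differentiable_on k U F) \<and>
        (\<forall>y\<in>U \<inter> X. F y = f y))"

definition partial :: "'n::finite \<Rightarrow> (real^'n \<Rightarrow> real) \<Rightarrow> real^'n \<Rightarrow> real" where
  "partial i f x = deriv (\<lambda>h. f (x + h *\<^sub>R axis i 1)) 0"

text \<open>
  The argument \<open>g\<close> below is the matrix of a Riemannian metric in one coordinate chart;
  \<open>christoffel g k i j\<close> is the Christoffel symbol with upper index \<open>k\<close> and lower indices
  \<open>i\<close>, \<open>j\<close>.  The sign of \<open>ricci\<close> is such that round spheres have positive Ricci curvature.
\<close>

definition christoffel ::
    "(real^'n \<Rightarrow> real^'n^'n) \<Rightarrow> 'n::finite \<Rightarrow> 'n \<Rightarrow> 'n \<Rightarrow> real^'n \<Rightarrow> real" where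
  "christoffel g k i j x =
     (1/2) * (\<Sum>l\<in>UNIV. matrix_inv (g x) $ k $ l *
        (partial i (\<lambda>y. g y $ j $ l) x + partial j (\<lambda>y. g y $ i $ l) x
           - partial l (\<lambda>y. g y $ i $ j) x))"

definition ricci :: "(real^'n \<Rightarrow> real^'n^'n) \<Rightarrow> 'n::finite \<Rightarrow> 'n \<Rightarrow> real^'n \<Rightarrow> real" where
  "ricci g i j x =
     (\<Sum>k\<in>UNIV. partial k (christoffel g k i j) x - partial j (christoffel g k i k) x) +
     (\<Sum>k\<in>UNIV. \<Sum>l\<in>UNIV. christoffel g k k l x * christoffel g l i j x
        - christoffel g k j l x * christoffel g l i k x)"

definition scalar_curvature :: "(real^'n \<Rightarrow> real^'n^'n) \<Rightarrow> real^'n::finite \<Rightarrow> real" where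
  "scalar_curvature g x =
     (\<Sum>i\<in>UNIV. \<Sum>j\<in>UNIV. matrix_inv (g x) $ i $ j * ricci g i j x)"

definition ricci_flow_on ::
    "(real^'n::finite) set \<Rightarrow> real set \<Rightarrow> (real \<Rightarrow> real^'n \<Rightarrow> real^'n^'n) \<Rightarrow> bool" where
  "ricci_flow_on U J g \<longleftrightarrow>
     (\<forall>t\<in>J. \<forall>x\<in>U. \<forall>i j.
        ((\<lambda>s. g s x $ i $ j) has_real_derivative - 2 * ricci (g t) i j x) (at t))"

text \<open>
  A Ricci flow becomes singular at time \<open>T\<close> if its curvature becomes unbounded as time increases
  to \<open>T\<close>.  On a surface the scalar curvature determines the whole curvature tensor.
\<close>

definition becomes_singular_at ::
    "(real^2) set \<Rightarrow> real \<Rightarrow> (real \<Rightarrow> real^2 \<Rightarrow> real^2^2) \<Rightarrow> bool" where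
  "becomes_singular_at U T g \<longleftrightarrow>
     (\<forall>M. \<exists>\<^sub>F t in at_left T. \<exists>x\<in>U. \<bar>scalar_curvature (g t) x\<bar> > M)"

definition sphere_point :: "real \<Rightarrow> real \<Rightarrow> real^3" where
  "sphere_point \<psi> \<theta> = vector [cos \<psi> * cos \<theta>, cos \<psi> * sin \<theta>, sin \<psi>]"

text \<open>
  Latitude-longitude coordinates are \<open>x $ 1 = \<psi>\<close> and \<open>x $ 2 = \<theta>\<close>.  On the strip below the
  longitude is not restricted to one period, so that the strip is open and covers the sphere without
  its poles.
\<close>

definition coord_strip :: "(real^2) set" where
  "coord_strip = {x. - pi/2 < x $ 1 \<and> x $ 1 < pi/2}"

definition round_metric :: "real^2 \<Rightarrow> real^2^2" where
  "round_metric x = vector [vector [1, 0], vector [0, (cos (x $ 1))\<^sup>2]]"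

definition conformal_metric :: "(real^3 \<Rightarrow> real \<Rightarrow> real) \<Rightarrow> real \<Rightarrow> real^2 \<Rightarrow> real^2^2" where
  "conformal_metric u t x = u (sphere_point (x $ 1) (x $ 2)) t *\<^sub>R round_metric x"

text \<open>
  The Laplacian of the round sphere, for a function given in the coordinates \<open>(\<psi>, \<theta>)\<close>; this is
  meaningful away from the poles only.
\<close>

definition sphere_laplacian :: "(real \<Rightarrow> real \<Rightarrow> real) \<Rightarrow> real \<Rightarrow> real \<Rightarrow> real" where
  "sphere_laplacian f \<psi> \<theta> =
     (deriv ^^ 2) (\<lambda>s. f s \<theta>) \<psi> - tan \<psi> * deriv (\<lambda>s. f s \<theta>) \<psi>
       + (1 / cos \<psi>)\<^sup>2 * (deriv ^^ 2) (\<lambda>s. f \<psi> s) \<theta>"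

end

(*
  In Mercator's coordinate s (sin psi = tanh s) the flow reads l_t = e^l (l_ss + l_theta_theta) for
  e^l = v cosh^2 s.  Comparing u with its rescalings mu u(t0 + (t - t0) / mu) and letting t0 tend to
  minus infinity shows that u is nonincreasing in t, hence R = l_t >= 0 and v >= C0 cos^2 psi.

  Rotational symmetry is L^1 contraction: for a rotated copy w of u the integral of |u - w| over the
  sphere is nonincreasing in t, and the bound on v_theta together with v >= C0 cos^2 psi dominates
  |u - w| by an integrable function uniformly in t <= T0, so that the integral tends to 0 as t tends
  to minus infinity.

  For the derivative bounds, Hamilton's Harnack inequality on an ancient solution gives R_t >= 0, so R
  is bounded for t <= t0.  With m = l_s one has m_s = e^(-l) R, and m tends to 2 and -2 at the poles;
  integrating from the nearest pole yields (4 - m^2) e^l <= 2 sup R.  Since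
  sec psi v_psi = e^l (m - 2 tanh s), this bounds the first derivative term, and the equation then
  bounds v_psi_psi.
*)

theory Submission
  imports Defs
begin

section \<open>Smooth functions\<close>

text \<open>The obstacle is the pair of poles, which Mercator's coordinate sends to infinity, where
  \<open>exp ell\<close> grows like \<open>cosh^2\<close>. Since \<open>sphere_point\<close> makes
  sense for every real \<psi>, a smooth function on the sphere becomes a smooth periodic function on
  the plane; compactness of a period cell bounds its derivatives across the poles, and its first
  s-derivative carries a factor \<open>1 / cosh s\<close>. The condition a > 0 makes the bound on
  the rotation defect decay like \<open>cosh s powr (- a)\<close>, hence integrable; a < 3 allows
  the lower bound on v to be inserted into v^(a - 3). The box on which the contraction is integrated
  has to be chosen after the initial time, because the boundary terms depend on that time;
  integrability over the whole line makes the initial estimate independent of the box. The curvature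
  is only known to be nonnegative, so the Harnack quantity is regularized by \<epsilon>. Its error
  terms are controlled on a fixed time interval; \<epsilon> tends to 0 first and the initial time to
  minus infinity afterwards. Symmetry is proved before, which leaves one space variable in that
  computation.\<close>

lemma cdiff_cong:
  assumes "open S" "\<And>x. x \<in> S \<Longrightarrow> f x = g x" "continuously_differentiable_on n S f"
  shows "continuously_differentiable_on n S g"
  using assms(2,3)
proof (induction n arbitrary: f g)
  case 0
  then show ?case by (metis continuous_on_cong continuously_differentiable_on.simps(1))
next
  case (Suc n)
  have fd: "f differentiable (at x)" if "x \<in> S" for x using Suc.prems that by simp
  have gd: "g differentiable (at x)" if "x \<in> S" for x
    using fd[OF that] has_derivative_transform_within_open[OF _ \<open>open S\<close> that] Suc.prems(1)
    unfolding differentiable_def by blast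
  have eq: "frechet_derivative f (at x) = frechet_derivative g (at x)" if "x \<in> S" for x
    using frechet_derivative_transform_within_open[OF fd[OF that] \<open>open S\<close> that] Suc.prems(1) by blast
  have "continuously_differentiable_on n S (\<lambda>x. frechet_derivative g (at x) w)" for w
    by (rule Suc.IH[of "\<lambda>x. frechet_derivative f (at x) w"]) (use eq Suc.prems in auto)
  then show ?case using gd by simp
qed

lemma cdiff_SucI:
  assumes "open S" "\<And>x. x \<in> S \<Longrightarrow> (f has_derivative f' x) (at x)"
    "\<And>w. continuously_differentiable_on n S (\<lambda>x. f' x w)"
  shows "continuously_differentiable_on (Suc n) S f"
proof -
  have "continuously_differentiable_on n S (\<lambda>x. frechet_derivative f (at x) w)" for w
    by (rule cdiff_cong[OF assms(1) _ assms(3)[of w]])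
      (use frechet_derivative_at[OF assms(2)] in auto)
  then show ?thesis using assms(2) by (auto simp: differentiable_def)
qed

lemma cdiff_SucD:
  assumes "continuously_differentiable_on (Suc n) S f"
  shows "\<And>x. x \<in> S \<Longrightarrow> (f has_derivative frechet_derivative f (at x)) (at x)"
    "\<And>w. continuously_differentiable_on n S (\<lambda>x. frechet_derivative f (at x) w)"
  using assms by (simp_all add: frechet_derivative_works)

lemma cdiff_lower:
  "continuously_differentiable_on (Suc n) S f \<Longrightarrow> continuously_differentiable_on n S f"
proof (induction n arbitrary: f)
  case 0
  then show ?case
    by (auto intro!: continuous_at_imp_continuous_on differentiable_imp_continuous_within)
next
  case (Suc n)
  have "continuously_differentiable_on n S (\<lambda>x. frechet_derivative f (at x) w)" for w
    using Suc.IH Suc.prems continuously_differentiable_on.simps(2) by blast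
  then show ?case using Suc.prems by simp
qed

lemma cdiff_subset:
  "continuously_differentiable_on n S f \<Longrightarrow> T \<subseteq> S \<Longrightarrow> continuously_differentiable_on n T f"
  by (induction n arbitrary: f) (auto intro: continuous_on_subset)

text \<open>Continuity and derivatives at a point depend only on nearby values. This converts the
  local extensions supplied by \<open>smooth_on\<close> into smoothness on an open set.\<close>

lemma cdiff_local:
  assumes "\<And>x. x \<in> S \<Longrightarrow> \<exists>N. open N \<and> x \<in> N \<and> continuously_differentiable_on n N f"
  shows "continuously_differentiable_on n S f"
  using assms
proof (induction n arbitrary: f)
  case 0
  have "isCont f x" if x: "x \<in> S" for x
  proof -
    obtain N where "open N" "x \<in> N" "continuous_on N f" using 0[OF x] by auto
    then show ?thesis using continuous_on_eq_continuous_at by blast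
  qed
  then show ?case by (simp add: continuous_at_imp_continuous_on)
next
  case (Suc n)
  have "f differentiable (at x)" if "x \<in> S" for x using Suc.prems[OF that] by auto
  moreover have "continuously_differentiable_on n S (\<lambda>x. frechet_derivative f (at x) w)" for w
  proof (rule Suc.IH)
    fix x assume "x \<in> S"
    then obtain N where "open N" "x \<in> N" "continuously_differentiable_on (Suc n) N f"
      using Suc.prems by blast
    then show "\<exists>N. open N \<and> x \<in> N \<and>
        continuously_differentiable_on n N (\<lambda>x. frechet_derivative f (at x) w)"
      using cdiff_SucD(2) by blast
  qed
  ultimately show ?case by simp
qed

lemma cdiff_const:
  "open S \<Longrightarrow> continuously_differentiable_on n S (\<lambda>x. c)"
proof (induction n arbitrary: c)
  case (Suc n)
  then show ?case by (intro cdiff_SucI[where f' = "\<lambda>_ _. 0"]) auto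
qed simp

lemma cdiff_linear:
  assumes "open S" "bounded_linear f"
  shows "continuously_differentiable_on n S f"
proof (cases n)
  case 0
  then show ?thesis using assms linear_continuous_on by simp
next
  case (Suc m)
  show ?thesis unfolding Suc
    by (rule cdiff_SucI[where f' = "\<lambda>_. f"])
      (use assms bounded_linear_imp_has_derivative cdiff_const in auto)
qed

lemma cdiff_add:
  assumes "open S"
  shows "continuously_differentiable_on n S f \<Longrightarrow> continuously_differentiable_on n S g \<Longrightarrow>
    continuously_differentiable_on n S (\<lambda>x. f x + g x)"
proof (induction n arbitrary: f g)
  case 0
  then show ?case by (simp add: continuous_on_add)
next
  case (Suc n)
  show ?case
    by (rule cdiff_SucI[OF assms
          has_derivative_add[OF cdiff_SucD(1)[OF Suc.prems(1)]
            cdiff_SucD(1)[OF Suc.prems(2)]]])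
      (use Suc in auto)
qed

lemma cdiff_sum:
  assumes "open S" "finite I" "\<And>i. i \<in> I \<Longrightarrow> continuously_differentiable_on n S (f i)"
  shows "continuously_differentiable_on n S (\<lambda>x. \<Sum>i\<in>I. f i x)"
  using assms(2,3)
proof (induction I rule: finite_induct)
  case empty
  then show ?case using cdiff_const[OF assms(1)] by simp
next
  case (insert i I)
  then show ?case using cdiff_add[OF assms(1)] by simp
qed

lemma cdiff_mult:
  assumes "open S"
  shows "continuously_differentiable_on n S f \<Longrightarrow> continuously_differentiable_on n S g \<Longrightarrow>
    continuously_differentiable_on n S (\<lambda>x. f x * g x)"
proof (induction n arbitrary: f g)
  case 0
  then show ?case by (simp add: continuous_on_mult)
next
  case (Suc n)
  have l: "continuously_differentiable_on n S f" "continuously_differentiable_on n S g"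
    using Suc.prems by (blast dest: cdiff_lower)+
  show ?case
    by (rule cdiff_SucI[OF assms
          has_derivative_mult[OF cdiff_SucD(1)[OF Suc.prems(1)]
            cdiff_SucD(1)[OF Suc.prems(2)]]])
      (use Suc l in \<open>auto intro!: cdiff_add[OF assms]\<close>)
qed

text \<open>By the chain rule the derivative is a finite sum of products of a component derivative
  of \<phi> with \<open>frechet_derivative F (at (\<phi> x)) b\<close>. The second factor is again a
  function composed with \<phi>, so the induction runs over arbitrary \<open>F\<close>.\<close>

lemma cdiff_compose:
  fixes \<phi> :: "'a::euclidean_space \<Rightarrow> 'b::euclidean_space"
  assumes "open S" "\<And>x. x \<in> S \<Longrightarrow> \<phi> x \<in> U"
  shows "continuously_differentiable_on n U F \<Longrightarrow>
    (\<And>b. b \<in> Basis \<Longrightarrow> continuously_differentiable_on n S (\<lambda>x. \<phi> x \<bullet> b)) \<Longrightarrow>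
    continuously_differentiable_on n S (\<lambda>x. F (\<phi> x))"
proof (induction n arbitrary: F)
  case 0
  then have "continuous_on S \<phi>" by (subst continuous_on_componentwise) auto
  with 0 show ?case using assms(2) continuous_on_compose2[of U F S \<phi>] by auto
next
  case (Suc n)
  define D where "D x w = (\<Sum>b\<in>Basis. frechet_derivative (\<lambda>x. \<phi> x \<bullet> b) (at x) w *\<^sub>R b)" for x w
  have comp: "((\<lambda>x. \<phi> x \<bullet> b) has_derivative frechet_derivative (\<lambda>x. \<phi> x \<bullet> b) (at x)) (at x)"
    if "x \<in> S" "b \<in> Basis" for x b
    using cdiff_SucD(1)[OF Suc.prems(2)[OF that(2)] that(1)] .
  have phi: "(\<phi> has_derivative D x) (at x)" if "x \<in> S" for x
    unfolding has_derivative_componentwise_within[of \<phi>]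
    using comp[OF that] by (auto simp: D_def inner_sum_left inner_Basis if_distrib cong: if_cong)
  have F: "(F has_derivative frechet_derivative F (at (\<phi> x))) (at (\<phi> x))" if "x \<in> S" for x
    using cdiff_SucD(1)[OF Suc.prems(1)] assms(2) that by blast
  have exp: "frechet_derivative F (at (\<phi> x)) (D x w) =
     (\<Sum>b\<in>Basis. frechet_derivative (\<lambda>x. \<phi> x \<bullet> b) (at x) w * frechet_derivative F (at (\<phi> x)) b)"
    if "x \<in> S" for x w
  proof -
    interpret bounded_linear "frechet_derivative F (at (\<phi> x))"
      using F[OF that] has_derivative_bounded_linear by blast
    show ?thesis by (simp add: D_def sum scaleR)
  qed
  have der: "((\<lambda>x. F (\<phi> x)) has_derivative (\<lambda>w. \<Sum>b\<in>Basis. frechet_derivative (\<lambda>x. \<phi> x \<bullet> b) (at x) w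
      * frechet_derivative F (at (\<phi> x)) b)) (at x)" if "x \<in> S" for x
    using diff_chain_at[OF phi[OF that] F[OF that]] exp[OF that] by (simp add: o_def)
  have comp': "continuously_differentiable_on n S (\<lambda>x. \<phi> x \<bullet> b)" if "b \<in> Basis" for b
    using Suc.prems(2)[OF that] by (rule cdiff_lower)
  have F': "continuously_differentiable_on n S (\<lambda>x. frechet_derivative F (at (\<phi> x)) b)" for b
    by (rule Suc.IH[OF cdiff_SucD(2)[OF Suc.prems(1)] comp'])
  show ?case
  proof (rule cdiff_SucI[OF assms(1) der])
    show "continuously_differentiable_on n S (\<lambda>x. \<Sum>b\<in>Basis.
        frechet_derivative (\<lambda>x. \<phi> x \<bullet> b) (at x) w * frechet_derivative F (at (\<phi> x)) b)" for w
      using Suc.prems(2) F'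
      by (intro cdiff_sum cdiff_mult assms(1)) auto
  qed
qed

section \<open>Functions with derivatives of all orders\<close>

definition C_infinity_on :: "'a::euclidean_space set \<Rightarrow> ('a \<Rightarrow> real) \<Rightarrow> bool" where
  "C_infinity_on S f \<longleftrightarrow> open S \<and> (\<forall>n. continuously_differentiable_on n S f)"

named_theorems smooth_intros

lemma C_infinity_onD:
  assumes "C_infinity_on S f"
  shows "open S" "continuously_differentiable_on n S f" "continuous_on S f"
    "x \<in> S \<Longrightarrow> (f has_derivative frechet_derivative f (at x)) (at x)"
    "C_infinity_on S (\<lambda>x. frechet_derivative f (at x) w)"
proof -
  have cd: "continuously_differentiable_on n S f" for n
    using assms by (simp add: C_infinity_on_def)
  show op: "open S" using assms by (simp add: C_infinity_on_def)
  show "continuously_differentiable_on n S f" by (rule cd)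
  show "continuous_on S f" using cd[of 0] by simp
  show "x \<in> S \<Longrightarrow> (f has_derivative frechet_derivative f (at x)) (at x)"
    by (rule cdiff_SucD(1)[OF cd[of 1, unfolded One_nat_def]])
  show "C_infinity_on S (\<lambda>x. frechet_derivative f (at x) w)"
    unfolding C_infinity_on_def
    using op cdiff_SucD(2)[OF cd[of "Suc _"]] by blast
qed

lemma C_infinity_on_const [smooth_intros]:
  "open S \<Longrightarrow> C_infinity_on S (\<lambda>x. c)"
  by (simp add: C_infinity_on_def cdiff_const)

lemma C_infinity_on_add [smooth_intros]:
  "C_infinity_on S f \<Longrightarrow> C_infinity_on S g \<Longrightarrow>
    C_infinity_on S (\<lambda>x. f x + g x)"
  by (simp add: C_infinity_on_def cdiff_add)

lemma C_infinity_on_mult [smooth_intros]: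
  "C_infinity_on S f \<Longrightarrow> C_infinity_on S g \<Longrightarrow>
    C_infinity_on S (\<lambda>x. f x * g x)"
  by (simp add: C_infinity_on_def cdiff_mult)

lemma C_infinity_on_minus [smooth_intros]:
  assumes "C_infinity_on S f"
  shows "C_infinity_on S (\<lambda>x. - f x)"
  using C_infinity_on_mult[OF C_infinity_on_const assms, of "-1"]
    C_infinity_onD(1)[OF assms] by simp

lemma C_infinity_on_diff [smooth_intros]:
  "C_infinity_on S f \<Longrightarrow> C_infinity_on S g \<Longrightarrow>
    C_infinity_on S (\<lambda>x. f x - g x)"
  using C_infinity_on_add[OF _ C_infinity_on_minus, of S f g] by simp

lemma C_infinity_on_linear:
  "open S \<Longrightarrow> bounded_linear f \<Longrightarrow> C_infinity_on S f"
  by (simp add: C_infinity_on_def cdiff_linear)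

lemma C_infinity_on_compose:
  fixes \<phi> :: "'a::euclidean_space \<Rightarrow> 'b::euclidean_space"
  assumes "open S" "\<And>x. x \<in> S \<Longrightarrow> \<phi> x \<in> U" "C_infinity_on U F"
    "\<And>b. b \<in> Basis \<Longrightarrow> C_infinity_on S (\<lambda>x. \<phi> x \<bullet> b)"
  shows "C_infinity_on S (\<lambda>x. F (\<phi> x))"
  using assms cdiff_compose[where \<phi> = \<phi> and S = S and U = U and F = F]
  unfolding C_infinity_on_def by blast

lemma C_infinity_on_compose_real:
  fixes \<phi> :: "'a::euclidean_space \<Rightarrow> real"
  assumes "C_infinity_on U F" "C_infinity_on S \<phi>"
    "\<And>x. x \<in> S \<Longrightarrow> \<phi> x \<in> U"
  shows "C_infinity_on S (\<lambda>x. F (\<phi> x))"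
  by (rule C_infinity_on_compose[OF C_infinity_onD(1)[OF assms(2)] assms(3,1)])
    (use assms(2) in auto)

lemma cdiff_Suc_real:
  fixes f :: "real \<Rightarrow> real"
  assumes "open S" "\<And>x. x \<in> S \<Longrightarrow> (f has_real_derivative f' x) (at x)"
    "continuously_differentiable_on n S f'"
  shows "continuously_differentiable_on (Suc n) S f"
proof (rule cdiff_SucI[OF assms(1)])
  show "(f has_derivative (*) (f' x)) (at x)" if "x \<in> S" for x
    using assms(2)[OF that] by (simp add: has_field_derivative_def)
  show "continuously_differentiable_on n S (\<lambda>x. f' x * w)" for w
    using assms cdiff_mult cdiff_const by blast
qed

lemma C_infinity_on_real:
  fixes f :: "real \<Rightarrow> real"
  assumes "\<And>x. x \<in> S \<Longrightarrow> (f has_real_derivative f' x) (at x)"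
    "C_infinity_on S f'"
  shows "C_infinity_on S f"
  using cdiff_Suc_real[OF _ assms(1)] assms(2)
    cdiff_lower
  unfolding C_infinity_on_def by blast

lemma sin_cos_smooth:
  "C_infinity_on UNIV (sin :: real \<Rightarrow> real)"
  "C_infinity_on UNIV (cos :: real \<Rightarrow> real)"
proof -
  have "continuously_differentiable_on n UNIV (sin :: real \<Rightarrow> real) \<and>
    continuously_differentiable_on n UNIV (cos :: real \<Rightarrow> real)" for n
  proof (induction n)
    case 0
    then show ?case by (auto intro: continuous_intros)
  next
    case (Suc n)
    have m: "continuously_differentiable_on n UNIV (\<lambda>x::real. (-1) * sin x)"
      using Suc cdiff_mult cdiff_const open_UNIV by blast
    show ?case
      by (intro conjI cdiff_Suc_real[where f' = cos]
          cdiff_Suc_real[where f' = "\<lambda>x. (-1) * sin x"])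
        (use Suc m in \<open>auto intro!: derivative_eq_intros\<close>)
  qed
  then show "C_infinity_on UNIV (sin :: real \<Rightarrow> real)"
    "C_infinity_on UNIV (cos :: real \<Rightarrow> real)"
    by (auto simp: C_infinity_on_def)
qed

lemma sinh_cosh_smooth:
  "C_infinity_on UNIV (sinh :: real \<Rightarrow> real)"
  "C_infinity_on UNIV (cosh :: real \<Rightarrow> real)"
proof -
  have "continuously_differentiable_on n UNIV (sinh :: real \<Rightarrow> real) \<and>
    continuously_differentiable_on n UNIV (cosh :: real \<Rightarrow> real)" for n
  proof (induction n)
    case 0
    then show ?case by (auto intro: continuous_intros)
  next
    case (Suc n)
    show ?case
      by (intro conjI cdiff_Suc_real[where f' = cosh]
          cdiff_Suc_real[where f' = sinh])
        (use Suc in \<open>auto intro!: derivative_eq_intros\<close>)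
  qed
  then show "C_infinity_on UNIV (sinh :: real \<Rightarrow> real)"
    "C_infinity_on UNIV (cosh :: real \<Rightarrow> real)"
    by (auto simp: C_infinity_on_def)
qed

lemma inverse_smooth: "C_infinity_on {0<..} (inverse :: real \<Rightarrow> real)"
proof -
  have "continuously_differentiable_on n {0<..} (inverse :: real \<Rightarrow> real)" for n
  proof (induction n)
    case 0
    then show ?case by (auto intro!: continuous_intros)
  next
    case (Suc n)
    have m: "continuously_differentiable_on n {0<..} (\<lambda>x::real. (-1) * (inverse x * inverse x))"
      using Suc by (intro cdiff_mult cdiff_const) auto
    show ?case
      by (rule cdiff_Suc_real[OF _ _ m])
        (auto intro!: derivative_eq_intros)
  qed
  then show ?thesis by (auto simp: C_infinity_on_def)
qed

lemma ln_smooth: "C_infinity_on {0<..} (ln :: real \<Rightarrow> real)"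
  by (rule C_infinity_on_real[OF _ inverse_smooth])
    (auto intro!: derivative_eq_intros simp: inverse_eq_divide)

lemma exp_smooth: "C_infinity_on UNIV (exp :: real \<Rightarrow> real)"
proof -
  have "continuously_differentiable_on n UNIV (exp :: real \<Rightarrow> real)" for n
  proof (induction n)
    case 0
    then show ?case by (auto intro: continuous_intros)
  next
    case (Suc n)
    show ?case by (rule cdiff_Suc_real[OF _ _ Suc]) auto
  qed
  then show ?thesis by (auto simp: C_infinity_on_def)
qed

lemma C_infinity_on_inverse [smooth_intros]:
  fixes \<phi> :: "'a::euclidean_space \<Rightarrow> real"
  shows "C_infinity_on S \<phi> \<Longrightarrow> (\<And>x. x \<in> S \<Longrightarrow> \<phi> x > 0) \<Longrightarrow>
    C_infinity_on S (\<lambda>x. inverse (\<phi> x))"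
  using C_infinity_on_compose_real[OF inverse_smooth] by auto

lemma C_infinity_on_ln [smooth_intros]:
  fixes \<phi> :: "'a::euclidean_space \<Rightarrow> real"
  shows "C_infinity_on S \<phi> \<Longrightarrow> (\<And>x. x \<in> S \<Longrightarrow> \<phi> x > 0) \<Longrightarrow>
    C_infinity_on S (\<lambda>x. ln (\<phi> x))"
  using C_infinity_on_compose_real[OF ln_smooth] by auto

lemma C_infinity_on_elementary [smooth_intros]:
  fixes \<phi> :: "'a::euclidean_space \<Rightarrow> real"
  assumes "C_infinity_on S \<phi>"
  shows "C_infinity_on S (\<lambda>x. sin (\<phi> x))"
    "C_infinity_on S (\<lambda>x. cos (\<phi> x))"
    "C_infinity_on S (\<lambda>x. sinh (\<phi> x))"
    "C_infinity_on S (\<lambda>x. cosh (\<phi> x))"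
    "C_infinity_on S (\<lambda>x. exp (\<phi> x))"
  using C_infinity_on_compose_real[OF _ assms]
    sin_cos_smooth sinh_cosh_smooth exp_smooth by auto

lemma C_infinity_on_arctan [smooth_intros]:
  fixes \<phi> :: "'a::euclidean_space \<Rightarrow> real"
  assumes "C_infinity_on S \<phi>"
  shows "C_infinity_on S (\<lambda>x. arctan (\<phi> x))"
proof -
  have i: "C_infinity_on UNIV (\<lambda>x::real. inverse (1 + x * x))"
    by (intro smooth_intros C_infinity_on_linear bounded_linear_ident)
      (auto intro: add_pos_nonneg)
  have "C_infinity_on UNIV arctan"
    by (rule C_infinity_on_real[OF _ i])
      (use DERIV_arctan in \<open>auto simp: power2_eq_square\<close>)
  then show ?thesis using C_infinity_on_compose_real[OF _ assms] by auto
qed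

section \<open>Functions of two space variables and negative time\<close>

definition slab :: "(real \<times> real \<times> real) set" where
  "slab = {x. snd (snd x) < 0}"

abbreviation smooth_slab :: "(real \<times> real \<times> real \<Rightarrow> real) \<Rightarrow> bool" where
  "smooth_slab \<equiv> C_infinity_on slab"

text \<open>Taken as values of the Frechet derivative, the partial derivatives inherit smoothness at
  once; \<open>pd1_deriv\<close> to \<open>pd3_deriv\<close> identify them with ordinary derivatives
  on the slab. The first variable is the latitude or Mercator's coordinate, the second the
  longitude, the third time.\<close>

definition pd1 :: "(real \<times> real \<times> real \<Rightarrow> real) \<Rightarrow> real \<times> real \<times> real \<Rightarrow> real" where
  "pd1 f x = frechet_derivative f (at x) (1, 0, 0)"

definition pd2 :: "(real \<times> real \<times> real \<Rightarrow> real) \<Rightarrow> real \<times> real \<times> real \<Rightarrow> real" where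
  "pd2 f x = frechet_derivative f (at x) (0, 1, 0)"

definition pd3 :: "(real \<times> real \<times> real \<Rightarrow> real) \<Rightarrow> real \<times> real \<times> real \<Rightarrow> real" where
  "pd3 f x = frechet_derivative f (at x) (0, 0, 1)"

lemma mem_slab [simp]: "(s, \<theta>, t) \<in> slab \<longleftrightarrow> t < 0"
  by (simp add: slab_def)

lemma open_slab [simp]: "open slab"
  unfolding slab_def by (intro open_Collect_less continuous_intros)

lemma smooth_slab_pd [smooth_intros]:
  assumes "smooth_slab f"
  shows "smooth_slab (pd1 f)" "smooth_slab (pd2 f)" "smooth_slab (pd3 f)"
  using C_infinity_onD(5)[OF assms] by (simp_all add: pd1_def[abs_def] pd2_def[abs_def] pd3_def[abs_def])

lemma smooth_slab_proj [smooth_intros]: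
  "smooth_slab fst" "smooth_slab (\<lambda>x. fst (snd x))" "smooth_slab (\<lambda>x. snd (snd x))"
  by (intro C_infinity_on_linear open_slab bounded_linear_intros)+

lemma
  assumes "smooth_slab f" "t < 0"
  shows pd1_deriv: "((\<lambda>s. f (s, \<theta>, t)) has_real_derivative pd1 f (s, \<theta>, t)) (at s)"
    and pd2_deriv: "((\<lambda>\<theta>. f (s, \<theta>, t)) has_real_derivative pd2 f (s, \<theta>, t)) (at \<theta>)"
    and pd3_deriv: "((\<lambda>t. f (s, \<theta>, t)) has_real_derivative pd3 f (s, \<theta>, t)) (at t)"
proof -
  have D: "(f has_derivative frechet_derivative f (at (s, \<theta>, t))) (at (s, \<theta>, t))"
    using C_infinity_onD(4)[OF assms(1)] assms(2) by simp
  interpret bounded_linear "frechet_derivative f (at (s, \<theta>, t))"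
    using D by (rule has_derivative_bounded_linear)
  have g1: "((\<lambda>s. (s, \<theta>, t)) has_derivative (\<lambda>h. h *\<^sub>R (1, 0, 0))) (at s)"
    by (auto intro!: derivative_eq_intros simp: zero_prod_def)
  have g2: "((\<lambda>\<theta>. (s, \<theta>, t)) has_derivative (\<lambda>h. h *\<^sub>R (0, 1, 0))) (at \<theta>)"
    by (auto intro!: derivative_eq_intros simp: zero_prod_def)
  have g3: "((\<lambda>t. (s, \<theta>, t)) has_derivative (\<lambda>h. h *\<^sub>R (0, 0, 1))) (at t)"
    by (auto intro!: derivative_eq_intros simp: zero_prod_def)
  have c: "(\<lambda>x. x * c) = (*) c" for c :: real by (simp add: fun_eq_iff mult.commute)
  show "((\<lambda>s. f (s, \<theta>, t)) has_real_derivative pd1 f (s, \<theta>, t)) (at s)"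
    using diff_chain_at[OF g1 D] unfolding o_def scaleR real_scaleR_def c pd1_def has_field_derivative_def .
  show "((\<lambda>\<theta>. f (s, \<theta>, t)) has_real_derivative pd2 f (s, \<theta>, t)) (at \<theta>)"
    using diff_chain_at[OF g2 D] unfolding o_def scaleR real_scaleR_def c pd2_def has_field_derivative_def .
  show "((\<lambda>t. f (s, \<theta>, t)) has_real_derivative pd3 f (s, \<theta>, t)) (at t)"
    using diff_chain_at[OF g3 D] unfolding o_def scaleR real_scaleR_def c pd3_def has_field_derivative_def .
qed

lemma smooth_slab_cont:
  assumes "smooth_slab f" "continuous_on A p" "continuous_on A q" "continuous_on A r"
    "\<And>x. x \<in> A \<Longrightarrow> r x < 0"
  shows "continuous_on A (\<lambda>x. f (p x, q x, r x))"
proof (rule continuous_on_compose2[OF C_infinity_onD(3)[OF assms(1)]])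
  show "continuous_on A (\<lambda>x. (p x, q x, r x))"
    by (intro continuous_on_Pair assms)
  show "(\<lambda>x. (p x, q x, r x)) ` A \<subseteq> slab" using assms(5) by auto
qed

text \<open>The increment of \<open>f\<close> from s0 - 1 to s is the integral of
  \<open>pd1 f\<close>. Differentiating it in t under the integral sign, and then in s by the
  fundamental theorem of calculus, produces both sides.\<close>

lemma pd13_commute:
  assumes "smooth_slab f" "t0 < 0"
  shows "pd3 (pd1 f) (s0, \<theta>, t0) = pd1 (pd3 f) (s0, \<theta>, t0)"
proof -
  let ?a = "s0 - 1" and ?b = "s0 + 1"
  have ftc: "integral {?a..s} (\<lambda>x. pd1 f (x, \<theta>, t)) = f (s, \<theta>, t) - f (?a, \<theta>, t)"
    if "t < 0" "?a \<le> s" for s t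
  proof (intro integral_unique fundamental_theorem_of_calculus that)
    fix x
    show "((\<lambda>x. f (x, \<theta>, t)) has_vector_derivative pd1 f (x, \<theta>, t)) (at x within {?a..s})"
      using has_field_derivative_at_within[OF pd1_deriv[OF assms(1) that(1)]]
      unfolding has_real_derivative_iff_has_vector_derivative .
  qed
  have eq: "pd3 f (s, \<theta>, t0) - pd3 f (?a, \<theta>, t0) = integral {?a..s} (\<lambda>x. pd3 (pd1 f) (x, \<theta>, t0))"
    if s: "?a \<le> s" for s
  proof -
    have "((\<lambda>t. integral (cbox ?a s) (\<lambda>x. pd1 f (x, \<theta>, t))) has_real_derivative
        integral (cbox ?a s) (\<lambda>x. pd3 (pd1 f) (x, \<theta>, t0))) (at t0 within {..<0})"
    proof (rule leibniz_rule_field_derivative)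
      show "((\<lambda>t. pd1 f (x, \<theta>, t)) has_real_derivative pd3 (pd1 f) (x, \<theta>, t)) (at t within {..<0})"
        if "t \<in> {..<0}" for t x
        by (rule has_field_derivative_at_within[OF pd3_deriv[OF smooth_slab_pd(1)[OF assms(1)]]])
          (use that in auto)
      show "(\<lambda>x. pd1 f (x, \<theta>, t)) integrable_on cbox ?a s" if "t \<in> {..<0}" for t
        using that by (intro integrable_continuous smooth_slab_cont smooth_slab_pd assms(1) continuous_intros) auto
      show "continuous_on ({..<0} \<times> cbox ?a s) (\<lambda>(t, x). pd3 (pd1 f) (x, \<theta>, t))"
        unfolding split_beta
        by (intro smooth_slab_cont smooth_slab_pd assms(1) continuous_intros) auto
    qed (use assms(2) in auto)
    then have "((\<lambda>t. integral {?a..s} (\<lambda>x. pd1 f (x, \<theta>, t))) has_real_derivative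
        integral {?a..s} (\<lambda>x. pd3 (pd1 f) (x, \<theta>, t0))) (at t0)"
      using assms(2) by (simp add: at_within_open[of t0 "{..<0}"])
    then have "((\<lambda>t. f (s, \<theta>, t) - f (?a, \<theta>, t)) has_real_derivative
        integral {?a..s} (\<lambda>x. pd3 (pd1 f) (x, \<theta>, t0))) (at t0)"
      by (rule has_field_derivative_transform_within_open[where S = "{..<0}"]) (use assms(2) ftc s in auto)
    moreover have "((\<lambda>t. f (s, \<theta>, t) - f (?a, \<theta>, t)) has_real_derivative
        pd3 f (s, \<theta>, t0) - pd3 f (?a, \<theta>, t0)) (at t0)"
      by (intro DERIV_diff pd3_deriv assms)
    ultimately show ?thesis using DERIV_unique by blast
  qed
  have "((\<lambda>s. integral {?a..s} (\<lambda>x. pd3 (pd1 f) (x, \<theta>, t0))) has_real_derivative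
      pd3 (pd1 f) (s0, \<theta>, t0)) (at s0 within {?a..?b})"
    by (intro integral_has_real_derivative smooth_slab_cont smooth_slab_pd assms(1) continuous_intros)
      (use assms(2) in auto)
  then have "((\<lambda>s. integral {?a..s} (\<lambda>x. pd3 (pd1 f) (x, \<theta>, t0))) has_real_derivative
      pd3 (pd1 f) (s0, \<theta>, t0)) (at s0)"
    by (simp add: at_within_Icc_at)
  then have "((\<lambda>s. pd3 f (s, \<theta>, t0) - pd3 f (?a, \<theta>, t0)) has_real_derivative
      pd3 (pd1 f) (s0, \<theta>, t0)) (at s0)"
    by (rule has_field_derivative_transform_within_open[where S = "{?a<..<?b}"]) (use eq in auto)
  moreover have "((\<lambda>s. pd3 f (s, \<theta>, t0) - pd3 f (?a, \<theta>, t0)) has_real_derivative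
      pd1 (pd3 f) (s0, \<theta>, t0) - 0) (at s0)"
    by (intro DERIV_diff pd1_deriv smooth_slab_pd assms DERIV_const)
  ultimately show ?thesis using DERIV_unique by fastforce
qed

section \<open>Functions on the sphere in latitude and longitude\<close>

lemma sphere_point_nth [simp]:
  "sphere_point \<psi> \<theta> $ 1 = cos \<psi> * cos \<theta>"
  "sphere_point \<psi> \<theta> $ 2 = cos \<psi> * sin \<theta>"
  "sphere_point \<psi> \<theta> $ 3 = sin \<psi>"
  by (simp_all add: sphere_point_def)

lemma sphere_point_in_sphere: "sphere_point \<psi> \<theta> \<in> sphere 0 1"
proof -
  have "(norm (sphere_point \<psi> \<theta>))\<^sup>2 = (cos \<psi> * cos \<theta>)\<^sup>2 + (cos \<psi> * sin \<theta>)\<^sup>2 + (sin \<psi>)\<^sup>2"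
    by (simp add: norm_vec_def L2_set_def sum_3)
  also have "\<dots> = (cos \<psi>)\<^sup>2 * ((cos \<theta>)\<^sup>2 + (sin \<theta>)\<^sup>2) + (sin \<psi>)\<^sup>2"
    by (simp only: power_mult_distrib distrib_left)
  also have "\<dots> = 1" by simp
  finally show ?thesis using power2_eq_1_iff[of "norm (sphere_point \<psi> \<theta>)"] norm_ge_zero[of "sphere_point \<psi> \<theta>"] by auto
qed

text \<open>The parametrization is smooth on the whole plane, even where it is not a chart.
  Composing it with the local extensions therefore gives smoothness across the poles as
  well.\<close>

lemma smooth_on_sphere_slab:
  assumes "smooth_on (sphere 0 1 \<times> {..<0}) (\<lambda>(p, t). u p t)"
  shows "smooth_slab (\<lambda>x. u (sphere_point (fst x) (fst (snd x))) (snd (snd x)))"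
proof -
  define \<Phi> where "\<Phi> x = (sphere_point (fst x) (fst (snd x)), snd (snd x))" for x :: "real \<times> real \<times> real"
  have comp: "smooth_slab (\<lambda>x. \<Phi> x \<bullet> b)" if b: "b \<in> Basis" for b :: "(real^3) \<times> real"
  proof (cases "snd b = 0")
    case True
    then obtain i where "b = (axis i 1, 0)"
      using b by (auto simp: Basis_prod_def Basis_vec_def)
    then have "(\<lambda>x. \<Phi> x \<bullet> b) = (\<lambda>x. sphere_point (fst x) (fst (snd x)) $ i)"
      by (auto simp: \<Phi>_def inner_axis)
    moreover have "i = 1 \<or> i = 2 \<or> i = 3" by (rule exhaust_3)
    ultimately show ?thesis by (auto intro!: smooth_intros)
  next
    case False
    then have "b = (0, 1)" using b by (auto simp: Basis_prod_def)
    then show ?thesis by (auto simp: \<Phi>_def intro!: smooth_intros)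
  qed
  have cont: "continuous_on slab \<Phi>"
    unfolding continuous_on_componentwise[of slab \<Phi>] using C_infinity_onD(3)[OF comp] by blast
  have "continuously_differentiable_on n slab (\<lambda>x. u (sphere_point (fst x) (fst (snd x))) (snd (snd x)))" for n
  proof (rule cdiff_local)
    fix x assume x: "x \<in> slab"
    then have "\<Phi> x \<in> sphere 0 1 \<times> {..<0}"
      using sphere_point_in_sphere by (simp add: \<Phi>_def slab_def del: mem_sphere)
    then obtain U F where UF: "open U" "\<Phi> x \<in> U" "\<And>k. continuously_differentiable_on k U F"
      "\<And>y. y \<in> U \<inter> (sphere 0 1 \<times> {..<0}) \<Longrightarrow> F y = (case y of (p, t) \<Rightarrow> u p t)"
      using assms unfolding smooth_on_def by metis
    define N where "N = slab \<inter> \<Phi> -` U"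
    have N: "open N" "N \<subseteq> slab" unfolding N_def using continuous_open_preimage[OF cont _ UF(1)] by auto
    have "continuously_differentiable_on n N (\<lambda>x. F (\<Phi> x))"
      by (rule cdiff_compose[OF N(1) _ UF(3)])
        (use comp N in \<open>auto simp: N_def C_infinity_on_def
          intro: cdiff_subset\<close>)
    then have "continuously_differentiable_on n N
        (\<lambda>x. u (sphere_point (fst x) (fst (snd x))) (snd (snd x)))"
    proof (rule cdiff_cong[OF N(1), rotated])
      fix y assume "y \<in> N"
      then have "\<Phi> y \<in> U \<inter> (sphere 0 1 \<times> {..<0})"
        using sphere_point_in_sphere by (simp add: N_def \<Phi>_def slab_def del: mem_sphere)
      from UF(4)[OF this] show "F (\<Phi> y) = u (sphere_point (fst y) (fst (snd y))) (snd (snd y))"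
        by (simp add: \<Phi>_def)
    qed
    then show "\<exists>N. open N \<and> x \<in> N \<and> continuously_differentiable_on n N
        (\<lambda>x. u (sphere_point (fst x) (fst (snd x))) (snd (snd x)))"
      using N x UF(2) by (auto simp: N_def)
  qed
  then show ?thesis by (simp add: C_infinity_on_def)
qed

section \<open>Mercator coordinates\<close>

lemma pd_shift:
  assumes "smooth_slab f" "smooth_slab g" "t < 0"
    and eq: "\<And>s \<theta> t. t < 0 \<Longrightarrow> g (s, \<theta>, t) = f (s + b, \<theta> + c, t)"
  shows "pd1 g (s, \<theta>, t) = pd1 f (s + b, \<theta> + c, t)" "pd2 g (s, \<theta>, t) = pd2 f (s + b, \<theta> + c, t)"
    "pd3 g (s, \<theta>, t) = pd3 f (s + b, \<theta> + c, t)"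
proof -
  have "((\<lambda>s. f (s + b, \<theta> + c, t)) has_real_derivative pd1 f (s + b, \<theta> + c, t)) (at s)"
    using pd1_deriv[OF assms(1,3), of "\<theta> + c" "s + b"] by (simp add: DERIV_shift)
  then have "((\<lambda>s. g (s, \<theta>, t)) has_real_derivative pd1 f (s + b, \<theta> + c, t)) (at s)"
    using eq assms(3) by simp
  then show "pd1 g (s, \<theta>, t) = pd1 f (s + b, \<theta> + c, t)"
    using pd1_deriv[OF assms(2,3)] DERIV_unique by blast
  have "((\<lambda>\<theta>. f (s + b, \<theta> + c, t)) has_real_derivative pd2 f (s + b, \<theta> + c, t)) (at \<theta>)"
    using pd2_deriv[OF assms(1,3), of "s + b" "\<theta> + c"] by (simp add: DERIV_shift)
  then have "((\<lambda>\<theta>. g (s, \<theta>, t)) has_real_derivative pd2 f (s + b, \<theta> + c, t)) (at \<theta>)"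
    using eq assms(3) by simp
  then show "pd2 g (s, \<theta>, t) = pd2 f (s + b, \<theta> + c, t)"
    using pd2_deriv[OF assms(2,3)] DERIV_unique by blast
  have "((\<lambda>t. g (s, \<theta>, t)) has_real_derivative pd3 f (s + b, \<theta> + c, t)) (at t)"
    by (rule has_field_derivative_transform_within_open[OF pd3_deriv[OF assms(1,3)], where S = "{..<0}"])
      (use eq assms(3) in auto)
  then show "pd3 g (s, \<theta>, t) = pd3 f (s + b, \<theta> + c, t)"
    using pd3_deriv[OF assms(2,3)] DERIV_unique by blast
qed

text \<open>The latitude runs over the whole line too: an increase of \<psi> by 2 pi is a full turn
  along a great circle through the poles. Bounds obtained from compactness of a period cell thus
  hold up to the poles.\<close>

definition doubly_periodic :: "(real \<times> real \<times> real \<Rightarrow> real) \<Rightarrow> bool" where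
  "doubly_periodic f \<longleftrightarrow> (\<forall>s \<theta> t k l. t < 0 \<longrightarrow>
     f (s + 2 * pi * of_int k, \<theta> + 2 * pi * of_int l, t) = f (s, \<theta>, t))"

lemma doubly_periodic_pd:
  assumes "smooth_slab f" "doubly_periodic f"
  shows "doubly_periodic (pd1 f)" "doubly_periodic (pd2 f)" "doubly_periodic (pd3 f)"
  using pd_shift[OF assms(1) assms(1)] assms(2) unfolding doubly_periodic_def by metis+

lemma ex_period_representative:
  fixes x :: real
  obtains y k where "x = y + 2 * pi * of_int k" "0 \<le> y" "y \<le> 2 * pi"
proof
  define k where "k = \<lfloor>x / (2 * pi)\<rfloor>"
  have k: "of_int k \<le> x / (2 * pi)" "x / (2 * pi) < of_int k + 1"
    unfolding k_def by linarith+
  show "x = (x - 2 * pi * of_int k) + 2 * pi * of_int k" by simp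
  show "0 \<le> x - 2 * pi * of_int k" "x - 2 * pi * of_int k \<le> 2 * pi"
    using k pi_gt_zero by (simp_all add: field_simps)
qed

lemma doubly_periodic_bounded:
  assumes "continuous_on slab f" "doubly_periodic f" "t1 < 0"
  obtains M where "M > 0" "\<And>s \<theta> t. T \<le> t \<Longrightarrow> t \<le> t1 \<Longrightarrow> \<bar>f (s, \<theta>, t)\<bar> \<le> M"
proof -
  let ?K = "{0..2*pi} \<times> {0..2*pi} \<times> {T..t1}"
  have "continuous_on ?K f" using assms by (intro continuous_on_subset[OF assms(1)]) (auto simp: slab_def)
  moreover have "compact ?K" by (intro compact_Times compact_Icc)
  ultimately have "bounded (f ` ?K)" by (intro compact_imp_bounded compact_continuous_image)
  then obtain M where M: "norm (f x) \<le> M" if "x \<in> ?K" for x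
    by (meson bounded_iff imageI)
  show ?thesis
  proof
    show "max M 1 > 0" by simp
    fix s \<theta> t assume t: "T \<le> t" "t \<le> t1"
    obtain s' k where s: "s = s' + 2 * pi * of_int k" "0 \<le> s'" "s' \<le> 2 * pi"
      by (rule ex_period_representative)
    obtain \<theta>' l where th: "\<theta> = \<theta>' + 2 * pi * of_int l" "0 \<le> \<theta>'" "\<theta>' \<le> 2 * pi"
      by (rule ex_period_representative)
    have "f (s, \<theta>, t) = f (s', \<theta>', t)"
      using assms(2,3) t unfolding doubly_periodic_def s th by auto
    moreover have "norm (f (s', \<theta>', t)) \<le> M" using M s th t by auto
    ultimately show "\<bar>f (s, \<theta>, t)\<bar> \<le> max M 1" by simp
  qed
qed

text \<open>
  The Gudermannian function turns Mercator's coordinate into the latitude.  In Mercator's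
  coordinates the round metric is conformally flat with factor \<open>1 / cosh\<^sup>2\<close>.
\<close>

definition gd :: "real \<Rightarrow> real" where "gd s = arctan (sinh s)"

lemma cos_gd [simp]: "cos (gd s) = 1 / cosh s"
  and sin_gd [simp]: "sin (gd s) = tanh s"
  and tan_gd [simp]: "tan (gd s) = sinh s"
proof -
  have "sqrt (1 + (sinh s)\<^sup>2) = cosh s"
    using cosh_square_eq[of s] by (simp add: add.commute real_sqrt_unique)
  then show "cos (gd s) = 1 / cosh s" "sin (gd s) = tanh s" "tan (gd s) = sinh s"
    by (simp_all add: gd_def cos_arctan sin_arctan tan_arctan tanh_def)
qed

lemma gd_bounds: "- (pi / 2) < gd s" "gd s < pi / 2"
  using arctan_bounded[of "sinh s"] by (simp_all add: gd_def)

lemma gd_surj: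
  assumes "- (pi / 2) < \<psi>" "\<psi> < pi / 2"
  obtains s where "\<psi> = gd s"
  using that[of "arsinh (tan \<psi>)"] arctan_tan assms by (simp add: gd_def)

lemma DERIV_gd [derivative_intros]:
  assumes "(f has_real_derivative D) (at x within A)"
  shows "((\<lambda>x. gd (f x)) has_real_derivative D / cosh (f x)) (at x within A)"
proof -
  have "1 + (sinh (f x))\<^sup>2 = cosh (f x) * cosh (f x)"
    using cosh_square_eq[of "f x"] by (simp add: power2_eq_square)
  then show ?thesis unfolding gd_def
    by (auto intro!: derivative_eq_intros assms simp: field_simps)
qed

lemma DERIV_tanh_cosh: "(tanh has_real_derivative 1 / (cosh s)\<^sup>2) (at (s::real))"
proof -
  have c: "cosh s \<noteq> 0" using cosh_real_pos[of s] by simp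
  have "1 - (tanh s)\<^sup>2 = ((cosh s)\<^sup>2 - (sinh s)\<^sup>2) / (cosh s)\<^sup>2"
    using c by (simp add: tanh_def power_divide diff_divide_distrib)
  also have "\<dots> = 1 / (cosh s)\<^sup>2" by (simp add: cosh_square_eq)
  finally have eq: "1 - (tanh s)\<^sup>2 = 1 / (cosh s)\<^sup>2" .
  have "(tanh has_real_derivative 1 - (tanh s)\<^sup>2) (at s)"
    using c by (auto intro!: derivative_eq_intros)
  then show ?thesis by (simp only: eq)
qed

lemma sphere_point_periodic:
  "sphere_point (\<psi> + 2 * pi * of_int k) (\<theta> + 2 * pi * of_int l) = sphere_point \<psi> \<theta>"
  by (simp only: sphere_point_def sin_add cos_add sin_int_2pin cos_int_2pin mult_zero_right
      mult_1_right diff_zero add_0_right)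

text \<open>Continuing past a pole leads down the opposite meridian. With periodicity, this reduces
  every real \<psi> to the usual range of latitudes.\<close>

lemma sphere_point_antipodal_meridian: "sphere_point (pi - \<psi>) (\<theta> + pi) = sphere_point \<psi> \<theta>"
  by (simp add: sphere_point_def sin_diff cos_diff)

section \<open>The flow equation in the two coordinate systems\<close>

locale sphere_flow =
  fixes u :: "real^3 \<Rightarrow> real \<Rightarrow> real"
  assumes u_smooth: "smooth_on (sphere 0 1 \<times> {..<0}) (\<lambda>(p, t). u p t)"
    and u_pos: "\<forall>p\<in>sphere 0 1. \<forall>t<0. u p t > 0"
    and u_eq: "\<forall>t<0. \<forall>\<psi>\<in>{-pi/2<..<pi/2}. \<forall>\<theta>\<in>{0..2*pi}.
        ((\<lambda>s. u (sphere_point \<psi> \<theta>) s) has_real_derivative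
           sphere_laplacian (\<lambda>\<psi>' \<theta>'. ln (u (sphere_point \<psi>' \<theta>') t)) \<psi> \<theta> - 2) (at t)"
begin

definition lu :: "real \<times> real \<times> real \<Rightarrow> real" where
  "lu x = ln (u (sphere_point (fst x) (fst (snd x))) (snd (snd x)))"

text \<open>Since the round metric is \<open>cosh^(-2)\<close> times ds^2 + d\<theta>^2, the
  evolving metric is \<open>exp (- ell)\<close> times ds^2 + d\<theta>^2.\<close>

definition ell :: "real \<times> real \<times> real \<Rightarrow> real" where
  "ell x = 2 * ln (cosh (fst x)) - lu (gd (fst x), snd x)"

lemma u_gt_0 [simp]: "t < 0 \<Longrightarrow> u (sphere_point \<psi> \<theta>) t > 0"
  using u_pos sphere_point_in_sphere by blast

lemma smooth_lu: "smooth_slab lu"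
  unfolding lu_def by (intro smooth_intros smooth_on_sphere_slab u_smooth) (simp add: slab_def)

lemma exp_lu: "t < 0 \<Longrightarrow> exp (lu (\<psi>, \<theta>, t)) = u (sphere_point \<psi> \<theta>) t"
  by (simp add: lu_def)

lemma periodic_lu: "doubly_periodic lu"
  by (simp add: doubly_periodic_def lu_def sphere_point_periodic)

lemma smooth_ell: "smooth_slab ell"
proof -
  have "smooth_slab (\<lambda>x. lu (gd (fst x), snd x))"
  proof (rule C_infinity_on_compose[OF open_slab _ smooth_lu])
    show "(gd (fst x), snd x) \<in> slab" if "x \<in> slab" for x using that by (simp add: slab_def)
    fix b :: "real \<times> real \<times> real" assume "b \<in> Basis"
    then have "b = (1, 0, 0) \<or> b = (0, 1, 0) \<or> b = (0, 0, 1)" by (auto simp: Basis_prod_def zero_prod_def)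
    then show "smooth_slab (\<lambda>x. (gd (fst x), snd x) \<bullet> b)"
      unfolding gd_def by (auto intro!: smooth_intros simp: inner_prod_def)
  qed
  then show ?thesis unfolding ell_def
    by (intro smooth_intros open_slab) (auto simp: cosh_real_pos)
qed

lemma exp_ell: "t < 0 \<Longrightarrow> exp (ell (s, \<theta>, t)) = (cosh s)\<^sup>2 / u (sphere_point (gd s) \<theta>) t"
  by (simp add: ell_def exp_diff exp_lu cosh_real_pos exp_double)

lemma periodic_ell: "t < 0 \<Longrightarrow> ell (s, \<theta> + 2 * pi * of_int k, t) = ell (s, \<theta>, t)"
  using periodic_lu[unfolded doubly_periodic_def, rule_format, of t _ 0] by (simp add: ell_def)

text \<open>The derivative of \<open>gd\<close> is \<open>1 / cosh\<close>, so the contribution of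
  \<open>lu\<close> to the s-derivative dies out at the poles; what survives is 2 tanh s, the
  derivative of 2 ln cosh s. This is the origin of the limits 2 and -2.\<close>

lemma pd_ell:
  assumes "t < 0"
  shows "pd1 ell (s, \<theta>, t) = 2 * tanh s - pd1 lu (gd s, \<theta>, t) / cosh s"
    "pd2 ell (s, \<theta>, t) = - pd2 lu (gd s, \<theta>, t)"
    "pd3 ell (s, \<theta>, t) = - pd3 lu (gd s, \<theta>, t)"
    "pd2 (pd2 ell) (s, \<theta>, t) = - pd2 (pd2 lu) (gd s, \<theta>, t)"
    "pd1 (pd1 ell) (s, \<theta>, t) = (2 + sinh s * pd1 lu (gd s, \<theta>, t) - pd1 (pd1 lu) (gd s, \<theta>, t)) / (cosh s)\<^sup>2"
proof -
  note chain = DERIV_chain2[OF pd1_deriv[OF _ assms] DERIV_gd[OF DERIV_ident]]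
  have c: "cosh x \<noteq> 0" "cosh x > 0" for x :: real using cosh_real_pos[of x] by auto
  have 1: "pd1 ell (s, \<theta>, t) = 2 * tanh s - pd1 lu (gd s, \<theta>, t) / cosh s" for s
  proof -
    have "((\<lambda>s. ell (s, \<theta>, t)) has_real_derivative 2 * tanh s - pd1 lu (gd s, \<theta>, t) / cosh s) (at s)"
      unfolding ell_def
      by (auto intro!: derivative_eq_intros chain[OF smooth_lu] simp: c tanh_def)
    then show ?thesis by (rule DERIV_unique[OF pd1_deriv[OF smooth_ell assms]])
  qed
  show "pd1 ell (s, \<theta>, t) = 2 * tanh s - pd1 lu (gd s, \<theta>, t) / cosh s" by (rule 1)
  have "((\<lambda>s. 2 * tanh s - pd1 lu (gd s, \<theta>, t) / cosh s) has_real_derivative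
    2 * (1 / (cosh s)\<^sup>2) - ((pd1 (pd1 lu) (gd s, \<theta>, t) * (1 / cosh s)) * cosh s
      - pd1 lu (gd s, \<theta>, t) * (sinh s * 1)) / (cosh s * cosh s)) (at s)"
    by (intro DERIV_diff DERIV_cmult DERIV_divide chain[OF smooth_slab_pd(1)[OF smooth_lu]]
        DERIV_tanh_cosh has_field_derivative_cosh[OF DERIV_ident] c)
  also have "2 * (1 / (cosh s)\<^sup>2) - ((pd1 (pd1 lu) (gd s, \<theta>, t) * (1 / cosh s)) * cosh s
      - pd1 lu (gd s, \<theta>, t) * (sinh s * 1)) / (cosh s * cosh s) =
      (2 + sinh s * pd1 lu (gd s, \<theta>, t) - pd1 (pd1 lu) (gd s, \<theta>, t)) / (cosh s)\<^sup>2"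
    using c[of s] by (simp add: field_simps power2_eq_square)
  finally have "((\<lambda>s. 2 * tanh s - pd1 lu (gd s, \<theta>, t) / cosh s) has_real_derivative
    (2 + sinh s * pd1 lu (gd s, \<theta>, t) - pd1 (pd1 lu) (gd s, \<theta>, t)) / (cosh s)\<^sup>2) (at s)" .
  then show "pd1 (pd1 ell) (s, \<theta>, t) = (2 + sinh s * pd1 lu (gd s, \<theta>, t) - pd1 (pd1 lu) (gd s, \<theta>, t)) / (cosh s)\<^sup>2"
    by (rule DERIV_unique[OF pd1_deriv[OF smooth_slab_pd(1)[OF smooth_ell] assms, of \<theta>, unfolded 1]])
  have 2: "pd2 ell (s, \<theta>, t) = - pd2 lu (gd s, \<theta>, t)" for \<theta>
  proof -
    have "((\<lambda>\<theta>. ell (s, \<theta>, t)) has_real_derivative - pd2 lu (gd s, \<theta>, t)) (at \<theta>)"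
      unfolding ell_def
      by (auto intro!: derivative_eq_intros pd2_deriv smooth_lu assms)
    then show ?thesis by (rule DERIV_unique[OF pd2_deriv[OF smooth_ell assms]])
  qed
  show "pd2 ell (s, \<theta>, t) = - pd2 lu (gd s, \<theta>, t)" by (rule 2)
  have "((\<lambda>\<theta>. - pd2 lu (gd s, \<theta>, t)) has_real_derivative - pd2 (pd2 lu) (gd s, \<theta>, t)) (at \<theta>)"
    by (auto intro!: derivative_eq_intros pd2_deriv smooth_lu assms smooth_slab_pd)
  then show "pd2 (pd2 ell) (s, \<theta>, t) = - pd2 (pd2 lu) (gd s, \<theta>, t)"
    by (rule DERIV_unique[OF pd2_deriv[OF smooth_slab_pd(2)[OF smooth_ell] assms, of s, unfolded 2]])
  have "((\<lambda>t. ell (s, \<theta>, t)) has_real_derivative - pd3 lu (gd s, \<theta>, t)) (at t)"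
    unfolding ell_def
    by (auto intro!: derivative_eq_intros pd3_deriv smooth_lu assms)
  then show "pd3 ell (s, \<theta>, t) = - pd3 lu (gd s, \<theta>, t)"
    by (rule DERIV_unique[OF pd3_deriv[OF smooth_ell assms]])
qed

lemma lu_eq:
  assumes "t < 0" "- (pi / 2) < \<psi>" "\<psi> < pi / 2"
  shows "u (sphere_point \<psi> \<theta>) t * pd3 lu (\<psi>, \<theta>, t) = pd1 (pd1 lu) (\<psi>, \<theta>, t)
     - tan \<psi> * pd1 lu (\<psi>, \<theta>, t) + (1 / cos \<psi>)\<^sup>2 * pd2 (pd2 lu) (\<psi>, \<theta>, t) - 2"
proof -
  have *: "u (sphere_point \<psi> \<theta>) t * pd3 lu (\<psi>, \<theta>, t) = pd1 (pd1 lu) (\<psi>, \<theta>, t)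
     - tan \<psi> * pd1 lu (\<psi>, \<theta>, t) + (1 / cos \<psi>)\<^sup>2 * pd2 (pd2 lu) (\<psi>, \<theta>, t) - 2"
    if th: "0 \<le> \<theta>" "\<theta> \<le> 2 * pi" for \<theta>
  proof -
    have d1: "deriv (\<lambda>s. lu (s, \<theta>, t)) = (\<lambda>s. pd1 lu (s, \<theta>, t))"
      "deriv (\<lambda>s. pd1 lu (s, \<theta>, t)) = (\<lambda>s. pd1 (pd1 lu) (s, \<theta>, t))" for \<theta>
      using pd1_deriv[OF smooth_lu assms(1)] pd1_deriv[OF smooth_slab_pd(1)[OF smooth_lu] assms(1)]
        DERIV_imp_deriv by blast+
    have d2: "deriv (\<lambda>\<theta>. lu (\<psi>, \<theta>, t)) = (\<lambda>\<theta>. pd2 lu (\<psi>, \<theta>, t))"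
      "deriv (\<lambda>\<theta>. pd2 lu (\<psi>, \<theta>, t)) = (\<lambda>\<theta>. pd2 (pd2 lu) (\<psi>, \<theta>, t))"
      using pd2_deriv[OF smooth_lu assms(1)] pd2_deriv[OF smooth_slab_pd(2)[OF smooth_lu] assms(1)]
        DERIV_imp_deriv by blast+
    have "sphere_laplacian (\<lambda>\<psi>' \<theta>'. ln (u (sphere_point \<psi>' \<theta>') t)) \<psi> \<theta> =
        sphere_laplacian (\<lambda>\<psi>' \<theta>'. lu (\<psi>', \<theta>', t)) \<psi> \<theta>"
      by (simp add: lu_def)
    also have "\<dots> = pd1 (pd1 lu) (\<psi>, \<theta>, t) - tan \<psi> * pd1 lu (\<psi>, \<theta>, t)
        + (1 / cos \<psi>)\<^sup>2 * pd2 (pd2 lu) (\<psi>, \<theta>, t)"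
      unfolding sphere_laplacian_def by (simp add: numeral_2_eq_2 d1 d2)
    finally have "((\<lambda>s. u (sphere_point \<psi> \<theta>) s) has_real_derivative pd1 (pd1 lu) (\<psi>, \<theta>, t)
        - tan \<psi> * pd1 lu (\<psi>, \<theta>, t) + (1 / cos \<psi>)\<^sup>2 * pd2 (pd2 lu) (\<psi>, \<theta>, t) - 2) (at t)"
      using u_eq assms th by (metis atLeastAtMost_iff greaterThanLessThan_iff minus_divide_left)
    moreover have "((\<lambda>t. u (sphere_point \<psi> \<theta>) t) has_real_derivative
        u (sphere_point \<psi> \<theta>) t * pd3 lu (\<psi>, \<theta>, t)) (at t)"
    proof (rule has_field_derivative_transform_within_open[where S = "{..<0}"])
      show "((\<lambda>t. exp (lu (\<psi>, \<theta>, t))) has_real_derivative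
        u (sphere_point \<psi> \<theta>) t * pd3 lu (\<psi>, \<theta>, t)) (at t)"
        using DERIV_fun_exp[OF pd3_deriv[OF smooth_lu assms(1)]] exp_lu[OF assms(1)] by simp
    qed (use assms exp_lu in auto)
    ultimately show ?thesis using DERIV_unique by blast
  qed
  \<comment> \<open>The equation is assumed for longitudes in one period; periodicity of all its
    terms extends it to every \<theta>.\<close>
  obtain \<theta>' k where th: "\<theta> = \<theta>' + 2 * pi * of_int k" "0 \<le> \<theta>'" "\<theta>' \<le> 2 * pi"
    by (rule ex_period_representative)
  note P = smooth_lu periodic_lu doubly_periodic_pd smooth_slab_pd
  have per: "f (\<psi>, \<theta>, t) = f (\<psi>, \<theta>', t)" if "doubly_periodic f" for f
    using that[unfolded doubly_periodic_def, rule_format, of t \<psi> 0] assms(1) th by simp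
  have "sphere_point \<psi> \<theta> = sphere_point \<psi> \<theta>'"
    using sphere_point_periodic[of \<psi> 0] th by simp
  then show ?thesis using *[OF th(2,3)] by (simp add: per P)
qed

text \<open>The spherical Laplacian is \<open>cosh^2\<close> times the flat one in (s, \<theta>).
  The summand 2 ln cosh s has spherical Laplacian 2 and thereby absorbs the constant -2 of the
  flow.\<close>

lemma ell_eq:
  assumes "t < 0"
  shows "pd3 ell (s, \<theta>, t) = exp (ell (s, \<theta>, t)) * (pd1 (pd1 ell) (s, \<theta>, t) + pd2 (pd2 ell) (s, \<theta>, t))"
proof -
  have c: "cosh s > 0" by (rule cosh_real_pos)
  have "pd3 ell (s, \<theta>, t) = - (u (sphere_point (gd s) \<theta>) t * pd3 lu (gd s, \<theta>, t)) / u (sphere_point (gd s) \<theta>) t"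
    using u_gt_0[OF assms, of "gd s" \<theta>] by (simp add: pd_ell[OF assms])
  also have "\<dots> = exp (ell (s, \<theta>, t)) * (pd1 (pd1 ell) (s, \<theta>, t) + pd2 (pd2 ell) (s, \<theta>, t))"
    unfolding lu_eq[OF assms gd_bounds] pd_ell[OF assms] exp_ell[OF assms]
    using c u_gt_0[OF assms, of "gd s" \<theta>] by (simp add: field_simps power2_eq_square)
  finally show ?thesis .
qed

end

section \<open>Maximum principle and monotonicity in time\<close>

text \<open>One-sided, because the maximum over a time interval may sit at its final time, where
  only earlier times are available for comparison.\<close>

lemma DERIV_nonneg_left_max:
  fixes g :: "real \<Rightarrow> real"
  assumes "(g has_real_derivative D) (at x)" "a < x" "\<And>y. a \<le> y \<Longrightarrow> y \<le> x \<Longrightarrow> g y \<le> g x"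
  shows "D \<ge> 0"
proof (rule ccontr)
  assume "\<not> D \<ge> 0"
  then obtain d where d: "d > 0" "\<And>h. 0 < h \<Longrightarrow> h < d \<Longrightarrow> g x < g (x - h)"
    using DERIV_neg_dec_left[OF assms(1)] by auto
  define h where "h = min (d / 2) (x - a)"
  have "0 < h" "h < d" "a \<le> x - h" "x - h \<le> x" using d(1) assms(2) by (auto simp: h_def)
  then show False using d(2)[of h] assms(3)[of "x - h"] by linarith
qed

text \<open>At a maximum g' vanishes; a positive second derivative would make g' positive just to
  the right, and the mean value theorem would give a larger value of g there.\<close>

lemma DERIV_global_max:
  fixes g :: "real \<Rightarrow> real"
  assumes "\<And>x. (g has_real_derivative g' x) (at x)" "(g' has_real_derivative D) (at x0)"
    "\<And>x. g x \<le> g x0"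
  shows "D \<le> 0"
proof (rule ccontr)
  assume "\<not> D \<le> 0"
  have z: "g' x0 = 0"
    using DERIV_local_max[OF assms(1), of 1 x0] assms(3) by simp
  obtain d where d: "d > 0" "\<And>h. 0 < h \<Longrightarrow> h < d \<Longrightarrow> g' x0 < g' (x0 + h)"
    using DERIV_pos_inc_right[OF assms(2)] \<open>\<not> D \<le> 0\<close> by auto
  obtain \<xi> where "x0 < \<xi>" "\<xi> < x0 + d / 2" "g (x0 + d / 2) - g x0 = (x0 + d / 2 - x0) * g' \<xi>"
    using MVT2[of x0 "x0 + d / 2" g g'] assms(1) d(1) by auto
  moreover from this have "g' \<xi> > 0" using d(2)[of "\<xi> - x0"] d(1) z by auto
  ultimately have "g (x0 + d / 2) - g x0 = d / 2 * g' \<xi>" "d / 2 * g' \<xi> > 0" using d(1) by auto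
  then show False using assms(3)[of "x0 + d / 2"] by linarith
qed

lemma ln_cosh_ge: "\<bar>s\<bar> \<le> 1 + ln (cosh (s::real))"
proof -
  have "exp \<bar>s\<bar> \<le> 2 * cosh s"
    using cosh_real_pos[of s] by (cases "s \<ge> 0") (auto simp: cosh_def field_simps)
  then have "\<bar>s\<bar> \<le> ln (2 * cosh s)" by (simp add: ln_ge_iff cosh_real_pos)
  also have "\<dots> = ln 2 + ln (cosh s)" by (simp add: ln_mult cosh_real_pos)
  finally show ?thesis using ln_2_less_1 by linarith
qed

text \<open>
  The barrier \<open>1 + ln (cosh s)\<close> tends to infinity at the poles, while its second derivative
  \<open>1 / cosh\<^sup>2 s\<close> compensates the growth of the coefficient \<open>a\<close>; it keeps the maximum away from the poles.
\<close>

lemma parabolic_max_principle: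
  fixes f f1 f11 f2 f22 f3 a :: "real \<times> real \<times> real \<Rightarrow> real"
  assumes cont: "continuous_on (UNIV \<times> UNIV \<times> {t0..t1}) f"
    and per: "\<And>s \<theta> t k. t0 \<le> t \<Longrightarrow> t \<le> t1 \<Longrightarrow> f (s, \<theta> + 2 * pi * of_int k, t) = f (s, \<theta>, t)"
    and bdd: "\<And>s \<theta> t. t0 \<le> t \<Longrightarrow> t \<le> t1 \<Longrightarrow> f (s, \<theta>, t) \<le> M"
    and init: "\<And>s \<theta>. f (s, \<theta>, t0) \<le> 0"
    and d1: "\<And>s \<theta> t. t0 < t \<Longrightarrow> t \<le> t1 \<Longrightarrow> ((\<lambda>s. f (s, \<theta>, t)) has_real_derivative f1 (s, \<theta>, t)) (at s)"
    and d11: "\<And>s \<theta> t. t0 < t \<Longrightarrow> t \<le> t1 \<Longrightarrow> ((\<lambda>s. f1 (s, \<theta>, t)) has_real_derivative f11 (s, \<theta>, t)) (at s)"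
    and d2: "\<And>s \<theta> t. t0 < t \<Longrightarrow> t \<le> t1 \<Longrightarrow> ((\<lambda>\<theta>. f (s, \<theta>, t)) has_real_derivative f2 (s, \<theta>, t)) (at \<theta>)"
    and d22: "\<And>s \<theta> t. t0 < t \<Longrightarrow> t \<le> t1 \<Longrightarrow> ((\<lambda>\<theta>. f2 (s, \<theta>, t)) has_real_derivative f22 (s, \<theta>, t)) (at \<theta>)"
    and d3: "\<And>s \<theta> t. t0 < t \<Longrightarrow> t \<le> t1 \<Longrightarrow> ((\<lambda>t. f (s, \<theta>, t)) has_real_derivative f3 (s, \<theta>, t)) (at t)"
    and ineq: "\<And>s \<theta> t. t0 < t \<Longrightarrow> t \<le> t1 \<Longrightarrow> f (s, \<theta>, t) > 0 \<Longrightarrow>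
      f3 (s, \<theta>, t) \<le> a (s, \<theta>, t) * (f11 (s, \<theta>, t) + f22 (s, \<theta>, t)) + B * f (s, \<theta>, t)"
    and a: "\<And>s \<theta> t. t0 < t \<Longrightarrow> t \<le> t1 \<Longrightarrow> 0 \<le> a (s, \<theta>, t)"
      "\<And>s \<theta> t. t0 < t \<Longrightarrow> t \<le> t1 \<Longrightarrow> a (s, \<theta>, t) \<le> B' * (cosh s)\<^sup>2"
    and B: "0 \<le> B" "0 \<le> B'"
    and \<tau>: "t0 \<le> \<tau>" "\<tau> \<le> t1"
  shows "f (s0, \<theta>0, \<tau>) \<le> 0"
proof (rule ccontr)
  assume "\<not> f (s0, \<theta>0, \<tau>) \<le> 0"
  then have pos: "f (s0, \<theta>0, \<tau>) > 0" by simp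
  \<comment> \<open>The exponential decay has to beat the reaction constant \<open>B\<close> and the
    error \<open>B'\<close> caused by the barrier; the summand 1 is the surplus that yields the
    contradiction.\<close>
  define A where "A = B + B' + 1"
  define \<phi> where "\<phi> s = 1 + ln (cosh s)" for s :: real
  have \<phi>1: "\<phi> s \<ge> 1" for s using cosh_real_ge_1[of s] by (simp add: \<phi>_def)
  have \<phi>abs: "\<phi> s \<ge> \<bar>s\<bar>" for s using ln_cosh_ge[of s] by (simp add: \<phi>_def)
  \<comment> \<open>Half of the weighted positive value at (s0, \<theta>0, \<tau>) is given away to
    the barrier, so \<open>F\<close> stays positive there.\<close>
  define \<delta> where "\<delta> = exp (- A * (\<tau> - t0)) * f (s0, \<theta>0, \<tau>) / (2 * \<phi> s0)"
  have \<delta>: "\<delta> > 0" using pos \<phi>1[of s0] by (simp add: \<delta>_def)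
  define F where "F = (\<lambda>(s, \<theta>, t). exp (- A * (t - t0)) * f (s, \<theta>, t) - \<delta> * \<phi> s)"
  have Fp: "F (s0, \<theta>0, \<tau>) > 0"
    using pos \<phi>1[of s0] by (simp add: F_def \<delta>_def)
  \<comment> \<open>Beyond \<open>L\<close> the barrier exceeds |M| and \<open>F\<close> is
    nonpositive, so a positive maximum over the compact set below is global; |s0| keeps s0
    inside.\<close>
  define L where "L = \<bar>s0\<bar> + \<bar>M\<bar> / \<delta>"
  have A0: "A > 0" using B by (simp add: A_def)
  have far: "F (s, \<theta>, t) \<le> 0" if "\<bar>s\<bar> > L" "t0 \<le> t" "t \<le> t1" for s \<theta> t
  proof -
    have "exp (- A * (t - t0)) \<le> 1" using A0 that by (simp add: mult_nonneg_nonneg)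
    then have "exp (- A * (t - t0)) * f (s, \<theta>, t) \<le> \<bar>M\<bar>"
      using bdd[OF that(2,3), of s \<theta>] mult_right_mono[of "exp (- A * (t - t0))" 1 "f (s, \<theta>, t)"]
        mult_nonneg_nonpos[of "exp (- A * (t - t0))" "f (s, \<theta>, t)"]
      by (cases "f (s, \<theta>, t) \<ge> 0") auto
    also have "\<dots> \<le> \<delta> * L" using \<delta> by (simp add: L_def field_simps)
    also have "\<dots> \<le> \<delta> * \<phi> s" using \<delta> \<phi>abs[of s] that(1) by simp
    finally show ?thesis by (simp add: F_def)
  qed
  let ?K = "{-L..L} \<times> {0..2*pi} \<times> {t0..t1}"
  have contF: "continuous_on ?K F"
  proof -
    have "continuous_on ?K (\<lambda>x. exp (- A * (snd (snd x) - t0)) * f x - \<delta> * \<phi> (fst x))"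
      unfolding \<phi>_def
      by (intro continuous_intros continuous_on_subset[OF cont]) (auto simp: cosh_real_nonzero)
    then show ?thesis by (simp add: F_def split_beta)
  qed
  have perF: "\<exists>\<theta>'. 0 \<le> \<theta>' \<and> \<theta>' \<le> 2 * pi \<and> F (s, \<theta>, t) = F (s, \<theta>', t)"
    if "t0 \<le> t" "t \<le> t1" for s \<theta> t
  proof -
    obtain \<theta>' k where "\<theta> = \<theta>' + 2 * pi * of_int k" "0 \<le> \<theta>'" "\<theta>' \<le> 2 * pi"
      by (rule ex_period_representative)
    then show ?thesis using per[OF that, of s \<theta>' k] by (auto simp: F_def)
  qed
  have L0: "\<bar>s0\<bar> \<le> L" using \<delta> by (simp add: L_def)
  have "compact ?K" "?K \<noteq> {}" using L0 \<tau> by (auto intro!: compact_Times)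
  then obtain x where x: "x \<in> ?K" "\<And>y. y \<in> ?K \<Longrightarrow> F y \<le> F x"
    using continuous_attains_sup[OF _ _ contF] by blast
  obtain s \<theta> t where x_eq: "x = (s, \<theta>, t)" by (cases x)
  have t: "t0 \<le> t" "t \<le> t1" using x(1) x_eq by auto
  have K: "F (s', \<theta>', t') \<le> F (s, \<theta>, t)" if "\<bar>s'\<bar> \<le> L" "t0 \<le> t'" "t' \<le> t1" for s' \<theta>' t'
  proof -
    obtain \<theta>'' where "0 \<le> \<theta>''" "\<theta>'' \<le> 2 * pi" and eq: "F (s', \<theta>', t') = F (s', \<theta>'', t')"
      using perF \<open>t0 \<le> t'\<close> \<open>t' \<le> t1\<close> by blast
    then have "(s', \<theta>'', t') \<in> ?K" using that by auto
    from x(2)[OF this] show ?thesis unfolding eq x_eq .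
  qed
  have Fx: "F (s, \<theta>, t) > 0" using K[OF L0 \<tau>, of \<theta>0] Fp by linarith
  have glob: "F (s', \<theta>', t') \<le> F (s, \<theta>, t)" if "t0 \<le> t'" "t' \<le> t1" for s' \<theta>' t'
    using K[of s' t' \<theta>'] far[of s' t' \<theta>'] that Fx by linarith
  define e where "e = exp (- A * (t - t0))"
  have e: "e > 0" "e \<le> 1" using A0 t by (auto simp: e_def mult_nonneg_nonneg)
  have ef: "e * f (s, \<theta>, t) > \<delta> * \<phi> s" using Fx by (simp add: F_def e_def)
  have "0 < \<delta> * \<phi> s" using \<delta> \<phi>1[of s] by simp
  then have f_pos: "f (s, \<theta>, t) > 0" using ef e by (meson less_trans zero_less_mult_pos)
  have "t \<noteq> t0" using f_pos init[of s \<theta>] by auto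
  then have t': "t0 < t" using t by simp
  have "e * f11 (s, \<theta>, t) - \<delta> * (1 / (cosh s)\<^sup>2) \<le> 0"
  proof (rule DERIV_global_max)
    show "((\<lambda>s. F (s, \<theta>, t)) has_real_derivative e * f1 (x, \<theta>, t) - \<delta> * tanh x) (at x)" for x
      unfolding F_def \<phi>_def e_def prod.case
      by (auto intro!: derivative_eq_intros d1[OF t' t(2)] simp: tanh_def)
    show "((\<lambda>x. e * f1 (x, \<theta>, t) - \<delta> * tanh x) has_real_derivative
        e * f11 (s, \<theta>, t) - \<delta> * (1 / (cosh s)\<^sup>2)) (at s)"
      by (intro DERIV_diff DERIV_cmult d11[OF t' t(2)] DERIV_tanh_cosh)
  qed (use glob t in auto)
  moreover have "e * f22 (s, \<theta>, t) \<le> 0"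
  proof (rule DERIV_global_max)
    show "((\<lambda>\<theta>. F (s, \<theta>, t)) has_real_derivative e * f2 (s, x, t)) (at x)" for x
      unfolding F_def \<phi>_def e_def prod.case
      by (auto intro!: derivative_eq_intros d2[OF t' t(2)])
    show "((\<lambda>x. e * f2 (s, x, t)) has_real_derivative e * f22 (s, \<theta>, t)) (at \<theta>)"
      by (intro DERIV_cmult d22[OF t' t(2)])
  qed (use glob t in auto)
  ultimately have lap: "e * (f11 (s, \<theta>, t) + f22 (s, \<theta>, t)) \<le> \<delta> / (cosh s)\<^sup>2"
    by (simp add: distrib_left)
  have "e * f3 (s, \<theta>, t) - A * (e * f (s, \<theta>, t)) \<ge> 0"
  proof (rule DERIV_nonneg_left_max)
    show "((\<lambda>t. F (s, \<theta>, t)) has_real_derivative e * f3 (s, \<theta>, t) - A * (e * f (s, \<theta>, t))) (at t)"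
      unfolding F_def \<phi>_def e_def prod.case
      by (auto intro!: derivative_eq_intros d3[OF t' t(2)] simp: algebra_simps)
  qed (use glob t t' in auto)
  then have "A * (e * f (s, \<theta>, t)) \<le> e * (a (s, \<theta>, t) * (f11 (s, \<theta>, t) + f22 (s, \<theta>, t)) + B * f (s, \<theta>, t))"
    using mult_left_mono[OF ineq[OF t' t(2) f_pos], of e] e by linarith
  also have "\<dots> = a (s, \<theta>, t) * (e * (f11 (s, \<theta>, t) + f22 (s, \<theta>, t))) + B * (e * f (s, \<theta>, t))"
    by (simp add: algebra_simps)
  also have "\<dots> \<le> B' * \<delta> + B * (e * f (s, \<theta>, t))"
  proof -
    have c: "cosh s > 0" by (rule cosh_real_pos)
    have "a (s, \<theta>, t) * (e * (f11 (s, \<theta>, t) + f22 (s, \<theta>, t))) \<le> a (s, \<theta>, t) * (\<delta> / (cosh s)\<^sup>2)"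
      using lap a(1)[OF t' t(2)] by (rule mult_left_mono)
    also have "\<dots> \<le> B' * (cosh s)\<^sup>2 * (\<delta> / (cosh s)\<^sup>2)"
      using a(2)[OF t' t(2)] \<delta> c by (intro mult_right_mono) auto
    also have "\<dots> = B' * \<delta>" using c by simp
    finally show ?thesis by simp
  qed
  \<comment> \<open>At a point where \<open>F\<close> is positive the barrier lies below
    \<open>e * f\<close>, so its error turns into a multiple of \<open>e * f\<close>, which
    \<open>A\<close> was chosen to dominate.\<close>
  also have "B' * \<delta> \<le> B' * (e * f (s, \<theta>, t))"
  proof (rule mult_left_mono[OF _ B(2)])
    have "\<delta> * 1 \<le> \<delta> * \<phi> s" using \<delta> \<phi>1[of s] by (intro mult_left_mono) auto
    then show "\<delta> \<le> e * f (s, \<theta>, t)" using ef by simp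
  qed
  finally have "e * f (s, \<theta>, t) \<le> 0" by (simp add: A_def algebra_simps)
  then show False using e f_pos by (simp add: mult_le_0_iff)
qed

section \<open>Comparison with rescaled solutions\<close>

context sphere_flow
begin

lemma lu_bounds:
  assumes "t1 < 0"
  obtains M where "M > 0" "\<And>\<psi> \<theta> t. T \<le> t \<Longrightarrow> t \<le> t1 \<Longrightarrow> \<bar>lu (\<psi>, \<theta>, t)\<bar> \<le> M"
  using doubly_periodic_bounded[OF C_infinity_onD(3)[OF smooth_lu] periodic_lu assms] by blast

lemma exp_ell_bounds:
  assumes "t1 < 0"
  obtains M where "M > 0" "\<And>s \<theta> t. T \<le> t \<Longrightarrow> t \<le> t1 \<Longrightarrow> exp (ell (s, \<theta>, t)) \<le> M * (cosh s)\<^sup>2"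
    "\<And>s \<theta> t. T \<le> t \<Longrightarrow> t \<le> t1 \<Longrightarrow> (cosh s)\<^sup>2 \<le> M * exp (ell (s, \<theta>, t))"
proof -
  obtain M where M: "M > 0" "\<And>\<psi> \<theta> t. T \<le> t \<Longrightarrow> t \<le> t1 \<Longrightarrow> \<bar>lu (\<psi>, \<theta>, t)\<bar> \<le> M"
    using lu_bounds[OF assms] by blast
  show ?thesis
  proof
    show "exp M > 0" by simp
    fix s \<theta> t assume t: "T \<le> t" "t \<le> t1"
    have e: "exp (ell (s, \<theta>, t)) = (cosh s)\<^sup>2 * exp (- lu (gd s, \<theta>, t))"
      using t assms by (simp add: exp_ell exp_minus exp_lu field_simps)
    have m: "- M \<le> - lu (gd s, \<theta>, t)" "- lu (gd s, \<theta>, t) \<le> M" using M(2)[OF t, of "gd s" \<theta>] by auto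
    have "exp (- lu (gd s, \<theta>, t)) \<le> exp M" using m by simp
    then show "exp (ell (s, \<theta>, t)) \<le> exp M * (cosh s)\<^sup>2"
      unfolding e by (subst mult.commute) (intro mult_right_mono, auto)
    have "1 \<le> exp M * exp (- lu (gd s, \<theta>, t))" using m by (simp flip: exp_add)
    from mult_left_mono[OF this, of "(cosh s)\<^sup>2"]
    show "(cosh s)\<^sup>2 \<le> exp M * exp (ell (s, \<theta>, t))" unfolding e by (simp add: algebra_simps)
  qed
qed

text \<open>
  The equation is invariant under \<open>u \<mapsto> \<mu> u(\<cdot>, t / \<mu>)\<close>; comparing a solution with its rescalings
  gives the estimate of Aronson and Benilan, and hence monotonicity in time for ancient solutions.
\<close>

lemma scaling_comparison:
  assumes "\<mu> > 1" "t0 \<le> \<tau>" "\<tau> < 0"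
  shows "ell (s, \<theta>, t0 + (\<tau> - t0) / \<mu>) - ell (s, \<theta>, \<tau>) \<le> ln \<mu>"
proof -
  \<comment> \<open>The scaling is centred at t0, so that \<mu> u(., h t) solves the same equation
    and both solutions can be compared from t0 onwards.\<close>
  define h where "h t = t0 + (t - t0) / \<mu>" for t
  have t00: "t0 < 0" using assms by simp
  have h: "t0 \<le> h t" "h t \<le> t" if "t0 \<le> t" for t
  proof -
    have "(t - t0) / \<mu> \<le> (t - t0) / 1" "0 \<le> (t - t0) / \<mu>"
      using that assms(1) by (intro divide_left_mono divide_nonneg_pos; simp)+
    then show "t0 \<le> h t" "h t \<le> t" by (simp_all add: h_def)
  qed
  have h_neg: "h t < 0" if "t0 \<le> t" "t \<le> \<tau>" for t
    using h[OF that(1)] that(2) assms(3) by linarith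
  have h_deriv: "(h has_real_derivative 1 / \<mu>) (at t)" for t
    unfolding h_def using assms(1) by (auto intro!: derivative_eq_intros)
  obtain M where M: "M > 0" "\<And>s \<theta> t. t0 \<le> t \<Longrightarrow> t \<le> \<tau> \<Longrightarrow> exp (ell (s, \<theta>, t)) \<le> M * (cosh s)\<^sup>2"
    by (rule exp_ell_bounds[OF assms(3), of t0]) blast
  obtain M0 where M0: "M0 > 0" "\<And>\<psi> \<theta> t. t0 \<le> t \<Longrightarrow> t \<le> \<tau> \<Longrightarrow> \<bar>lu (\<psi>, \<theta>, t)\<bar> \<le> M0"
    by (rule lu_bounds[OF assms(3), of t0]) blast
  obtain B where B: "B > 0" "\<And>\<psi> \<theta> t. t0 \<le> t \<Longrightarrow> t \<le> \<tau> \<Longrightarrow> \<bar>pd3 lu (\<psi>, \<theta>, t)\<bar> \<le> B"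
    by (rule doubly_periodic_bounded[OF C_infinity_onD(3)[OF smooth_slab_pd(3)[OF smooth_lu]]
        doubly_periodic_pd(3)[OF smooth_lu periodic_lu] assms(3), of t0]) blast
  note sm = smooth_ell smooth_slab_pd
  \<comment> \<open>This is the logarithm of u divided by the rescaled solution; at t0 it equals -
    ln \<mu>, which is negative.\<close>
  define f where "f = (\<lambda>(s, \<theta>, t). ell (s, \<theta>, h t) - ell (s, \<theta>, t) - ln \<mu>)"
  define f1 where "f1 = (\<lambda>(s, \<theta>, t). pd1 ell (s, \<theta>, h t) - pd1 ell (s, \<theta>, t))"
  define f11 where "f11 = (\<lambda>(s, \<theta>, t). pd1 (pd1 ell) (s, \<theta>, h t) - pd1 (pd1 ell) (s, \<theta>, t))"
  define f2 where "f2 = (\<lambda>(s, \<theta>, t). pd2 ell (s, \<theta>, h t) - pd2 ell (s, \<theta>, t))"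
  define f22 where "f22 = (\<lambda>(s, \<theta>, t). pd2 (pd2 ell) (s, \<theta>, h t) - pd2 (pd2 ell) (s, \<theta>, t))"
  define f3 where "f3 = (\<lambda>(s, \<theta>, t). pd3 ell (s, \<theta>, h t) / \<mu> - pd3 ell (s, \<theta>, t))"
  have "f (s, \<theta>, \<tau>) \<le> 0"
  proof (rule parabolic_max_principle[where f = f and ?t0.0 = t0 and ?t1.0 = \<tau> and M = "2 * M0"
        and ?f1.0 = f1 and ?f11.0 = f11 and ?f2.0 = f2 and ?f22.0 = f22 and ?f3.0 = f3
        and a = "\<lambda>x. exp (ell x)" and B = B and B' = M])
    have "continuous_on (UNIV \<times> UNIV \<times> {t0..\<tau>}) (\<lambda>x. ell (fst x, fst (snd x), h (snd (snd x)))
        - ell (fst x, fst (snd x), snd (snd x)) - ln \<mu>)"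
      unfolding h_def using assms h_neg
      by (intro continuous_intros smooth_slab_cont sm) (auto simp: h_def)
    then show "continuous_on (UNIV \<times> UNIV \<times> {t0..\<tau>}) f" by (simp add: f_def split_beta)
    fix s \<theta> t
    {
      fix k assume "t0 \<le> t" "t \<le> \<tau>"
      then show "f (s, \<theta> + 2 * pi * of_int k, t) = f (s, \<theta>, t)"
        using assms h_neg by (simp add: f_def periodic_ell)
    next
      assume t: "t0 \<le> t" "t \<le> \<tau>"
      have "t0 \<le> h t" "h t \<le> \<tau>" using h[OF t(1)] t by auto
      from M0(2)[OF this, of "gd s" \<theta>] M0(2)[OF t, of "gd s" \<theta>]
      show "f (s, \<theta>, t) \<le> 2 * M0" using ln_gt_zero[OF assms(1)] unfolding f_def ell_def by simp
    next
      show "f (s, \<theta>, t0) \<le> 0" using assms(1) by (simp add: f_def h_def)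
    next
      assume t: "t0 < t" "t \<le> \<tau>"
      have n: "h t < 0" "t < 0" using h_neg[of t] t assms by auto
      show "((\<lambda>s. f (s, \<theta>, t)) has_real_derivative f1 (s, \<theta>, t)) (at s)"
        unfolding f_def f1_def prod.case by (auto intro!: derivative_eq_intros pd1_deriv sm n)
      show "((\<lambda>s. f1 (s, \<theta>, t)) has_real_derivative f11 (s, \<theta>, t)) (at s)"
        unfolding f1_def f11_def prod.case by (auto intro!: derivative_eq_intros pd1_deriv sm n)
      show "((\<lambda>\<theta>. f (s, \<theta>, t)) has_real_derivative f2 (s, \<theta>, t)) (at \<theta>)"
        unfolding f_def f2_def prod.case by (auto intro!: derivative_eq_intros pd2_deriv sm n)
      show "((\<lambda>\<theta>. f2 (s, \<theta>, t)) has_real_derivative f22 (s, \<theta>, t)) (at \<theta>)"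
        unfolding f2_def f22_def prod.case by (auto intro!: derivative_eq_intros pd2_deriv sm n)
      show "((\<lambda>t. f (s, \<theta>, t)) has_real_derivative f3 (s, \<theta>, t)) (at t)"
        unfolding f_def f3_def prod.case
        by (auto intro!: derivative_eq_intros DERIV_chain2[OF pd3_deriv h_deriv] pd3_deriv sm n)
      show "0 \<le> exp (ell (s, \<theta>, t))" by simp
      show "exp (ell (s, \<theta>, t)) \<le> M * (cosh s)\<^sup>2" using M(2) t by simp
      assume pos: "f (s, \<theta>, t) > 0"
      let ?V = "exp (ell (s, \<theta>, t))" and ?W = "exp (ell (s, \<theta>, h t))" and ?p = "pd3 ell (s, \<theta>, h t)"
      have W: "?W = ?V * exp (f (s, \<theta>, t)) * \<mu>"
        using assms(1) by (simp add: f_def flip: exp_add) (simp add: exp_diff)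
      have lapW: "pd1 (pd1 ell) (s, \<theta>, h t) + pd2 (pd2 ell) (s, \<theta>, h t) = ?p / ?W"
        using ell_eq[OF n(1), of s \<theta>] by simp
      have "?V * (?p / ?W) = ?p * exp (- f (s, \<theta>, t)) / \<mu>"
        unfolding W using assms(1) by (simp add: exp_minus field_simps)
      then have VW: "?V * (pd1 (pd1 ell) (s, \<theta>, h t) + pd2 (pd2 ell) (s, \<theta>, h t))
          = ?p * exp (- f (s, \<theta>, t)) / \<mu>"
        unfolding lapW .
      have "?V * ((pd1 (pd1 ell) (s, \<theta>, h t) - pd1 (pd1 ell) (s, \<theta>, t))
            + (pd2 (pd2 ell) (s, \<theta>, h t) - pd2 (pd2 ell) (s, \<theta>, t)))
          = ?V * (pd1 (pd1 ell) (s, \<theta>, h t) + pd2 (pd2 ell) (s, \<theta>, h t))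
            - ?V * (pd1 (pd1 ell) (s, \<theta>, t) + pd2 (pd2 ell) (s, \<theta>, t))"
        by (simp add: algebra_simps)
      also have "\<dots> = ?p * exp (- f (s, \<theta>, t)) / \<mu> - pd3 ell (s, \<theta>, t)"
        unfolding VW ell_eq[OF n(2), of s \<theta>] by (rule refl)
      finally have "?p / \<mu> - pd3 ell (s, \<theta>, t) =
          ?V * ((pd1 (pd1 ell) (s, \<theta>, h t) - pd1 (pd1 ell) (s, \<theta>, t))
            + (pd2 (pd2 ell) (s, \<theta>, h t) - pd2 (pd2 ell) (s, \<theta>, t)))
          + ?p / \<mu> * (1 - exp (- f (s, \<theta>, t)))"
        by (simp add: right_diff_distrib)
      \<comment> \<open>The two solutions carry different coefficients in front of the Laplacian.
        Where f is positive, 1 - exp(-f) lies between 0 and f, so this mismatch becomes a term of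
        order zero.\<close>
      also have "?p / \<mu> * (1 - exp (- f (s, \<theta>, t))) \<le> B * f (s, \<theta>, t)"
      proof (rule mult_mono)
        have "?p \<le> B" using B(2)[of "h t" "gd s" \<theta>] h[of t] t by (auto simp: pd_ell[OF n(1)])
        also have "B \<le> B * \<mu>" using B assms(1) by simp
        finally show "?p / \<mu> \<le> B" using assms(1) by (simp add: field_simps)
        show "1 - exp (- f (s, \<theta>, t)) \<le> f (s, \<theta>, t)" using exp_ge_add_one_self[of "- f (s, \<theta>, t)"] by linarith
      qed (use B pos in auto)
      finally show "f3 (s, \<theta>, t) \<le> exp (ell (s, \<theta>, t)) * (f11 (s, \<theta>, t) + f22 (s, \<theta>, t))
          + B * f (s, \<theta>, t)"
        by (simp add: f3_def f11_def f22_def)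
    }
  qed (use assms M B in auto)
  then show ?thesis by (simp add: f_def h_def)
qed

lemma ell_mono:
  assumes "t' \<le> t" "t < 0"
  shows "ell (s, \<theta>, t') \<le> ell (s, \<theta>, t)"
proof (cases "t' = t")
  case False
  then have lt: "t' < t" using assms by simp
  show ?thesis
  proof (rule field_le_epsilon)
    fix \<epsilon> :: real assume \<epsilon>: "\<epsilon> > 0"
    \<comment> \<open>Chosen so that the scaling by 1 + \<epsilon> about t0 maps t to t'. It tends
      to minus infinity as \<epsilon> tends to 0, which is where ancientness enters.\<close>
    define t0 where "t0 = t' - (t - t') / \<epsilon>"
    have "t0 < t'" using lt \<epsilon> by (simp add: t0_def)
    moreover have "t - t0 = (1 + \<epsilon>) * (t' - t0)" using \<epsilon> by (simp add: t0_def field_simps)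
    then have "t0 + (t - t0) / (1 + \<epsilon>) = t'" using \<epsilon> by simp
    ultimately have "ell (s, \<theta>, t') - ell (s, \<theta>, t) \<le> ln (1 + \<epsilon>)"
      using scaling_comparison[of "1 + \<epsilon>" t0 t s \<theta>] \<epsilon> lt assms by simp
    also have "\<dots> \<le> \<epsilon>" using \<epsilon> by (intro ln_add_one_self_le_self) simp
    finally show "ell (s, \<theta>, t') \<le> ell (s, \<theta>, t) + \<epsilon>" by simp
  qed
qed simp

lemma pd3_ell_nonneg:
  assumes "t < 0" shows "pd3 ell (s, \<theta>, t) \<ge> 0"
  by (rule DERIV_nonneg_left_max[OF pd3_deriv[OF smooth_ell assms], of "t - 1"])
    (use ell_mono assms in auto)

end

section \<open>Contraction in the mean and rotational symmetry\<close>

lemma DERIV_sum_of_squares: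
  fixes A B :: "real \<Rightarrow> real"
  assumes "(A has_real_derivative A') (at x)" "(B has_real_derivative B') (at x)"
  shows "((\<lambda>x. (A x - B x)\<^sup>2 + (\<epsilon> * B x)\<^sup>2) has_real_derivative
    2 * ((A x - B x) * (A' - B') + \<epsilon>\<^sup>2 * B x * B')) (at x)"
  by (auto intro!: derivative_eq_intros assms simp: power2_eq_square algebra_simps)

text \<open>With P = exp(-p) and Q = exp(-q), the quotient is an increasing function of P / Q alone,
  since the regularization is proportional to Q. Its derivative is therefore a nonnegative multiple
  of the derivative of ln (P / Q) = q - p.\<close>

lemma DERIV_contraction_multiplier:
  fixes p q :: "real \<Rightarrow> real"
  assumes "(p has_real_derivative p') (at x)" "(q has_real_derivative q') (at x)" "\<epsilon> > 0"
  shows "\<exists>\<kappa>\<ge>0.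
    ((\<lambda>x. (exp (- p x) - exp (- q x)) / sqrt ((exp (- p x) - exp (- q x))\<^sup>2 + (\<epsilon> * exp (- q x))\<^sup>2))
      has_real_derivative \<kappa> * (q' - p')) (at x)"
proof (intro exI conjI)
  define P where "P = exp (- p x)"
  define Q where "Q = exp (- q x)"
  define S where "S = (P - Q)\<^sup>2 + (\<epsilon> * Q)\<^sup>2"
  define G where "G = sqrt S"
  have Q: "P > 0" "Q > 0" by (simp_all add: P_def Q_def)
  then have S: "S > 0" using assms(3) by (auto simp: S_def intro!: add_nonneg_pos)
  then have G: "G > 0" "G * G = S" by (simp_all add: G_def)
  show "\<epsilon>\<^sup>2 * P * Q\<^sup>2 / (G * S) \<ge> 0" using G S Q by simp
  have dP: "((\<lambda>x. exp (- p x)) has_real_derivative - (P * p')) (at x)"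
    and dQ: "((\<lambda>x. exp (- q x)) has_real_derivative - (Q * q')) (at x)"
    by (auto intro!: derivative_eq_intros assms simp: P_def Q_def)
  note dS = DERIV_sum_of_squares[OF dP dQ, of \<epsilon>]
  have dG: "((\<lambda>x. sqrt ((exp (- p x) - exp (- q x))\<^sup>2 + (\<epsilon> * exp (- q x))\<^sup>2)) has_real_derivative
      inverse G / 2 * (2 * ((P - Q) * (- (P * p') - - (Q * q')) + \<epsilon>\<^sup>2 * Q * - (Q * q')))) (at x)"
    using DERIV_chain2[OF DERIV_real_sqrt dS] S by (simp add: P_def Q_def S_def G_def)
  have G0: "sqrt ((exp (- p x) - exp (- q x))\<^sup>2 + (\<epsilon> * exp (- q x))\<^sup>2) \<noteq> 0"
    using G(1) unfolding G_def S_def P_def Q_def by auto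
  have "((\<lambda>x. (exp (- p x) - exp (- q x)) / sqrt ((exp (- p x) - exp (- q x))\<^sup>2 + (\<epsilon> * exp (- q x))\<^sup>2))
      has_real_derivative ((- (P * p') - - (Q * q')) * G
        - (P - Q) * (inverse G / 2 * (2 * ((P - Q) * (- (P * p') - - (Q * q')) + \<epsilon>\<^sup>2 * Q * - (Q * q'))))) / (G * G)) (at x)"
    using DERIV_divide[OF DERIV_diff[OF dP dQ] dG G0] unfolding G_def S_def P_def Q_def .
  also have "((- (P * p') - - (Q * q')) * G
        - (P - Q) * (inverse G / 2 * (2 * ((P - Q) * (- (P * p') - - (Q * q')) + \<epsilon>\<^sup>2 * Q * - (Q * q'))))) / (G * G)
      = ((Q * q' - P * p') * (G * G)
        - (P - Q) * ((P - Q) * (Q * q' - P * p') - \<epsilon>\<^sup>2 * Q * (Q * q'))) / (G * S)"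
  proof -
    have "inverse G * G = 1" using G by simp
    then have "((- (P * p') - - (Q * q')) * G - (P - Q) * (inverse G / 2 * (2 * ((P - Q) * (- (P * p') - - (Q * q'))
          + \<epsilon>\<^sup>2 * Q * - (Q * q'))))) * G
      = (Q * q' - P * p') * (G * G) - (P - Q) * ((P - Q) * (Q * q' - P * p') - \<epsilon>\<^sup>2 * Q * (Q * q'))"
      by algebra
    then show ?thesis unfolding G(2)[symmetric] using G(1) by (simp add: field_simps)
  qed
  also have "\<dots> = \<epsilon>\<^sup>2 * P * Q\<^sup>2 / (G * S) * (q' - p')"
    unfolding G(2) by (simp add: S_def power2_eq_square algebra_simps flip: add_divide_distrib diff_divide_distrib)
  finally show "((\<lambda>x. (exp (- p x) - exp (- q x)) / sqrt ((exp (- p x) - exp (- q x))\<^sup>2 + (\<epsilon> * exp (- q x))\<^sup>2))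
      has_real_derivative \<epsilon>\<^sup>2 * P * Q\<^sup>2 / (G * S) * (q' - p')) (at x)" .
qed

text \<open>One-sided integration by parts: \<open>h\<close> will be a product whose derivative
  exceeds \<open>g\<close> by a nonnegative square term. As a derivative everywhere,
  \<open>h'\<close> is integrable by the fundamental theorem.\<close>

lemma integral_le_antiderivative:
  fixes g h h' :: "real \<Rightarrow> real"
  assumes "a \<le> b" "continuous_on {a..b} g" "\<And>x. (h has_real_derivative h' x) (at x)" "\<And>x. g x \<le> h' x"
  shows "integral {a..b} g \<le> h b - h a"
proof -
  have "(h' has_integral h b - h a) {a..b}"
    using assms(1) by (intro fundamental_theorem_of_calculus)
      (use assms(3) has_field_derivative_at_within has_real_derivative_iff_has_vector_derivative in blast)+
  moreover have "(g has_integral integral {a..b} g) {a..b}"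
    using assms(2) integrable_continuous_interval by blast
  ultimately show ?thesis using assms(4) has_integral_le by blast
qed

context sphere_flow
begin

lemma DERIV_shift_snd:
  assumes "smooth_slab f" "t < 0"
  shows "((\<lambda>s. f (s, \<theta> + c, t)) has_real_derivative pd1 f (s, \<theta> + c, t)) (at s)"
    "((\<lambda>\<theta>. f (s, \<theta> + c, t)) has_real_derivative pd2 f (s, \<theta> + c, t)) (at \<theta>)"
    "((\<lambda>t. f (s, \<theta> + c, t)) has_real_derivative pd3 f (s, \<theta> + c, t)) (at t)"
  using pd1_deriv[OF assms] pd3_deriv[OF assms] pd2_deriv[OF assms, of s "\<theta> + c"]
  by (simp_all add: DERIV_shift)

text \<open>A smooth substitute for the distance between the Mercator conformal factor and its
  rotated copy. Regularizing with \<epsilon> times the rotated factor instead of \<epsilon> keeps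
  the multiplier of \<open>DERIV_contraction_multiplier\<close> a function of the ratio
  only.\<close>

definition rel_dist :: "real \<Rightarrow> real \<Rightarrow> real \<Rightarrow> real \<Rightarrow> real \<Rightarrow> real" where
  "rel_dist \<epsilon> c s \<theta> t = sqrt ((exp (- ell (s, \<theta>, t)) - exp (- ell (s, \<theta> + c, t)))\<^sup>2
     + (\<epsilon> * exp (- ell (s, \<theta> + c, t)))\<^sup>2)"

lemma rel_dist_pos: "\<epsilon> > 0 \<Longrightarrow> rel_dist \<epsilon> c s \<theta> t > 0"
  by (auto simp: rel_dist_def intro!: add_nonneg_pos)

lemma rel_dist_cont:
  assumes "continuous_on A p" "continuous_on A q" "continuous_on A r" "\<And>x. x \<in> A \<Longrightarrow> r x < 0"
  shows "continuous_on A (\<lambda>x. rel_dist \<epsilon> c (p x) (q x) (r x))"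
  unfolding rel_dist_def
  by (intro continuous_intros smooth_slab_cont smooth_ell assms)

text \<open>The factor \<open>exp (- ell)\<close> has time derivative - (\<open>ell\<close>_ss +
  \<open>ell\<close>_\<theta>\<theta>), so the difference \<open>D\<close> changes at the rate of
  the flat Laplacian of W, the rotated \<open>ell\<close> minus \<open>ell\<close>. The multiplier
  \<eta> = D / G increases with W; integration by parts thus leaves nonpositive interior terms. The
  boundary terms in \<theta> cancel, and those in s account for the error: two ends, each at most 2
  M / cosh L, over a circle of length 2 pi.\<close>

lemma L1_contraction:
  assumes t01: "t0 < t1" "t1 < 0" and \<epsilon>: "\<epsilon> > 0" and L: "L > 0"
    and M: "\<And>\<psi> \<theta> t. t0 \<le> t \<Longrightarrow> t \<le> t1 \<Longrightarrow> \<bar>pd1 lu (\<psi>, \<theta>, t)\<bar> \<le> M"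
  shows "integral (cbox (-L, 0) (L, 2 * pi)) (\<lambda>x. rel_dist \<epsilon> c (fst x) (snd x) t1)
    \<le> integral (cbox (-L, 0) (L, 2 * pi)) (\<lambda>x. rel_dist \<epsilon> c (fst x) (snd x) t0)
      + (t1 - t0) * (8 * pi * M / cosh L)"
proof -
  let ?box = "cbox (-L, 0) (L, 2 * pi)"
  define G where "G = rel_dist \<epsilon> c"
  define D where "D s \<theta> t = exp (- ell (s, \<theta>, t)) - exp (- ell (s, \<theta> + c, t))" for s \<theta> t
  define \<eta> where "\<eta> s \<theta> t = D s \<theta> t / G s \<theta> t" for s \<theta> t
  define W1 where "W1 s \<theta> t = pd1 ell (s, \<theta> + c, t) - pd1 ell (s, \<theta>, t)" for s \<theta> t
  define W2 where "W2 s \<theta> t = pd2 ell (s, \<theta> + c, t) - pd2 ell (s, \<theta>, t)" for s \<theta> t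
  define W11 where "W11 s \<theta> t = pd1 (pd1 ell) (s, \<theta> + c, t) - pd1 (pd1 ell) (s, \<theta>, t)" for s \<theta> t
  define W22 where "W22 s \<theta> t = pd2 (pd2 ell) (s, \<theta> + c, t) - pd2 (pd2 ell) (s, \<theta>, t)" for s \<theta> t
  define U2t where "U2t s \<theta> t = - exp (- ell (s, \<theta> + c, t)) * pd3 ell (s, \<theta> + c, t)" for s \<theta> t
  define Gt where "Gt s \<theta> t = (D s \<theta> t * (W11 s \<theta> t + W22 s \<theta> t) + \<epsilon>\<^sup>2 * exp (- ell (s, \<theta> + c, t)) * U2t s \<theta> t) / G s \<theta> t" for s \<theta> t
  note sm = smooth_ell smooth_slab_pd
  have G_pos: "G s \<theta> t > 0" for s \<theta> t using rel_dist_pos[OF \<epsilon>] by (simp add: G_def)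
  have Dabs: "\<bar>D s \<theta> t\<bar> \<le> G s \<theta> t" for s \<theta> t
    unfolding G_def rel_dist_def D_def by (rule real_le_rsqrt) simp
  have \<eta>abs: "\<bar>\<eta> s \<theta> t\<bar> \<le> 1" for s \<theta> t using Dabs[of s \<theta> t] G_pos[of s \<theta> t] by (simp add: \<eta>_def)
  have Ut: "- exp (- ell (s, \<theta>, t)) * pd3 ell (s, \<theta>, t) = - (pd1 (pd1 ell) (s, \<theta>, t) + pd2 (pd2 ell) (s, \<theta>, t))"
    if "t < 0" for s \<theta> t
  proof -
    have "exp (- ell (s, \<theta>, t)) * exp (ell (s, \<theta>, t)) = 1" by (simp flip: exp_add)
    then have "exp (- ell (s, \<theta>, t)) * (exp (ell (s, \<theta>, t)) * X) = X" for X
      by (simp only: mult.assoc[symmetric] mult_1_left)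
    then show ?thesis unfolding ell_eq[OF that] by (simp only: mult_minus_left)
  qed
  have dG: "((\<lambda>t. G s \<theta> t) has_real_derivative Gt s \<theta> t) (at t)" if t: "t < 0" for s \<theta> t
  proof -
    let ?S = "\<lambda>t. (exp (- ell (s, \<theta>, t)) - exp (- ell (s, \<theta> + c, t)))\<^sup>2 + (\<epsilon> * exp (- ell (s, \<theta> + c, t)))\<^sup>2"
    have d1: "((\<lambda>t. exp (- ell (s, \<theta>, t))) has_real_derivative - exp (- ell (s, \<theta>, t)) * pd3 ell (s, \<theta>, t)) (at t)"
      and d2: "((\<lambda>t. exp (- ell (s, \<theta> + c, t))) has_real_derivative U2t s \<theta> t) (at t)"
      unfolding U2t_def by (auto intro!: derivative_eq_intros pd3_deriv smooth_ell t)
    have e: "- exp (- ell (s, \<theta>, t)) * pd3 ell (s, \<theta>, t) - U2t s \<theta> t = W11 s \<theta> t + W22 s \<theta> t"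
      unfolding U2t_def Ut[OF t] W11_def W22_def by simp
    note dS = DERIV_sum_of_squares[OF d1 d2, of \<epsilon>, unfolded e]
    have "?S t > 0" using \<epsilon> by (auto intro!: add_nonneg_pos)
    have d: "((\<lambda>t. sqrt (?S t)) has_real_derivative inverse (sqrt (?S t)) / 2 * (2 *
        ((exp (- ell (s, \<theta>, t)) - exp (- ell (s, \<theta> + c, t))) * (W11 s \<theta> t + W22 s \<theta> t)
          + \<epsilon>\<^sup>2 * exp (- ell (s, \<theta> + c, t)) * U2t s \<theta> t))) (at t)"
      by (rule DERIV_chain2[where f = sqrt and g = ?S, OF DERIV_real_sqrt[OF \<open>?S t > 0\<close>] dS])
    have r: "inverse r / 2 * (2 * x) = x / r" for r x :: real by (cases "r = 0") (simp_all add: field_simps)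
    have G_eq: "(\<lambda>t. G s \<theta> t) = (\<lambda>t. sqrt (?S t))" by (simp only: G_def rel_dist_def)
    have Gt_eq: "Gt s \<theta> t = ((exp (- ell (s, \<theta>, t)) - exp (- ell (s, \<theta> + c, t))) * (W11 s \<theta> t + W22 s \<theta> t)
          + \<epsilon>\<^sup>2 * exp (- ell (s, \<theta> + c, t)) * U2t s \<theta> t) / sqrt (?S t)"
      by (simp only: Gt_def D_def G_def rel_dist_def)
    show ?thesis unfolding G_eq Gt_eq using d by (simp only: r)
  qed
  \<comment> \<open>The regularizing term contributes with the right sign because \<open>ell\<close>
    is nondecreasing in time.\<close>
  have Gt_le: "Gt s \<theta> t \<le> \<eta> s \<theta> t * (W11 s \<theta> t + W22 s \<theta> t)" if "t < 0" for s \<theta> t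
  proof -
    have "U2t s \<theta> t \<le> 0" using pd3_ell_nonneg[OF that] by (simp add: U2t_def)
    then have "\<epsilon>\<^sup>2 * exp (- ell (s, \<theta> + c, t)) * U2t s \<theta> t \<le> 0" by (simp add: mult_nonneg_nonpos)
    then have "Gt s \<theta> t \<le> (D s \<theta> t * (W11 s \<theta> t + W22 s \<theta> t)) / G s \<theta> t"
      unfolding Gt_def using G_pos[of s \<theta> t] by (intro divide_right_mono) auto
    then show ?thesis by (simp add: \<eta>_def)
  qed
  have cont: "continuous_on A (\<lambda>x. G (p x) (q x) (r x))" "continuous_on A (\<lambda>x. \<eta> (p x) (q x) (r x))"
    "continuous_on A (\<lambda>x. W11 (p x) (q x) (r x))" "continuous_on A (\<lambda>x. W22 (p x) (q x) (r x))"
    "continuous_on A (\<lambda>x. Gt (p x) (q x) (r x))"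
    if "continuous_on A p" "continuous_on A q" "continuous_on A r" "\<And>x. x \<in> A \<Longrightarrow> r x < 0"
    for A :: "'z::topological_space set" and p q r
  proof -
    have g: "G (p x) (q x) (r x) \<noteq> 0" for x using G_pos[of "p x" "q x" "r x"] by simp
    have cG: "continuous_on A (\<lambda>x. G (p x) (q x) (r x))" unfolding G_def by (intro rel_dist_cont that)
    have cD: "continuous_on A (\<lambda>x. D (p x) (q x) (r x))"
      unfolding D_def by (intro continuous_intros smooth_slab_cont sm that)
    have cW1: "continuous_on A (\<lambda>x. W11 (p x) (q x) (r x))"
      unfolding W11_def by (intro continuous_intros smooth_slab_cont sm that)
    have cW2: "continuous_on A (\<lambda>x. W22 (p x) (q x) (r x))"
      unfolding W22_def by (intro continuous_intros smooth_slab_cont sm that)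
    have cE: "continuous_on A (\<lambda>x. exp (- ell (p x, q x + c, r x)))"
      by (intro continuous_intros smooth_slab_cont sm that)
    have cU: "continuous_on A (\<lambda>x. U2t (p x) (q x) (r x))"
      unfolding U2t_def by (intro continuous_intros smooth_slab_cont sm that)
    have cH: "continuous_on A (\<lambda>x. \<eta> (p x) (q x) (r x))"
      unfolding \<eta>_def by (intro continuous_intros cG cD g ballI)
    have cGt: "continuous_on A (\<lambda>x. Gt (p x) (q x) (r x))"
      unfolding Gt_def by (intro continuous_intros cG cD cW1 cW2 cE cU g ballI)
    show "continuous_on A (\<lambda>x. G (p x) (q x) (r x))" "continuous_on A (\<lambda>x. \<eta> (p x) (q x) (r x))"
      "continuous_on A (\<lambda>x. W11 (p x) (q x) (r x))" "continuous_on A (\<lambda>x. W22 (p x) (q x) (r x))"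
      "continuous_on A (\<lambda>x. Gt (p x) (q x) (r x))"
      by (fact cG cH cW1 cW2 cGt)+
  qed
  define I where "I t = integral ?box (\<lambda>x. G (fst x) (snd x) t)" for t
  have dI: "(I has_real_derivative integral ?box (\<lambda>x. Gt (fst x) (snd x) t)) (at t)" if "t < 0" for t
  proof -
    have "(I has_real_derivative integral ?box (\<lambda>x. Gt (fst x) (snd x) t)) (at t within {..<0})"
      unfolding I_def
    proof (rule leibniz_rule_field_derivative)
      show "((\<lambda>t. G (fst x) (snd x) t) has_real_derivative Gt (fst x) (snd x) t) (at t within {..<0})"
        if "t \<in> {..<0}" for t x
        by (rule has_field_derivative_at_within[OF dG]) (use that in auto)
      show "(\<lambda>x. G (fst x) (snd x) t) integrable_on ?box" if "t \<in> {..<0}" for t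
        by (intro integrable_continuous cont continuous_intros) (use that in auto)
      show "continuous_on ({..<0} \<times> ?box) (\<lambda>(t, x). Gt (fst x) (snd x) t)"
        unfolding split_beta by (intro cont continuous_intros) auto
    qed (use that in auto)
    then show ?thesis using that by (simp add: at_within_open[of t "{..<0}"])
  qed
  have bound: "integral ?box (\<lambda>x. Gt (fst x) (snd x) t) \<le> 8 * pi * M / cosh L" if t: "t0 \<le> t" "t \<le> t1" for t
  proof -
    have tn: "t < 0" using t t01 by simp
    note cc = cont[OF _ _ continuous_on_const tn]
    have i: "(\<lambda>x. \<eta> (fst x) (snd x) t * W11 (fst x) (snd x) t) integrable_on ?box"
      "(\<lambda>x. \<eta> (fst x) (snd x) t * W22 (fst x) (snd x) t) integrable_on ?box"
      "(\<lambda>x. Gt (fst x) (snd x) t) integrable_on ?box"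
      by (intro integrable_continuous continuous_intros cc)+
    have "integral ?box (\<lambda>x. Gt (fst x) (snd x) t)
      \<le> integral ?box (\<lambda>x. \<eta> (fst x) (snd x) t * W11 (fst x) (snd x) t + \<eta> (fst x) (snd x) t * W22 (fst x) (snd x) t)"
      using Gt_le[OF tn] by (intro integral_le i integrable_add) (simp add: distrib_left)
    also have "\<dots> = integral ?box (\<lambda>x. \<eta> (fst x) (snd x) t * W11 (fst x) (snd x) t)
        + integral ?box (\<lambda>x. \<eta> (fst x) (snd x) t * W22 (fst x) (snd x) t)"
      by (rule integral_add[OF i(1,2)])
    also have "integral ?box (\<lambda>x. \<eta> (fst x) (snd x) t * W22 (fst x) (snd x) t) \<le> 0"
    proof -
      have "integral ?box (\<lambda>x. \<eta> (fst x) (snd x) t * W22 (fst x) (snd x) t)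
          = integral (cbox (-L) L) (\<lambda>s. integral (cbox 0 (2 * pi)) (\<lambda>\<theta>. \<eta> s \<theta> t * W22 s \<theta> t))"
        by (subst integral_prod_continuous) (auto intro!: continuous_intros cc)
      also have "\<dots> \<le> integral (cbox (-L) L) (\<lambda>s. 0)"
      proof (rule integral_le)
        have "continuous_on (cbox (-L) L) (\<lambda>s. integral (cbox 0 (2 * pi)) (\<lambda>\<theta>. \<eta> s \<theta> t * W22 s \<theta> t))"
          by (rule integral_continuous_on_param)
            (auto simp: split_beta intro!: continuous_intros cc)
        then show "(\<lambda>s. integral (cbox 0 (2 * pi)) (\<lambda>\<theta>. \<eta> s \<theta> t * W22 s \<theta> t)) integrable_on cbox (-L) L"
          by (rule integrable_continuous)
        fix s
        \<comment> \<open>The derivative of \<eta> W2 is \<eta> W22 plus \<kappa> W2^2 with \<kappa>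
          nonnegative, so \<eta> W22 lies below an exact derivative. The same is done in s
          below.\<close>
        have ex: "\<exists>d. ((\<lambda>\<theta>. \<eta> s \<theta> t * W2 s \<theta> t) has_real_derivative d) (at \<theta>) \<and> \<eta> s \<theta> t * W22 s \<theta> t \<le> d" for \<theta>
        proof -
          have "\<exists>\<kappa>\<ge>0. ((\<lambda>\<theta>. \<eta> s \<theta> t) has_real_derivative \<kappa> * W2 s \<theta> t) (at \<theta>)"
            unfolding \<eta>_def D_def G_def rel_dist_def W2_def
            by (rule DERIV_contraction_multiplier[where p = "\<lambda>\<theta>. ell (s, \<theta>, t)" and q = "\<lambda>\<theta>. ell (s, \<theta> + c, t)",
                  OF pd2_deriv[OF smooth_ell tn] DERIV_shift_snd(2)[OF smooth_ell tn] \<epsilon>])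
          then obtain \<kappa> where \<kappa>: "\<kappa> \<ge> 0" "((\<lambda>\<theta>. \<eta> s \<theta> t) has_real_derivative \<kappa> * W2 s \<theta> t) (at \<theta>)"
            by blast
          have "((\<lambda>\<theta>. W2 s \<theta> t) has_real_derivative W22 s \<theta> t) (at \<theta>)"
            unfolding W2_def W22_def by (intro DERIV_diff DERIV_shift_snd pd2_deriv sm tn)
          note d = DERIV_mult[OF \<kappa>(2) this]
          have "\<kappa> * (W2 s \<theta> t * W2 s \<theta> t) \<ge> 0" using \<kappa>(1) by simp
          then have "\<eta> s \<theta> t * W22 s \<theta> t \<le> \<kappa> * W2 s \<theta> t * W2 s \<theta> t + W22 s \<theta> t * \<eta> s \<theta> t"
            by (simp add: mult.assoc mult.commute[of "\<eta> s \<theta> t"])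
          with d show ?thesis by blast
        qed
        then obtain d where d: "\<And>\<theta>. ((\<lambda>\<theta>. \<eta> s \<theta> t * W2 s \<theta> t) has_real_derivative d \<theta>) (at \<theta>)"
          "\<And>\<theta>. \<eta> s \<theta> t * W22 s \<theta> t \<le> d \<theta>" by metis
        have "integral {0..2 * pi} (\<lambda>\<theta>. \<eta> s \<theta> t * W22 s \<theta> t) \<le> \<eta> s (2 * pi) t * W2 s (2 * pi) t - \<eta> s 0 t * W2 s 0 t"
          by (rule integral_le_antiderivative[OF _ _ d]) (auto intro!: continuous_intros cc)
        also have "\<dots> = 0"
        proof -
          have p: "ell (s, \<theta> + 2 * pi, t) = ell (s, \<theta>, t)" if "t < 0" for s \<theta> t
            using periodic_ell[OF that, of s \<theta> 1] by simp
          have p2: "pd2 ell (s, \<theta> + 2 * pi, t) = pd2 ell (s, \<theta>, t)" for \<theta>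
            using pd_shift(2)[OF smooth_ell smooth_ell tn, of 0 "2 * pi" s \<theta>] p by simp
          show ?thesis
            using p[OF tn, of s 0] p[OF tn, of s c] p2[of 0] p2[of c]
            by (simp add: \<eta>_def D_def G_def rel_dist_def W2_def add.commute)
        qed
        finally show "integral (cbox 0 (2 * pi)) (\<lambda>\<theta>. \<eta> s \<theta> t * W22 s \<theta> t) \<le> 0" by simp
      qed (rule integrable_const)
      finally show ?thesis by simp
    qed
    also have "integral ?box (\<lambda>x. \<eta> (fst x) (snd x) t * W11 (fst x) (snd x) t) \<le> 8 * pi * M / cosh L"
    proof -
      have "integral ?box (\<lambda>x. \<eta> (fst x) (snd x) t * W11 (fst x) (snd x) t)
          = integral (cbox (-L) L) (\<lambda>s. integral (cbox 0 (2 * pi)) (\<lambda>\<theta>. \<eta> s \<theta> t * W11 s \<theta> t))"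
        by (subst integral_prod_continuous) (auto intro!: continuous_intros cc)
      also have "\<dots> = integral (cbox 0 (2 * pi)) (\<lambda>\<theta>. integral (cbox (-L) L) (\<lambda>s. \<eta> s \<theta> t * W11 s \<theta> t))"
        by (rule integral_swap_continuous) (auto simp: split_beta intro!: continuous_intros cc)
      also have "\<dots> \<le> integral (cbox 0 (2 * pi)) (\<lambda>\<theta>. 4 * M / cosh L)"
      proof (rule integral_le)
        have "continuous_on (cbox 0 (2 * pi)) (\<lambda>\<theta>. integral (cbox (-L) L) (\<lambda>s. \<eta> s \<theta> t * W11 s \<theta> t))"
          by (rule integral_continuous_on_param)
            (auto simp: split_beta intro!: continuous_intros cc)
        then show "(\<lambda>\<theta>. integral (cbox (-L) L) (\<lambda>s. \<eta> s \<theta> t * W11 s \<theta> t)) integrable_on cbox 0 (2 * pi)"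
          by (rule integrable_continuous)
        fix \<theta>
        have ex: "\<exists>d. ((\<lambda>s. \<eta> s \<theta> t * W1 s \<theta> t) has_real_derivative d) (at s) \<and> \<eta> s \<theta> t * W11 s \<theta> t \<le> d" for s
        proof -
          have "\<exists>\<kappa>\<ge>0. ((\<lambda>s. \<eta> s \<theta> t) has_real_derivative \<kappa> * W1 s \<theta> t) (at s)"
            unfolding \<eta>_def D_def G_def rel_dist_def W1_def
            by (rule DERIV_contraction_multiplier[where p = "\<lambda>s. ell (s, \<theta>, t)" and q = "\<lambda>s. ell (s, \<theta> + c, t)",
                  OF pd1_deriv[OF smooth_ell tn] DERIV_shift_snd(1)[OF smooth_ell tn] \<epsilon>])
          then obtain \<kappa> where \<kappa>: "\<kappa> \<ge> 0" "((\<lambda>s. \<eta> s \<theta> t) has_real_derivative \<kappa> * W1 s \<theta> t) (at s)"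
            by blast
          have "((\<lambda>s. W1 s \<theta> t) has_real_derivative W11 s \<theta> t) (at s)"
            unfolding W1_def W11_def by (intro DERIV_diff DERIV_shift_snd pd1_deriv sm tn)
          note d = DERIV_mult[OF \<kappa>(2) this]
          have "\<kappa> * (W1 s \<theta> t * W1 s \<theta> t) \<ge> 0" using \<kappa>(1) by simp
          then have "\<eta> s \<theta> t * W11 s \<theta> t \<le> \<kappa> * W1 s \<theta> t * W1 s \<theta> t + W11 s \<theta> t * \<eta> s \<theta> t"
            by (simp add: mult.assoc mult.commute[of "\<eta> s \<theta> t"])
          with d show ?thesis by blast
        qed
        then obtain d where d: "\<And>s. ((\<lambda>s. \<eta> s \<theta> t * W1 s \<theta> t) has_real_derivative d s) (at s)"
          "\<And>s. \<eta> s \<theta> t * W11 s \<theta> t \<le> d s" by metis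
        \<comment> \<open>The terms 2 tanh s cancel in the difference, which leaves only derivatives
          of \<open>lu\<close> with their factor 1 / cosh s.\<close>
        have W1b: "\<bar>W1 s \<theta> t\<bar> \<le> 2 * M / cosh s" for s
        proof -
          have "W1 s \<theta> t = (pd1 lu (gd s, \<theta>, t) - pd1 lu (gd s, \<theta> + c, t)) / cosh s"
            by (simp add: W1_def pd_ell[OF tn] diff_divide_distrib)
          then show ?thesis using M[OF t, of "gd s" \<theta>] M[OF t, of "gd s" "\<theta> + c"] cosh_real_pos[of s]
            by (simp add: divide_right_mono)
        qed
        have b: "\<bar>\<eta> s \<theta> t * W1 s \<theta> t\<bar> \<le> 2 * M / cosh s" for s
          using mult_mono[OF \<eta>abs[of s \<theta> t] W1b[of s]] by (simp add: abs_mult)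
        have "integral {-L..L} (\<lambda>s. \<eta> s \<theta> t * W11 s \<theta> t) \<le> \<eta> L \<theta> t * W1 L \<theta> t - \<eta> (-L) \<theta> t * W1 (-L) \<theta> t"
          by (rule integral_le_antiderivative[OF _ _ d]) (use L in \<open>auto intro!: continuous_intros cc\<close>)
        also have "\<dots> \<le> 4 * M / cosh L" using b[of L] b[of "-L"] by simp
        finally show "integral (cbox (-L) L) (\<lambda>s. \<eta> s \<theta> t * W11 s \<theta> t) \<le> 4 * M / cosh L" by simp
      qed (rule integrable_const)
      also have "\<dots> = 8 * pi * M / cosh L" by simp
      finally show ?thesis .
    qed
    finally show ?thesis by simp
  qed
  obtain \<xi> where \<xi>: "t0 < \<xi>" "\<xi> < t1" "I t1 - I t0 = (t1 - t0) * integral ?box (\<lambda>x. Gt (fst x) (snd x) \<xi>)"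
    using MVT2[OF t01(1), of I "\<lambda>t. integral ?box (\<lambda>x. Gt (fst x) (snd x) t)"] dI t01 by auto
  have "I t1 - I t0 \<le> (t1 - t0) * (8 * pi * M / cosh L)"
    unfolding \<xi>(3) using bound[of \<xi>] \<xi> t01 by (intro mult_left_mono) auto
  then show ?thesis by (simp add: I_def G_def)
qed

end

text \<open>One factor 1 / (1 + s^2) will serve as an integrable weight, the other as smallness for
  large |s|. The constant comes from m (1 + |s|) <= exp(a |s| / 4), raised to the fourth power,
  together with exp |s| <= 2 cosh s.\<close>

lemma cosh_powr_decay:
  assumes "a > 0"
  obtains B where "B > 0" "\<And>s::real. cosh s powr (- a) \<le> B / (1 + s\<^sup>2)\<^sup>2"
proof
  define c where "c = a / 4"
  define m where "m = min 1 c"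
  have m: "m > 0" "m \<le> 1" "m \<le> c" using assms by (auto simp: m_def c_def)
  show "2 powr a / m ^ 4 > 0" using m by simp
  fix s :: real
  have "m * (1 + \<bar>s\<bar>) = m + m * \<bar>s\<bar>" by (simp add: distrib_left)
  also have "\<dots> \<le> 1 + c * \<bar>s\<bar>" using m by (intro add_mono mult_right_mono) auto
  also have "\<dots> \<le> exp (c * \<bar>s\<bar>)" by (rule exp_ge_add_one_self)
  finally have 1: "m * (1 + \<bar>s\<bar>) \<le> exp (c * \<bar>s\<bar>)" .
  have "1 + s\<^sup>2 \<le> (1 + \<bar>s\<bar>)\<^sup>2" by (simp add: power2_sum)
  then have "(1 + s\<^sup>2)\<^sup>2 \<le> ((1 + \<bar>s\<bar>)\<^sup>2)\<^sup>2" by (intro power_mono) auto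
  then have "m ^ 4 * (1 + s\<^sup>2)\<^sup>2 \<le> (m * (1 + \<bar>s\<bar>)) ^ 4"
    using m by (simp add: power_mult_distrib flip: power_mult)
  also have "\<dots> \<le> exp (c * \<bar>s\<bar>) ^ 4" using 1 m by (intro power_mono) auto
  also have "\<dots> = exp (a * \<bar>s\<bar>)" by (simp add: c_def flip: exp_of_nat_mult)
  also have "\<dots> = exp \<bar>s\<bar> powr a" by (simp add: powr_def mult.commute)
  also have "\<dots> \<le> (2 * cosh s) powr a"
  proof (rule powr_mono2)
    show "exp \<bar>s\<bar> \<le> 2 * cosh s"
      by (cases "s \<ge> 0") (auto simp: cosh_def field_simps)
  qed (use assms in auto)
  also have "\<dots> = 2 powr a * cosh s powr a" using cosh_real_pos[of s] by (simp add: powr_mult)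
  finally have "m ^ 4 * (1 + s\<^sup>2)\<^sup>2 \<le> 2 powr a * cosh s powr a" .
  moreover have "(1 + s\<^sup>2)\<^sup>2 > 0" by (intro zero_less_power add_pos_nonneg) auto
  ultimately show "cosh s powr (- a) \<le> 2 powr a / m ^ 4 / (1 + s\<^sup>2)\<^sup>2"
    using m cosh_real_pos[of s] by (simp add: powr_minus field_simps)
qed

lemma cosh_ge_half: "L / 2 \<le> cosh (L::real)"
proof -
  have "1 + L \<le> exp L" by (rule exp_ge_add_one_self)
  moreover have "exp (- L) > 0" by simp
  moreover have "2 * cosh L = exp L + exp (- L)" by (simp add: cosh_def)
  ultimately show ?thesis by linarith
qed

section \<open>Decay of the rotation defect as time tends to minus infinity\<close>

locale ancient_sphere_flow = sphere_flow +
  fixes C0 a T0 C :: real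
  assumes C0_pos: "C0 > 0"
    and v_lim: "\<forall>\<psi>\<in>{-pi/2..pi/2}. \<forall>\<theta>\<in>{0..2*pi}.
        ((\<lambda>t. inverse (u (sphere_point \<psi> \<theta>) t)) \<longlongrightarrow> C0 * (cos \<psi>)\<^sup>2) at_bot"
    and a_bounds: "0 < a" "a < 3"
    and T0_neg: "T0 < 0"
    and C_pos: "C > 0"
    and v_theta_bound: "\<forall>t\<le>T0. \<forall>\<psi>\<in>{-pi/2..pi/2}. \<forall>\<theta>\<in>{0..2*pi}.
        (deriv (\<lambda>s. inverse (u (sphere_point \<psi> s) t)) \<theta>)\<^sup>2
          \<le> C * inverse (u (sphere_point \<psi> \<theta>) t) powr (1 + a) * (cos \<psi>)\<^sup>2"
begin

lemma exp_ell_lim: "((\<lambda>t. exp (ell (s, \<theta>, t))) \<longlongrightarrow> C0) at_bot"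
proof -
  obtain \<theta>' k where th: "\<theta> = \<theta>' + 2 * pi * of_int k" "0 \<le> \<theta>'" "\<theta>' \<le> 2 * pi"
    by (rule ex_period_representative)
  have "gd s \<in> {-pi/2..pi/2}" using gd_bounds[of s] by auto
  from bspec[OF bspec[OF v_lim this], of \<theta>']
  have "((\<lambda>t. inverse (u (sphere_point (gd s) \<theta>') t)) \<longlongrightarrow> C0 * (cos (gd s))\<^sup>2) at_bot"
    using th(2,3) by simp
  from tendsto_mult_left[OF this, of "(cosh s)\<^sup>2"]
  have l: "((\<lambda>t. (cosh s)\<^sup>2 * inverse (u (sphere_point (gd s) \<theta>') t)) \<longlongrightarrow> C0) at_bot"
    using cosh_real_pos[of s] by (simp add: power_divide)
  have "\<forall>\<^sub>F t in at_bot. (cosh s)\<^sup>2 * inverse (u (sphere_point (gd s) \<theta>') t) = exp (ell (s, \<theta>, t))"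
    unfolding eventually_at_bot_linorder
  proof (intro exI[of _ "-1"] allI impI)
    fix t :: real assume "t \<le> -1"
    then have "t < 0" by simp
    from periodic_ell[OF this, of s \<theta>' k] show "(cosh s)\<^sup>2 * inverse (u (sphere_point (gd s) \<theta>') t) = exp (ell (s, \<theta>, t))"
      by (simp add: th(1) exp_ell[OF \<open>t < 0\<close>, of s \<theta>'] divide_inverse)
  qed
  from Lim_transform_eventually[OF l this] show ?thesis .
qed

lemma exp_ell_ge:
  assumes "t < 0" shows "C0 \<le> exp (ell (s, \<theta>, t))"
proof (rule tendsto_upperbound[OF exp_ell_lim])
  show "\<forall>\<^sub>F t' in at_bot. exp (ell (s, \<theta>, t')) \<le> exp (ell (s, \<theta>, t))"
    unfolding eventually_at_bot_linorder using ell_mono assms by (intro exI[of _ t]) auto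
qed simp

lemma exp_minus_ell_le: "t < 0 \<Longrightarrow> exp (- ell (s, \<theta>, t)) \<le> 1 / C0"
  using exp_ell_ge[of t s \<theta>] C0_pos le_imp_inverse_le[of C0 "exp (ell (s, \<theta>, t))"]
  by (simp add: exp_minus inverse_eq_divide)

text \<open>With c = cosh s, the square of the left side is v_\<theta>^2 / (c^4 v^4), which the
  hypothesis bounds by C v^(a - 3) / c^6. As a < 3, the power decreases in v and the lower bound v
  >= C0 / c^2 applies; the exponents of c then add up to -2a.\<close>

lemma pd2_exp_minus_ell_bound:
  assumes "t \<le> T0"
  shows "\<bar>exp (- ell (s, \<theta>, t)) * pd2 ell (s, \<theta>, t)\<bar> \<le> sqrt (C * C0 powr (a - 3)) * cosh s powr (- a)"
proof -
  have t: "t < 0" using assms T0_neg by simp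
  have *: "\<bar>exp (- ell (s, \<theta>, t)) * pd2 ell (s, \<theta>, t)\<bar> \<le> sqrt (C * C0 powr (a - 3)) * cosh s powr (- a)"
    if th: "0 \<le> \<theta>" "\<theta> \<le> 2 * pi" for \<theta>
  proof -
    define c where "c = cosh s"
    define x where "x = exp (- lu (gd s, \<theta>, t))"
    define p where "p = pd2 lu (gd s, \<theta>, t)"
    have c: "c > 0" by (simp add: c_def cosh_real_pos)
    have x: "x > 0" by (simp add: x_def)
    have v: "inverse (u (sphere_point (gd s) \<theta>) t) = exp (- lu (gd s, \<theta>, t))" for \<theta>
      by (simp add: exp_minus exp_lu[OF t])
    have "((\<lambda>\<theta>. exp (- lu (gd s, \<theta>, t))) has_real_derivative - (x * p)) (at \<theta>)"
      unfolding x_def p_def by (auto intro!: derivative_eq_intros pd2_deriv smooth_lu t)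
    then have dv: "deriv (\<lambda>\<theta>. exp (- lu (gd s, \<theta>, t))) \<theta> = - (x * p)"
      by (rule DERIV_imp_deriv)
    have m: "gd s \<in> {-pi/2..pi/2}" "\<theta> \<in> {0..2*pi}" using gd_bounds[of s] th by auto
    have b: "(- (x * p))\<^sup>2 \<le> C * x powr (1 + a) * (1 / c)\<^sup>2"
      using v_theta_bound[rule_format, OF assms m] unfolding v dv by (simp add: x_def c_def)
    have E: "exp (ell (s, \<theta>, t)) = c\<^sup>2 * x"
      by (simp add: exp_ell[OF t] x_def exp_minus exp_lu[OF t] c_def divide_inverse)
    have lo: "C0 / c\<^sup>2 \<le> x" using exp_ell_ge[OF t, of s \<theta>] c unfolding E by (simp add: field_simps)
    have "(exp (- ell (s, \<theta>, t)) * pd2 ell (s, \<theta>, t))\<^sup>2 = (x * p)\<^sup>2 / (c ^ 4 * x ^ 4)"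
      using c x unfolding exp_minus E pd_ell(2)[OF t] p_def[symmetric]
      by (simp add: field_simps power2_eq_square power4_eq_xxxx)
    also have "\<dots> \<le> (C * x powr (1 + a) * (1 / c)\<^sup>2) / (c ^ 4 * x ^ 4)"
      using b c x by (intro divide_right_mono) auto
    also have "\<dots> = C * x powr (a - 3) / c ^ 6"
    proof -
      have "x powr (1 + a) = x powr (a - 3) * x powr 4"
        by (simp flip: powr_add)
      also have "x powr 4 = x ^ 4" using x powr_realpow[of x 4] by simp
      finally have e: "x powr (1 + a) = x powr (a - 3) * x ^ 4" .
      have "(C * (X * y) * (1 / c)\<^sup>2) / (c ^ 4 * y) = C * X / c ^ 6" if "y > 0" for X y
        using that c by (simp add: field_simps eval_nat_numeral)
      then show ?thesis using x unfolding e by simp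
    qed
    also have "\<dots> \<le> C * (C0 / c\<^sup>2) powr (a - 3) / c ^ 6"
      using lo C0_pos c C_pos a_bounds by (intro divide_right_mono mult_left_mono powr_mono2') auto
    also have "\<dots> = C * C0 powr (a - 3) * (c powr (- a))\<^sup>2"
    proof -
      have c2: "c\<^sup>2 = c powr 2" using c powr_realpow[of c 2] by simp
      have c6: "c ^ 6 = c powr 6" using c powr_realpow[of c 6] by simp
      have "(C0 / c\<^sup>2) powr (a - 3) = C0 powr (a - 3) / c powr (2 * (a - 3))"
      proof -
        have "(c\<^sup>2) powr (a - 3) = c powr (2 * (a - 3))" unfolding c2 by (rule powr_powr)
        moreover have "(C0 / c\<^sup>2) powr (a - 3) = C0 powr (a - 3) / (c\<^sup>2) powr (a - 3)"
          using c C0_pos by (simp add: powr_divide)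
        ultimately show ?thesis by (simp only:)
      qed
      also have "C0 powr (a - 3) / c powr (2 * (a - 3)) = C0 powr (a - 3) * ((c powr (- a))\<^sup>2 * c ^ 6)"
      proof -
        define A where "A = c powr (2 * (a - 3))"
        define B where "B = (c powr (- a))\<^sup>2 * c ^ 6"
        have A: "A > 0" using c by (simp add: A_def)
        have AB: "A * B = 1"
          unfolding A_def B_def power2_eq_square c6 powr_add[symmetric] using c by simp
        have "X / A = X * B" for X
        proof -
          have "X / A = X * (A * B) / A" unfolding AB by simp
          also have "\<dots> = X * B" using A by simp
          finally show ?thesis .
        qed
        then show ?thesis unfolding A_def B_def .
      qed
      finally show ?thesis using c by simp
    qed
    finally have "\<bar>exp (- ell (s, \<theta>, t)) * pd2 ell (s, \<theta>, t)\<bar> \<le> sqrt (C * C0 powr (a - 3) * (c powr (- a))\<^sup>2)"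
      by (metis real_sqrt_abs real_sqrt_le_mono)
    then show ?thesis by (simp add: real_sqrt_mult c_def)
  qed
  obtain \<theta>' k where th: "\<theta> = \<theta>' + 2 * pi * of_int k" "0 \<le> \<theta>'" "\<theta>' \<le> 2 * pi"
    by (rule ex_period_representative)
  have "ell (s, \<theta>, t) = ell (s, \<theta>', t)" unfolding th(1) by (rule periodic_ell[OF t])
  moreover have "pd2 ell (s, \<theta>', t) = pd2 ell (s, \<theta>, t)"
    using pd_shift(2)[OF smooth_ell smooth_ell t, of 0 "2 * pi * of_int k" s \<theta>'] periodic_ell th(1) by simp
  ultimately show ?thesis using *[OF th(2,3)] by simp
qed

text \<open>Dini's argument: by monotonicity in time the sets where the bound fails form a
  decreasing sequence of compact sets, with empty intersection by pointwise convergence, so one of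
  them is empty.\<close>

lemma exp_minus_ell_uniform_limit:
  assumes "\<kappa> > 0"
  obtains \<tau> where "\<tau> < 0" "\<And>s \<theta> t. t \<le> \<tau> \<Longrightarrow> \<bar>s\<bar> \<le> L \<Longrightarrow> exp (- ell (s, \<theta>, t)) > 1 / C0 - \<kappa>"
proof -
  \<comment> \<open>The successor keeps the sampled times strictly negative, also for n = 0.\<close>
  define F where "F n = {x \<in> {-L..L} \<times> {0..2*pi}. exp (- ell (fst x, snd x, - real (Suc n))) \<le> 1 / C0 - \<kappa>}" for n
  have "compact (F n)" for n
  proof -
    have "closed {x. exp (- ell (fst x, snd x, - real (Suc n))) \<le> 1 / C0 - \<kappa>}"
      by (intro closed_Collect_le continuous_intros smooth_slab_cont smooth_ell) auto
    then have "compact ({-L..L} \<times> {0..2*pi} \<inter> {x. exp (- ell (fst x, snd x, - real (Suc n))) \<le> 1 / C0 - \<kappa>})"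
      by (intro compact_Int_closed compact_Times compact_Icc)
    then show ?thesis by (simp add: F_def Int_def)
  qed
  moreover have "F n \<subseteq> F m" if "m \<le> n" for m n
  proof
    fix x assume x: "x \<in> F n"
    have "ell (fst x, snd x, - real (Suc n)) \<le> ell (fst x, snd x, - real (Suc m))"
      using that by (intro ell_mono) auto
    then have "exp (- ell (fst x, snd x, - real (Suc m))) \<le> exp (- ell (fst x, snd x, - real (Suc n)))"
      by simp
    also have "\<dots> \<le> 1 / C0 - \<kappa>" using x by (simp add: F_def)
    finally show "x \<in> F m" using x by (simp add: F_def)
  qed
  moreover have "\<Inter> (range F) = {}"
  proof (rule ccontr)
    assume "\<Inter> (range F) \<noteq> {}"
    then obtain x where x: "\<And>n. x \<in> F n" by blast
    have "((\<lambda>t. inverse (exp (ell (fst x, snd x, t)))) \<longlongrightarrow> inverse C0) at_bot"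
      using C0_pos by (intro tendsto_inverse exp_ell_lim) auto
    then have "\<forall>\<^sub>F t in at_bot. inverse (exp (ell (fst x, snd x, t))) > 1 / C0 - \<kappa>"
      by (rule order_tendstoD(1)) (use assms in \<open>simp add: inverse_eq_divide\<close>)
    then obtain N where N: "\<And>t. t \<le> N \<Longrightarrow> inverse (exp (ell (fst x, snd x, t))) > 1 / C0 - \<kappa>"
      unfolding eventually_at_bot_linorder by blast
    obtain n where "real n \<ge> - N" using real_arch_simple by blast
    then have "- real (Suc n) \<le> N" by simp
    from N[OF this] x[of n] show False by (simp add: F_def exp_minus)
  qed
  ultimately obtain n where n: "F n = {}" using compact_nest[of F] by blast
  show ?thesis
  proof
    show "- real (Suc n) < 0" by simp
    fix s \<theta> t assume t: "t \<le> - real (Suc n)" and s: "\<bar>s\<bar> \<le> L"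
    then have tn: "t < 0" by linarith
    obtain \<theta>' k where th: "\<theta> = \<theta>' + 2 * pi * of_int k" "0 \<le> \<theta>'" "\<theta>' \<le> 2 * pi"
      by (rule ex_period_representative)
    have "(s, \<theta>') \<notin> F n" using n by simp
    then have "exp (- ell (s, \<theta>', - real (Suc n))) > 1 / C0 - \<kappa>" using s th by (auto simp: F_def)
    also have "exp (- ell (s, \<theta>', - real (Suc n))) \<le> exp (- ell (s, \<theta>', t))"
      using ell_mono[OF t, of s \<theta>'] by simp
    also have "ell (s, \<theta>', t) = ell (s, \<theta>, t)" unfolding th(1) by (rule periodic_ell[OF tn, symmetric])
    finally show "exp (- ell (s, \<theta>, t)) > 1 / C0 - \<kappa>" .
  qed
qed

lemma rotation_defect_small:
  assumes "K > 0"
  obtains \<tau> where "\<tau> < 0"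
    "\<And>s \<theta> t. t \<le> \<tau> \<Longrightarrow> \<bar>exp (- ell (s, \<theta>, t)) - exp (- ell (s, \<theta> + c, t))\<bar> \<le> K / (1 + s\<^sup>2)"
proof -
  obtain B where B: "B > 0" "\<And>s::real. cosh s powr (- a) \<le> B / (1 + s\<^sup>2)\<^sup>2"
    using cosh_powr_decay[OF a_bounds(1)] by blast
  define K1 where "K1 = sqrt (C * C0 powr (a - 3))"
  have K1: "K1 \<ge> 0" using C_pos by (simp add: K1_def)
  define B' where "B' = K1 * \<bar>c\<bar> * B"
  have B': "B' \<ge> 0" using K1 B by (simp add: B'_def)
  have q: "1 + s\<^sup>2 > 0" for s :: real by (intro add_pos_nonneg) auto
  have far: "\<bar>exp (- ell (s, \<theta>, t)) - exp (- ell (s, \<theta> + c, t))\<bar> \<le> B' / (1 + s\<^sup>2)\<^sup>2" if t: "t \<le> T0" for s \<theta> t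
  proof -
    have tn: "t < 0" using t T0_neg by simp
    have "norm (exp (- ell (s, \<theta>, t)) - exp (- ell (s, \<theta> + c, t))) \<le> (K1 * cosh s powr (- a)) * norm (\<theta> - (\<theta> + c))"
    proof (rule field_differentiable_bound[where S = UNIV and f = "\<lambda>\<theta>. exp (- ell (s, \<theta>, t))"])
      show "((\<lambda>\<theta>. exp (- ell (s, \<theta>, t))) has_real_derivative - (exp (- ell (s, z, t)) * pd2 ell (s, z, t))) (at z within UNIV)" for z
        by (auto intro!: derivative_eq_intros pd2_deriv smooth_ell tn)
      show "norm (- (exp (- ell (s, z, t)) * pd2 ell (s, z, t))) \<le> K1 * cosh s powr (- a)" for z
        using pd2_exp_minus_ell_bound[OF t, of s z] by (simp add: K1_def)
    qed auto
    also have "\<dots> \<le> (K1 * (B / (1 + s\<^sup>2)\<^sup>2)) * norm (\<theta> - (\<theta> + c))"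
      using B(2)[of s] K1 by (intro mult_right_mono mult_left_mono) auto
    finally show ?thesis by (simp add: B'_def mult_ac)
  qed
  \<comment> \<open>For |s| > L one has B' <= K |s| <= K (1 + s^2), so the decay in s alone gives
    the claim there.\<close>
  define L where "L = B' / K"
  have L: "L \<ge> 0" using B' assms by (simp add: L_def)
  \<comment> \<open>The smallest value of the target weight on |s| <= L; there uniform convergence
    does the work.\<close>
  define \<kappa> where "\<kappa> = K / (1 + L\<^sup>2)"
  have \<kappa>: "\<kappa> > 0" using assms q[of L] by (simp add: \<kappa>_def)
  obtain \<tau> where \<tau>: "\<tau> < 0" "\<And>s \<theta> t. t \<le> \<tau> \<Longrightarrow> \<bar>s\<bar> \<le> L \<Longrightarrow> exp (- ell (s, \<theta>, t)) > 1 / C0 - \<kappa>"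
    using exp_minus_ell_uniform_limit[OF \<kappa>, of L] by blast
  show ?thesis
  proof
    show "min \<tau> T0 < 0" using T0_neg by simp
    fix s \<theta> t assume t: "t \<le> min \<tau> T0"
    show "\<bar>exp (- ell (s, \<theta>, t)) - exp (- ell (s, \<theta> + c, t))\<bar> \<le> K / (1 + s\<^sup>2)"
    proof (cases "\<bar>s\<bar> \<le> L")
      case True
      have tn: "t < 0" using t T0_neg by simp
      have "\<bar>exp (- ell (s, \<theta>, t)) - exp (- ell (s, \<theta> + c, t))\<bar> \<le> \<kappa>"
        using \<tau>(2)[of t s \<theta>] \<tau>(2)[of t s "\<theta> + c"] exp_minus_ell_le[OF tn, of s \<theta>]
          exp_minus_ell_le[OF tn, of s "\<theta> + c"] t True by (simp add: abs_le_iff)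
      also have "\<kappa> \<le> K / (1 + s\<^sup>2)"
      proof -
        have "s\<^sup>2 \<le> L\<^sup>2" using True L by (metis abs_le_square_iff abs_of_nonneg)
        then show ?thesis unfolding \<kappa>_def using assms q[of s] by (intro divide_left_mono) auto
      qed
      finally show ?thesis .
    next
      case False
      have "B' \<le> K * (1 + s\<^sup>2)"
      proof -
        have "B' = K * L" using assms by (simp add: L_def)
        also have "\<dots> \<le> K * (1 + s\<^sup>2)"
        proof (rule mult_left_mono)
          have "0 \<le> (\<bar>s\<bar> - 1)\<^sup>2" by simp
          then have "2 * \<bar>s\<bar> \<le> 1 + s\<^sup>2" by (simp add: power2_diff)
          then show "L \<le> 1 + s\<^sup>2" using False L by linarith
        qed (use assms in simp)
        finally show ?thesis .
      qed
      then have "B' / (1 + s\<^sup>2)\<^sup>2 \<le> K * (1 + s\<^sup>2) / (1 + s\<^sup>2)\<^sup>2"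
        by (rule divide_right_mono) simp
      also have "\<dots> = K / (1 + s\<^sup>2)" using q[of s] by (simp add: power2_eq_square)
      finally show ?thesis using far[of t s \<theta>] t by simp
    qed
  qed
qed

text \<open>The order of choices matters: K fixes the initial time t0, t0 fixes the derivative bound
  M, and only then can the box L' be made large enough to suppress the boundary terms. The integral
  at t0 stays small for every L' because the weight 1 / (1 + s^2) is integrable on the line.\<close>

lemma rotation_invariant:
  assumes t1: "t1 < 0"
  shows "ell (s, \<theta> + c, t1) = ell (s, \<theta>, t1)"
proof -
  define D where "D x t = \<bar>exp (- ell (fst x, snd x, t)) - exp (- ell (fst x, snd x + c, t))\<bar>" for x t
  have D_cont: "continuous_on A (\<lambda>x. D x t)" if "t < 0" for A t
    unfolding D_def by (intro continuous_intros smooth_slab_cont smooth_ell) (use that in auto)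
  obtain \<theta>' k where th: "\<theta> = \<theta>' + 2 * pi * of_int k" "0 \<le> \<theta>'" "\<theta>' \<le> 2 * pi"
    by (rule ex_period_representative)
  define L where "L = \<bar>s\<bar> + 1"
  define Z where "Z = integral (cbox (-L, 0) (L, 2 * pi)) (\<lambda>x. D x t1)"
  have "Z \<le> 0"
  proof (rule field_le_epsilon)
    fix \<zeta> :: real assume \<zeta>: "\<zeta> > 0"
    \<comment> \<open>The weight K / (1 + s^2) has integral at most 2 pi * pi * K = \<zeta> / 2 over
      the whole cylinder.\<close>
    define K where "K = \<zeta> / (4 * pi\<^sup>2)"
    have K: "K > 0" using \<zeta> by (simp add: K_def)
    obtain \<tau> where \<tau>: "\<tau> < 0" "\<And>s \<theta> t. t \<le> \<tau> \<Longrightarrow>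
        \<bar>exp (- ell (s, \<theta>, t)) - exp (- ell (s, \<theta> + c, t))\<bar> \<le> K / (1 + s\<^sup>2)"
      using rotation_defect_small[OF K] by blast
    define t0 where "t0 = min \<tau> (t1 - 1)"
    have t0: "t0 < t1" "t0 \<le> \<tau>" "t0 < 0" using t1 by (auto simp: t0_def)
    obtain M where M: "M > 0" "\<And>\<psi> \<theta> t. t0 \<le> t \<Longrightarrow> t \<le> t1 \<Longrightarrow> \<bar>pd1 lu (\<psi>, \<theta>, t)\<bar> \<le> M"
      by (rule doubly_periodic_bounded[OF C_infinity_onD(3)[OF smooth_slab_pd(1)[OF smooth_lu]]
        doubly_periodic_pd(1)[OF smooth_lu periodic_lu] t1, of t0]) blast
    \<comment> \<open>Collects the coefficients of 1 / cosh L' from the regularization and from the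
      boundary terms. Since cosh L' >= L' / 2, the choice of L' below makes their total at most
      \<zeta> / 2.\<close>
    define X where "X = 4 * pi / C0 + (t1 - t0) * (8 * pi * M)"
    have X: "X > 0" using C0_pos M t0 by (auto simp: X_def intro!: add_pos_nonneg)
    define L' where "L' = max L (4 * X / \<zeta>)"
    have L': "L' \<ge> L" "L' > 0" "L' \<ge> 4 * X / \<zeta>" by (auto simp: L'_def L_def)
    have ch: "cosh L' > 0" by (rule cosh_real_pos)
    \<comment> \<open>The regularization integrates to at most 4 pi \<epsilon> L' / C0 over the box;
      this choice brings it to the order of 1 / cosh L'.\<close>
    define \<epsilon> where "\<epsilon> = 1 / (L' * cosh L')"
    have \<epsilon>: "\<epsilon> > 0" using L' ch by (simp add: \<epsilon>_def)
    let ?box = "cbox (-L', 0) (L', 2 * pi)"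
    have rc: "continuous_on A (\<lambda>x. rel_dist \<epsilon> c (fst x) (snd x) t)" if "t < 0" for A t
      by (intro rel_dist_cont continuous_intros that)
    have "Z \<le> integral ?box (\<lambda>x. D x t1)"
      unfolding Z_def using L' t1
      by (intro integral_subset_le integrable_continuous D_cont) (auto simp: D_def cbox_Pair_eq)
    also have "\<dots> \<le> integral ?box (\<lambda>x. rel_dist \<epsilon> c (fst x) (snd x) t1)"
    proof (intro integral_le integrable_continuous D_cont rc t1)
      show "D x t1 \<le> rel_dist \<epsilon> c (fst x) (snd x) t1" for x
        unfolding D_def rel_dist_def by (rule real_le_rsqrt) simp
    qed
    also have "\<dots> \<le> integral ?box (\<lambda>x. rel_dist \<epsilon> c (fst x) (snd x) t0) + (t1 - t0) * (8 * pi * M / cosh L')"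
      by (rule L1_contraction[OF t0(1) t1 \<epsilon> L'(2) M(2)])
    also have "integral ?box (\<lambda>x. rel_dist \<epsilon> c (fst x) (snd x) t0)
        \<le> integral ?box (\<lambda>x. K * inverse (1 + (fst x)\<^sup>2) + \<epsilon> / C0)"
    proof (intro integral_le integrable_continuous rc t0)
      show "continuous_on ?box (\<lambda>x. K * inverse (1 + (fst x)\<^sup>2) + \<epsilon> / C0)"
        by (intro continuous_intros) (auto simp: add_nonneg_eq_0_iff)
      fix x :: "real \<times> real"
      let ?B = "\<epsilon> * exp (- ell (fst x, snd x + c, t0))"
      have "rel_dist \<epsilon> c (fst x) (snd x) t0 \<le> D x t0 + \<bar>?B\<bar>"
        unfolding D_def rel_dist_def by (rule sqrt_sum_squares_le_sum_abs)
      also have "D x t0 \<le> K / (1 + (fst x)\<^sup>2)" unfolding D_def by (rule \<tau>(2)[OF t0(2)])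
      also have "\<bar>?B\<bar> \<le> \<epsilon> * (1 / C0)"
        using mult_left_mono[OF exp_minus_ell_le[OF t0(3), of "fst x" "snd x + c"], of \<epsilon>] \<epsilon>
        by (simp add: abs_mult)
      finally show "rel_dist \<epsilon> c (fst x) (snd x) t0 \<le> K * inverse (1 + (fst x)\<^sup>2) + \<epsilon> / C0"
        by (simp add: divide_inverse)
    qed
    also have "integral ?box (\<lambda>x. K * inverse (1 + (fst x)\<^sup>2) + \<epsilon> / C0) \<le> \<zeta> / 2 + 4 * pi / C0 / cosh L'"
    proof -
      have "integral ?box (\<lambda>x. K * inverse (1 + (fst x)\<^sup>2) + \<epsilon> / C0)
        = integral (cbox (-L') L') (\<lambda>s. integral (cbox 0 (2 * pi)) (\<lambda>\<theta>::real. K * inverse (1 + s\<^sup>2) + \<epsilon> / C0))"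
        by (subst integral_prod_continuous) (auto intro!: continuous_intros simp: add_nonneg_eq_0_iff)
      also have "\<dots> = integral {-L'..L'} (\<lambda>s. 2 * pi * (K * inverse (1 + s\<^sup>2) + \<epsilon> / C0))" by simp
      also have "\<dots> \<le> 2 * pi * (K * arctan L' + \<epsilon> / C0 * L') - 2 * pi * (K * arctan (-L') + \<epsilon> / C0 * (-L'))"
      proof (rule integral_le_antiderivative[where h' = "\<lambda>s. 2 * pi * (K * inverse (1 + s\<^sup>2) + \<epsilon> / C0)"])
        show "((\<lambda>s. 2 * pi * (K * arctan s + \<epsilon> / C0 * s)) has_real_derivative
            2 * pi * (K * inverse (1 + x\<^sup>2) + \<epsilon> / C0)) (at x)" for x
          by (auto intro!: derivative_eq_intros simp: divide_inverse)
      qed (use L' in \<open>auto intro!: continuous_intros simp: add_nonneg_eq_0_iff\<close>)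
      also have "\<dots> = 4 * pi * K * arctan L' + 4 * pi / C0 * (\<epsilon> * L')" by (simp add: arctan_minus algebra_simps)
      also have "\<dots> \<le> 4 * pi * K * (pi / 2) + 4 * pi / C0 * (\<epsilon> * L')"
        using arctan_ubound[of L'] K by (intro add_right_mono mult_left_mono) auto
      also have "\<dots> = \<zeta> / 2 + 4 * pi / C0 / cosh L'"
        using L' by (simp add: K_def \<epsilon>_def power2_eq_square)
      finally show ?thesis .
    qed
    finally have "Z \<le> \<zeta> / 2 + X / cosh L'" by (simp add: X_def add_divide_distrib)
    also have "X / cosh L' \<le> \<zeta> / 2"
    proof -
      have "4 * X / \<zeta> = 2 * (2 * X / \<zeta>)" by simp
      then have "2 * X / \<zeta> \<le> cosh L'" using L'(3) cosh_ge_half[of L'] by linarith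
      then show ?thesis using \<zeta> ch by (simp add: field_simps)
    qed
    finally show "Z \<le> 0 + \<zeta>" by simp
  qed
  moreover have "Z \<ge> 0" unfolding Z_def
    by (rule integral_nonneg[OF integrable_continuous[OF D_cont[OF t1]]]) (simp add: D_def)
  ultimately have "Z = 0" by simp
  then have "\<forall>x\<in>cbox (-L, 0) (L, 2 * pi). D x t1 = 0"
    unfolding Z_def
    by (subst (asm) integral_cbox_eq_0_iff[OF D_cont[OF t1]])
      (auto simp: D_def L_def box_ne_empty Basis_prod_def)
  moreover have "(s, \<theta>') \<in> cbox (-L, 0) (L, 2 * pi)" using th by (auto simp: L_def cbox_Pair_eq)
  ultimately have "ell (s, \<theta>', t1) = ell (s, \<theta>' + c, t1)" by (force simp: D_def)
  then show ?thesis using periodic_ell[OF t1, of s \<theta>' k] periodic_ell[OF t1, of s "\<theta>' + c" k]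
    by (simp add: th(1) algebra_simps)
qed

end

section \<open>The Harnack inequality\<close>

text \<open>Stated for functions of one variable, because it is applied both in s and in t.
  \<open>I\<close> stands for the reciprocal of R + \<epsilon>.\<close>

lemma DERIV_harnack_quantity:
  fixes V R R1 R2 I :: "real \<Rightarrow> real"
  assumes "(V has_real_derivative V') (at x)" "(R has_real_derivative R') (at x)"
    "(R1 has_real_derivative R1') (at x)" "(R2 has_real_derivative R2') (at x)"
    "(I has_real_derivative I') (at x)"
  shows "((\<lambda>x. V x * R2 x + (R x)\<^sup>2 - V x * (R1 x)\<^sup>2 * I x + \<epsilon> * R x) has_real_derivative
    V' * R2 x + V x * R2' + 2 * R x * R'
      - (V' * (R1 x)\<^sup>2 * I x + V x * (2 * R1 x * R1') * I x + V x * (R1 x)\<^sup>2 * I') + \<epsilon> * R') (at x)"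
  by (auto intro!: derivative_eq_intros assms simp: power2_eq_square algebra_simps)

text \<open>The function differentiated here is the s-derivative given by
  \<open>DERIV_harnack_quantity\<close>, with the derivative - R1 I^2 of the reciprocal already
  inserted.\<close>

lemma DERIV_harnack_quantity_2:
  fixes V V1 R R1 R2 R3 I :: "real \<Rightarrow> real"
  assumes "(V has_real_derivative V') (at x)" "(V1 has_real_derivative V1') (at x)"
    "(R has_real_derivative R') (at x)" "(R1 has_real_derivative R1') (at x)"
    "(R2 has_real_derivative R2') (at x)" "(R3 has_real_derivative R3') (at x)"
    "(I has_real_derivative I') (at x)"
  shows "((\<lambda>x. V1 x * R2 x + V x * R3 x + 2 * R x * R1 x
      - (V1 x * (R1 x)\<^sup>2 * I x + V x * (2 * R1 x * R2 x) * I x + V x * (R1 x)\<^sup>2 * - (R1 x * (I x)\<^sup>2)) + \<epsilon> * R1 x)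
    has_real_derivative
      V1' * R2 x + V1 x * R2' + V' * R3 x + V x * R3' + 2 * R' * R1 x + 2 * R x * R1'
      - (V1' * (R1 x)\<^sup>2 * I x + V1 x * (2 * R1 x * R1') * I x + V1 x * (R1 x)\<^sup>2 * I')
      - 2 * (V' * R1 x * R2 x * I x + V x * R1' * R2 x * I x + V x * R1 x * R2' * I x + V x * R1 x * R2 x * I')
      + (V' * (R1 x)^3 * (I x)\<^sup>2 + V x * (3 * (R1 x)\<^sup>2 * R1') * (I x)\<^sup>2 + V x * (R1 x)^3 * (2 * I x * I'))
      + \<epsilon> * R1') (at x)"
  by (auto intro!: derivative_eq_intros assms simp: power2_eq_square power3_eq_cube algebra_simps)

text \<open>
  Hamilton's Harnack computation on surfaces, with \<open>R\<close> replaced by \<open>R + \<epsilon>\<close> in the denominators: here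
  \<open>V\<close> is the inverse conformal factor, \<open>e = V\<^sub>s / V\<close>, \<open>R1, \<dots>, R4\<close> are the derivatives of the
  curvature, \<open>P\<close> is its time derivative and \<open>i = 1 / (R + \<epsilon>)\<close>.
\<close>

lemma harnack_identity:
  fixes V e R R1 R2 R3 R4 i \<epsilon> :: real
  assumes "(R + \<epsilon>) * i = 1" "P = V * R2 + R\<^sup>2" "Z = P - V * R1\<^sup>2 * i + \<epsilon> * R"
    "V1 = V * e" "V2 = V * e\<^sup>2 + R" "R1t = V1 * R2 + V * R3 + 2 * R * R1"
    "R2t = V2 * R2 + 2 * V1 * R3 + V * R4 + 2 * R1\<^sup>2 + 2 * R * R2"
    "Z2 = V2 * R2 + V1 * R3 + V1 * R3 + V * R4 + 2 * R1 * R1 + 2 * R * R2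
      - (V2 * R1\<^sup>2 * i + V1 * (2 * R1 * R2) * i + V1 * R1\<^sup>2 * - (R1 * i\<^sup>2))
      - 2 * (V1 * R1 * R2 * i + V * R2 * R2 * i + V * R1 * R3 * i + V * R1 * R2 * - (R1 * i\<^sup>2))
      + (V1 * R1^3 * i\<^sup>2 + V * (3 * R1\<^sup>2 * R2) * i\<^sup>2 + V * R1^3 * (2 * i * - (R1 * i\<^sup>2)))
      + \<epsilon> * R2"
    "Z3 = V * R * R2 + V * R2t + 2 * R * P
      - (V * R * R1\<^sup>2 * i + V * (2 * R1 * R1t) * i + V * R1\<^sup>2 * - (P * i\<^sup>2)) + \<epsilon> * P"
  shows "Z3 = V * Z2 + Z\<^sup>2 * i + (R + \<epsilon>) * (Z * i - R + V * e * R1 * i)\<^sup>2 + R * Z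
    - \<epsilon> * R\<^sup>2 - \<epsilon> * R * (V * R1\<^sup>2) * i\<^sup>2"
proof -
  \<comment> \<open>Once \<epsilon> is written as \<rho> - R, the claim is a polynomial identity
    modulo \<rho> i = 1.\<close>
  define \<rho> where "\<rho> = R + \<epsilon>"
  have \<epsilon>: "\<epsilon> = \<rho> - R" and i: "\<rho> * i = 1" using assms(1) by (simp_all add: \<rho>_def)
  show ?thesis unfolding assms(2-9) \<epsilon> using i by algebra
qed

text \<open>The function stays below the parabola with the same value and slope at x and second
  derivative B. The value of that parabola at its vertex bounds r from above there, hence is
  nonnegative, which is the discriminant condition. It will bound the squared curvature gradient by
  the curvature itself, also where the latter vanishes.\<close>

lemma nonneg_C2_gradient_bound:
  fixes r r' r'' :: "real \<Rightarrow> real"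
  assumes "\<And>x. (r has_real_derivative r' x) (at x)" "\<And>x. (r' has_real_derivative r'' x) (at x)"
    "\<And>x. r x \<ge> 0" "\<And>x. r'' x \<le> B" "B > 0"
  shows "(r' x)\<^sup>2 \<le> 2 * B * r x"
proof -
  define k where "k y = B / 2 * y\<^sup>2 - r y" for y
  have dk: "(k has_real_derivative B * y - r' y) (at y)" for y
    unfolding k_def by (auto intro!: derivative_eq_intros assms(1))
  have "convex_on UNIV k"
  proof (rule f''_ge0_imp_convex[OF convex_UNIV dk])
    show "((\<lambda>y. B * y - r' y) has_real_derivative B - r'' y) (at y)" for y
      by (auto intro!: derivative_eq_intros assms(2))
  qed (use assms(4) in auto)
  \<comment> \<open>The step from x to the vertex of the parabola.\<close>
  define h where "h = - (r' x / B)"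
  have "k (x + h) - k x \<ge> (B * x - r' x) * (x + h - x)"
    by (rule convex_on_imp_above_tangent[OF \<open>convex_on UNIV k\<close>]) (use dk in auto)
  then have "r (x + h) \<le> r x + r' x * h + B / 2 * h\<^sup>2"
    unfolding k_def by (simp add: power2_eq_square algebra_simps)
  then have "0 \<le> r x + r' x * h + B / 2 * h\<^sup>2" using assms(3)[of "x + h"] by simp
  also have "\<dots> = r x - (r' x)\<^sup>2 / (2 * B)"
    using assms(5) by (simp add: h_def power2_eq_square field_simps)
  finally show ?thesis using assms(5) by (simp add: field_simps)
qed

section \<open>The curvature, its evolution and the Harnack quantity\<close>

context ancient_sphere_flow
begin

lemma pd2_pd2_ell: "t < 0 \<Longrightarrow> pd2 (pd2 ell) (s, \<theta>, t) = 0"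
proof -
  assume t: "t < 0"
  have "pd2 ell (s, \<theta>, t) = 0" for \<theta>
  proof (rule DERIV_unique[OF pd2_deriv[OF smooth_ell t]])
    have "(\<lambda>\<theta>. ell (s, \<theta>, t)) = (\<lambda>\<theta>. ell (s, 0, t))"
      using rotation_invariant[OF t, of s 0] by (intro ext) simp
    then show "((\<lambda>\<theta>. ell (s, \<theta>, t)) has_real_derivative 0) (at \<theta>)" by simp
  qed
  then have "(\<lambda>\<theta>. pd2 ell (s, \<theta>, t)) = (\<lambda>\<theta>. 0)" by simp
  then show "pd2 (pd2 ell) (s, \<theta>, t) = 0"
    by (intro DERIV_unique[OF pd2_deriv[OF smooth_slab_pd(2)[OF smooth_ell] t]]) simp
qed

text \<open>The metric \<open>exp (- ell)\<close> times ds^2 + d\<theta>^2 has scalar curvature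
  \<open>exp ell\<close> times the flat Laplacian of \<open>ell\<close>, which the flow equation
  identifies with this time derivative.\<close>

definition Rm :: "real \<times> real \<times> real \<Rightarrow> real" where "Rm = pd3 ell"

lemma smooth_Rm: "smooth_slab Rm"
  unfolding Rm_def by (intro smooth_slab_pd smooth_ell)

lemma Rm_eq: "t < 0 \<Longrightarrow> Rm (s, \<theta>, t) = exp (ell (s, \<theta>, t)) * pd1 (pd1 ell) (s, \<theta>, t)"
  by (simp add: Rm_def ell_eq pd2_pd2_ell)

lemma pd1_pd1_ell: "t < 0 \<Longrightarrow> pd1 (pd1 ell) (s, \<theta>, t) = exp (- ell (s, \<theta>, t)) * Rm (s, \<theta>, t)"
  by (simp add: Rm_eq exp_minus)

lemma Rm_nonneg: "t < 0 \<Longrightarrow> Rm (s, \<theta>, t) \<ge> 0"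
  by (simp add: Rm_def pd3_ell_nonneg)

lemma pd1_eqI:
  assumes "smooth_slab f" "smooth_slab g" "t < 0" "\<And>s. f (s, \<theta>, t) = g (s, \<theta>, t)"
  shows "pd1 f (s, \<theta>, t) = pd1 g (s, \<theta>, t)"
  using pd1_deriv[OF assms(1,3), of \<theta> s] pd1_deriv[OF assms(2,3), of \<theta> s] DERIV_unique
  unfolding assms(4) by blast

text \<open>Obtained by differentiating R = \<open>exp ell\<close> \<open>ell\<close>_ss in time.
  The coefficient changes at the rate \<open>exp ell\<close> R, which produces R^2; interchanging
  derivatives gives R_ss.\<close>

lemma pd3_Rm: "t < 0 \<Longrightarrow> pd3 Rm (s, \<theta>, t) = exp (ell (s, \<theta>, t)) * pd1 (pd1 Rm) (s, \<theta>, t) + (Rm (s, \<theta>, t))\<^sup>2"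
proof -
  assume t: "t < 0"
  note sm = smooth_ell smooth_slab_pd
  have "pd3 (pd1 (pd1 ell)) (s, \<theta>, t) = pd1 (pd3 (pd1 ell)) (s, \<theta>, t)"
    by (intro pd13_commute sm t)
  also have "\<dots> = pd1 (pd1 Rm) (s, \<theta>, t)"
    unfolding Rm_def by (intro pd1_eqI sm t pd13_commute)
  finally have c: "pd3 (pd1 (pd1 ell)) (s, \<theta>, t) = pd1 (pd1 Rm) (s, \<theta>, t)" .
  have dE: "((\<lambda>t. exp (ell (s, \<theta>, t))) has_real_derivative exp (ell (s, \<theta>, t)) * Rm (s, \<theta>, t)) (at t)"
    unfolding Rm_def by (rule DERIV_fun_exp[OF pd3_deriv[OF smooth_ell t]])
  have "((\<lambda>t. exp (ell (s, \<theta>, t)) * pd1 (pd1 ell) (s, \<theta>, t)) has_real_derivative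
      exp (ell (s, \<theta>, t)) * Rm (s, \<theta>, t) * pd1 (pd1 ell) (s, \<theta>, t) + pd1 (pd1 Rm) (s, \<theta>, t) * exp (ell (s, \<theta>, t))) (at t)"
    unfolding c[symmetric] by (intro DERIV_mult dE pd3_deriv sm t)
  then have "((\<lambda>t. Rm (s, \<theta>, t)) has_real_derivative
      exp (ell (s, \<theta>, t)) * Rm (s, \<theta>, t) * pd1 (pd1 ell) (s, \<theta>, t) + pd1 (pd1 Rm) (s, \<theta>, t) * exp (ell (s, \<theta>, t))) (at t)"
    by (rule has_field_derivative_transform_within_open[where S = "{..<0}"]) (use t Rm_eq in auto)
  then have "pd3 Rm (s, \<theta>, t) = exp (ell (s, \<theta>, t)) * Rm (s, \<theta>, t) * pd1 (pd1 ell) (s, \<theta>, t)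
      + pd1 (pd1 Rm) (s, \<theta>, t) * exp (ell (s, \<theta>, t))"
    by (rule DERIV_unique[OF pd3_deriv[OF smooth_Rm t]])
  also have "\<dots> = exp (ell (s, \<theta>, t)) * pd1 (pd1 Rm) (s, \<theta>, t) + (Rm (s, \<theta>, t))\<^sup>2"
    using Rm_eq[OF t, of s \<theta>] by (simp add: power2_eq_square)
  finally show ?thesis .
qed

lemma DERIV_exp_ell:
  assumes "t < 0"
  shows "((\<lambda>s. exp (ell (s, \<theta>, t))) has_real_derivative exp (ell (s, \<theta>, t)) * pd1 ell (s, \<theta>, t)) (at s)"
    "((\<lambda>s. exp (ell (s, \<theta>, t)) * pd1 ell (s, \<theta>, t)) has_real_derivative
       exp (ell (s, \<theta>, t)) * (pd1 ell (s, \<theta>, t))\<^sup>2 + Rm (s, \<theta>, t)) (at s)"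
    "((\<lambda>t. exp (ell (s, \<theta>, t))) has_real_derivative exp (ell (s, \<theta>, t)) * Rm (s, \<theta>, t)) (at t)"
proof -
  show 1: "((\<lambda>s. exp (ell (s, \<theta>, t))) has_real_derivative exp (ell (s, \<theta>, t)) * pd1 ell (s, \<theta>, t)) (at s)"
    by (rule DERIV_fun_exp[OF pd1_deriv[OF smooth_ell assms]])
  show "((\<lambda>s. exp (ell (s, \<theta>, t)) * pd1 ell (s, \<theta>, t)) has_real_derivative
       exp (ell (s, \<theta>, t)) * (pd1 ell (s, \<theta>, t))\<^sup>2 + Rm (s, \<theta>, t)) (at s)"
    using DERIV_mult[OF 1 pd1_deriv[OF smooth_slab_pd(1)[OF smooth_ell] assms]] Rm_eq[OF assms, of s \<theta>]
    by (simp add: power2_eq_square mult.commute mult.left_commute)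
  show "((\<lambda>t. exp (ell (s, \<theta>, t))) has_real_derivative exp (ell (s, \<theta>, t)) * Rm (s, \<theta>, t)) (at t)"
    unfolding Rm_def by (rule DERIV_fun_exp[OF pd3_deriv[OF smooth_ell assms]])
qed

text \<open>This equals \<rho> times (\<open>exp ell\<close> (ln \<rho>)_ss + R) with \<rho> = R +
  \<epsilon>: Hamilton's quantity, the Laplacian of ln R plus R, with ln R replaced by ln
  \<rho>.\<close>

definition harnack :: "real \<Rightarrow> real \<times> real \<times> real \<Rightarrow> real" where
  "harnack \<epsilon> x = exp (ell x) * pd1 (pd1 Rm) x + (Rm x)\<^sup>2
     - exp (ell x) * (pd1 Rm x)\<^sup>2 * inverse (Rm x + \<epsilon>) + \<epsilon> * Rm x"

text \<open>\<open>harnack_identity\<close> with its complete square dropped. The error terms that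
  remain are those with a factor \<epsilon>.\<close>

lemma harnack_deriv:
  assumes "\<epsilon> > 0"
  obtains Z1 Z2 Z3 where
    "\<And>s \<theta> t. t < 0 \<Longrightarrow> ((\<lambda>s. harnack \<epsilon> (s, \<theta>, t)) has_real_derivative Z1 (s, \<theta>, t)) (at s)"
    "\<And>s \<theta> t. t < 0 \<Longrightarrow> ((\<lambda>s. Z1 (s, \<theta>, t)) has_real_derivative Z2 (s, \<theta>, t)) (at s)"
    "\<And>s \<theta> t. t < 0 \<Longrightarrow> ((\<lambda>t. harnack \<epsilon> (s, \<theta>, t)) has_real_derivative Z3 (s, \<theta>, t)) (at t)"
    "\<And>s \<theta> t. t < 0 \<Longrightarrow> Z3 (s, \<theta>, t) \<ge> exp (ell (s, \<theta>, t)) * Z2 (s, \<theta>, t)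
       + (harnack \<epsilon> (s, \<theta>, t))\<^sup>2 / (Rm (s, \<theta>, t) + \<epsilon>) + Rm (s, \<theta>, t) * harnack \<epsilon> (s, \<theta>, t)
       - \<epsilon> * (Rm (s, \<theta>, t))\<^sup>2
       - \<epsilon> * Rm (s, \<theta>, t) * (exp (ell (s, \<theta>, t)) * (pd1 Rm (s, \<theta>, t))\<^sup>2) / (Rm (s, \<theta>, t) + \<epsilon>)\<^sup>2"
proof -
  note sm = smooth_Rm smooth_ell smooth_slab_pd
  define I where "I x = inverse (Rm x + \<epsilon>)" for x
  define Vs where "Vs x = exp (ell x) * pd1 ell x" for x
  define Vss where "Vss x = exp (ell x) * (pd1 ell x)\<^sup>2 + Rm x" for x
  define R1t where "R1t x = Vs x * pd1 (pd1 Rm) x + exp (ell x) * pd1 (pd1 (pd1 Rm)) x + 2 * Rm x * pd1 Rm x" for x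
  define R2t where "R2t x = Vss x * pd1 (pd1 Rm) x + 2 * Vs x * pd1 (pd1 (pd1 Rm)) x
     + exp (ell x) * pd1 (pd1 (pd1 (pd1 Rm))) x + 2 * (pd1 Rm x)\<^sup>2 + 2 * Rm x * pd1 (pd1 Rm) x" for x
  define Z1 where "Z1 x = Vs x * pd1 (pd1 Rm) x + exp (ell x) * pd1 (pd1 (pd1 Rm)) x + 2 * Rm x * pd1 Rm x
      - (Vs x * (pd1 Rm x)\<^sup>2 * I x + exp (ell x) * (2 * pd1 Rm x * pd1 (pd1 Rm) x) * I x
        + exp (ell x) * (pd1 Rm x)\<^sup>2 * - (pd1 Rm x * (I x)\<^sup>2)) + \<epsilon> * pd1 Rm x" for x
  define Z2 where "Z2 x = (let V = exp (ell x); V1 = Vs x; V2 = Vss x; R = Rm x; R1 = pd1 Rm x; R2 = pd1 (pd1 Rm) x;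
      R3 = pd1 (pd1 (pd1 Rm)) x; R4 = pd1 (pd1 (pd1 (pd1 Rm))) x; i = I x in
      V2 * R2 + V1 * R3 + V1 * R3 + V * R4 + 2 * R1 * R1 + 2 * R * R2
      - (V2 * R1\<^sup>2 * i + V1 * (2 * R1 * R2) * i + V1 * R1\<^sup>2 * - (R1 * i\<^sup>2))
      - 2 * (V1 * R1 * R2 * i + V * R2 * R2 * i + V * R1 * R3 * i + V * R1 * R2 * - (R1 * i\<^sup>2))
      + (V1 * R1^3 * i\<^sup>2 + V * (3 * R1\<^sup>2 * R2) * i\<^sup>2 + V * R1^3 * (2 * i * - (R1 * i\<^sup>2)))
      + \<epsilon> * R2)" for x
  define Z3 where "Z3 x = (let V = exp (ell x); R = Rm x; R1 = pd1 Rm x; R2 = pd1 (pd1 Rm) x; i = I x; P = pd3 Rm x in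
      V * R * R2 + V * R2t x + 2 * R * P
      - (V * R * R1\<^sup>2 * i + V * (2 * R1 * R1t x) * i + V * R1\<^sup>2 * - (P * i\<^sup>2)) + \<epsilon> * P)" for x
  have dI: "((\<lambda>s. I (s, \<theta>, t)) has_real_derivative - (pd1 Rm (s, \<theta>, t) * (I (s, \<theta>, t))\<^sup>2)) (at s)"
    "((\<lambda>t. I (s, \<theta>, t)) has_real_derivative - (pd3 Rm (s, \<theta>, t) * (I (s, \<theta>, t))\<^sup>2)) (at t)"
    if t: "t < 0" for s \<theta> t
  proof -
    have "Rm (s, \<theta>, t) + \<epsilon> \<noteq> 0" using Rm_nonneg[OF t, of s \<theta>] assms by simp
    then show "((\<lambda>s. I (s, \<theta>, t)) has_real_derivative - (pd1 Rm (s, \<theta>, t) * (I (s, \<theta>, t))\<^sup>2)) (at s)"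
      "((\<lambda>t. I (s, \<theta>, t)) has_real_derivative - (pd3 Rm (s, \<theta>, t) * (I (s, \<theta>, t))\<^sup>2)) (at t)"
      unfolding I_def
      by (auto intro!: derivative_eq_intros pd1_deriv pd3_deriv sm t simp: power2_eq_square)
  qed
  \<comment> \<open>Time derivatives of R_s and R_ss are found by interchanging derivatives and
    differentiating R_t = V R_ss + R^2 in s.\<close>
  have R1t: "pd3 (pd1 Rm) (s, \<theta>, t) = R1t (s, \<theta>, t)" if t: "t < 0" for s \<theta> t
  proof -
    have "pd3 (pd1 Rm) (s, \<theta>, t) = pd1 (pd3 Rm) (s, \<theta>, t)" by (intro pd13_commute sm t)
    also have "\<dots> = R1t (s, \<theta>, t)"
    proof (rule DERIV_unique[OF pd1_deriv[OF smooth_slab_pd(3)[OF smooth_Rm] t]])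
      have "((\<lambda>s. exp (ell (s, \<theta>, t)) * pd1 (pd1 Rm) (s, \<theta>, t) + (Rm (s, \<theta>, t))\<^sup>2) has_real_derivative R1t (s, \<theta>, t)) (at s)"
        unfolding R1t_def Vs_def
        by (rule derivative_eq_intros DERIV_exp_ell(1) pd1_deriv sm t refl)+ (simp add: power2_eq_square algebra_simps)
      then show "((\<lambda>s. pd3 Rm (s, \<theta>, t)) has_real_derivative R1t (s, \<theta>, t)) (at s)"
        by (simp add: pd3_Rm[OF t])
    qed
    finally show ?thesis .
  qed
  have R2t: "pd3 (pd1 (pd1 Rm)) (s, \<theta>, t) = R2t (s, \<theta>, t)" if t: "t < 0" for s \<theta> t
  proof -
    have "pd3 (pd1 (pd1 Rm)) (s, \<theta>, t) = pd1 (pd3 (pd1 Rm)) (s, \<theta>, t)" by (intro pd13_commute sm t)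
    also have "\<dots> = R2t (s, \<theta>, t)"
    proof (rule DERIV_unique[OF pd1_deriv[OF smooth_slab_pd(3)[OF smooth_slab_pd(1)[OF smooth_Rm]] t]])
      have "((\<lambda>s. R1t (s, \<theta>, t)) has_real_derivative R2t (s, \<theta>, t)) (at s)"
        unfolding R1t_def R2t_def Vs_def Vss_def
        by (rule derivative_eq_intros DERIV_exp_ell(1,2)[OF t] pd1_deriv sm t refl)+ (simp add: power2_eq_square algebra_simps)
      then show "((\<lambda>s. pd3 (pd1 Rm) (s, \<theta>, t)) has_real_derivative R2t (s, \<theta>, t)) (at s)"
        by (simp add: R1t[OF t])
    qed
    finally show ?thesis .
  qed
  show ?thesis
  proof
    fix s \<theta> t assume t: "t < (0::real)"
    show "((\<lambda>s. harnack \<epsilon> (s, \<theta>, t)) has_real_derivative Z1 (s, \<theta>, t)) (at s)"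
      unfolding harnack_def Z1_def I_def[symmetric] Vs_def
      by (intro DERIV_harnack_quantity DERIV_exp_ell pd1_deriv sm t dI)
    show "((\<lambda>s. Z1 (s, \<theta>, t)) has_real_derivative Z2 (s, \<theta>, t)) (at s)"
      unfolding Z1_def Z2_def Let_def
      by (intro DERIV_harnack_quantity_2 DERIV_exp_ell[folded Vs_def Vss_def] pd1_deriv sm t dI)
    show "((\<lambda>t. harnack \<epsilon> (s, \<theta>, t)) has_real_derivative Z3 (s, \<theta>, t)) (at t)"
      unfolding harnack_def Z3_def I_def[symmetric] Let_def R1t[OF t, symmetric] R2t[OF t, symmetric]
      by (intro DERIV_harnack_quantity DERIV_exp_ell pd3_deriv sm t dI)
    let ?x = "(s, \<theta>, t)"
    have r: "Rm ?x + \<epsilon> > 0" using Rm_nonneg[OF t, of s \<theta>] assms by simp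
    then have i: "(Rm ?x + \<epsilon>) * I ?x = 1" by (simp add: I_def)
    have "Z3 ?x = exp (ell ?x) * Z2 ?x + (harnack \<epsilon> ?x)\<^sup>2 * I ?x
      + (Rm ?x + \<epsilon>) * (harnack \<epsilon> ?x * I ?x - Rm ?x + exp (ell ?x) * pd1 ell ?x * pd1 Rm ?x * I ?x)\<^sup>2
      + Rm ?x * harnack \<epsilon> ?x - \<epsilon> * (Rm ?x)\<^sup>2 - \<epsilon> * Rm ?x * (exp (ell ?x) * (pd1 Rm ?x)\<^sup>2) * (I ?x)\<^sup>2"
      by (rule harnack_identity[OF i pd3_Rm[OF t] _ Vs_def Vss_def R1t_def R2t_def Z2_def[unfolded Let_def] Z3_def[unfolded Let_def]])
        (simp add: harnack_def I_def pd3_Rm[OF t])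
    moreover have "(Rm ?x + \<epsilon>) * (harnack \<epsilon> ?x * I ?x - Rm ?x + exp (ell ?x) * pd1 ell ?x * pd1 Rm ?x * I ?x)\<^sup>2 \<ge> 0"
      using r by (intro mult_nonneg_nonneg) auto
    ultimately show "Z3 ?x \<ge> exp (ell ?x) * Z2 ?x
       + (harnack \<epsilon> ?x)\<^sup>2 / (Rm ?x + \<epsilon>) + Rm ?x * harnack \<epsilon> ?x - \<epsilon> * (Rm ?x)\<^sup>2
       - \<epsilon> * Rm ?x * (exp (ell ?x) * (pd1 Rm ?x)\<^sup>2) / (Rm ?x + \<epsilon>)\<^sup>2"
      unfolding I_def by (simp add: divide_inverse power_inverse)
  qed
qed

end

text \<open>The differential inequality for f = - (Z + \<rho> / \<tau>) - \<eta> E at points where f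
  is positive. The square Z^2 / \<rho> cancels the derivative of \<rho> / \<tau>; since \<eta> is at
  least \<epsilon> and at least \<epsilon> C, the errors carrying \<epsilon> are dominated by \<eta>
  E. The three bounds C, C^2 and C for the remaining terms add up to A.\<close>

lemma harnack_step:
  fixes V Z Z2 Z3 R R2 P N \<rho> \<epsilon> \<tau> E \<eta> A C f :: real
  assumes Z3: "Z3 \<ge> V * Z2 + Z\<^sup>2 / \<rho> + R * Z - \<epsilon> * R\<^sup>2 - \<epsilon> * R * N / \<rho>\<^sup>2"
    and P: "P = V * R2 + R\<^sup>2" and \<rho>: "\<rho> = R + \<epsilon>" and \<epsilon>: "\<epsilon> > 0" and R: "0 \<le> R" "R \<le> C"
    and N: "N \<le> C * R" and \<tau>: "\<tau> > 0" and E: "E \<ge> 1" and \<eta>: "\<eta> = \<epsilon> * (1 + C)" and A: "A = 2 * C + C\<^sup>2"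
    and f: "f = - (Z + \<rho> / \<tau>) - \<eta> * E" and f_pos: "f > 0"
  shows "- (Z3 + (P * \<tau> - \<rho>) / \<tau>\<^sup>2) - \<eta> * A * E \<le> V * (- (Z2 + R2 / \<tau>)) + C * f"
proof -
  define y where "y = Z + \<rho> / \<tau>"
  have Z: "Z = y - \<rho> / \<tau>" by (simp add: y_def)
  have y: "- y = f + \<eta> * E" using f by (simp add: y_def)
  have C: "C \<ge> 0" using R by simp
  have \<rho>_pos: "\<rho> > 0" using \<rho> R \<epsilon> by simp
  have \<eta>_ge: "\<eta> \<ge> \<epsilon>" "\<eta> \<ge> 0" using \<epsilon> C by (simp_all add: \<eta> distrib_left)
  have \<eta>E: "\<eta> \<le> \<eta> * E" using mult_left_mono[OF E \<eta>_ge(2)] by simp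
  \<comment> \<open>Expanding Z^2 = (y - \<rho> / \<tau>)^2 and discarding y^2 / \<rho>: the tangent
    to the square at - \<rho> / \<tau>, the value of Z for which y vanishes.\<close>
  have sq: "Z\<^sup>2 / \<rho> \<ge> - (2 * y / \<tau>) + \<rho> / \<tau>\<^sup>2"
  proof -
    have "Z\<^sup>2 / \<rho> = y\<^sup>2 / \<rho> - 2 * y / \<tau> + \<rho> / \<tau>\<^sup>2"
      unfolding Z using \<rho>_pos \<tau> by (simp add: power2_eq_square field_simps)
    moreover have "y\<^sup>2 / \<rho> \<ge> 0" using \<rho>_pos by simp
    ultimately show ?thesis by simp
  qed
  have t1: "(2 * y + \<epsilon> * R) / \<tau> \<le> 0"
  proof (rule divide_nonpos_pos[OF _ \<tau>])
    have "\<epsilon> * R \<le> \<epsilon> * C" using R \<epsilon> by simp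
    also have "\<epsilon> * C \<le> \<eta>" using \<epsilon> by (simp add: \<eta> distrib_left)
    finally show "2 * y + \<epsilon> * R \<le> 0" using y f_pos \<eta>E \<eta>_ge by linarith
  qed
  have t2: "- (R * y) \<le> C * f + \<eta> * E * C"
  proof -
    have "R * (- y) \<le> C * (- y)" using R y f_pos \<eta>E \<eta>_ge by (intro mult_right_mono) linarith+
    then have "- (R * y) \<le> C * (- y)" by simp
    also have "\<dots> = C * f + \<eta> * E * C" unfolding y by (simp add: algebra_simps)
    finally show ?thesis .
  qed
  have t3: "\<epsilon> * R\<^sup>2 \<le> \<eta> * E * C\<^sup>2"
  proof (rule mult_mono)
    show "R\<^sup>2 \<le> C\<^sup>2" using R by (intro power_mono) auto
  qed (use \<eta>E \<eta>_ge in auto)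
  have t4: "\<epsilon> * R * N / \<rho>\<^sup>2 \<le> \<eta> * E * C"
  proof -
    have "\<epsilon> * R * N \<le> \<epsilon> * R * (C * R)" using N R \<epsilon> by (intro mult_left_mono) auto
    also have "\<dots> = \<epsilon> * C * R\<^sup>2" by (simp add: power2_eq_square)
    also have "\<dots> \<le> \<epsilon> * C * \<rho>\<^sup>2" using R \<epsilon> C \<rho> by (intro mult_left_mono power_mono) auto
    finally have "\<epsilon> * R * N / \<rho>\<^sup>2 \<le> \<epsilon> * C" using \<rho>_pos by (simp add: field_simps)
    also have "\<dots> \<le> \<eta> * E * C" using \<eta>E \<eta>_ge C by (intro mult_right_mono) auto
    finally show ?thesis .
  qed
  have "- (Z3 + (P * \<tau> - \<rho>) / \<tau>\<^sup>2) - V * (- (Z2 + R2 / \<tau>))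
      = - (Z3 - V * Z2) - R\<^sup>2 / \<tau> + \<rho> / \<tau>\<^sup>2"
    unfolding P using \<tau> by (simp add: power2_eq_square field_simps)
  also have "\<dots> \<le> - (- (2 * y / \<tau>) + \<rho> / \<tau>\<^sup>2 + R * Z - \<epsilon> * R\<^sup>2 - \<epsilon> * R * N / \<rho>\<^sup>2) - R\<^sup>2 / \<tau> + \<rho> / \<tau>\<^sup>2"
    using Z3 sq by linarith
  also have "\<dots> = (2 * y + \<epsilon> * R) / \<tau> - R * y + \<epsilon> * R\<^sup>2 + \<epsilon> * R * N / \<rho>\<^sup>2"
    unfolding Z \<rho> using \<tau> by (simp add: add_divide_distrib distrib_left right_diff_distrib power2_eq_square)
  also have "\<dots> \<le> 0 + (C * f + \<eta> * E * C) + \<eta> * E * C\<^sup>2 + \<eta> * E * C"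
    using t1 t2 t3 t4 by linarith
  also have "\<dots> = C * f + \<eta> * A * E" by (simp add: A algebra_simps)
  finally show ?thesis by simp
qed

section \<open>Sign and bounds of the curvature up to the poles\<close>

context sphere_flow
begin

lemma lu_antipodal_meridian: "lu (pi - \<psi>, \<theta> + pi, t) = lu (\<psi>, \<theta>, t)"
  by (simp add: lu_def sphere_point_antipodal_meridian)

text \<open>All real \<psi> are needed, because \<open>nonneg_C2_gradient_bound\<close> asks for a
  sign on the whole line. Mercator's coordinate covers |\<psi>| < pi/2, continuity adds the poles,
  passing to the opposite meridian adds the next half turn, and periodicity the rest.\<close>

lemma pd3_lu_nonpos:
  assumes t: "t < 0"
  shows "pd3 lu (\<psi>, \<theta>, t) \<le> 0"
proof -
  have cl: "pd3 lu (\<psi>, \<theta>, t) \<le> 0" if "- (pi / 2) \<le> \<psi>" "\<psi> \<le> pi / 2" for \<psi> \<theta>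
  proof (rule continuous_le_on_closure[of "{- (pi/2)<..<pi/2}" "\<lambda>\<psi>. pd3 lu (\<psi>, \<theta>, t)"])
    show "continuous_on (closure {- (pi / 2)<..<pi / 2}) (\<lambda>\<psi>. pd3 lu (\<psi>, \<theta>, t))"
      by (intro smooth_slab_cont smooth_slab_pd smooth_lu continuous_intros t)
    show "\<psi> \<in> closure {- (pi / 2)<..<pi / 2}"
      using that by (subst closure_greaterThanLessThan) auto
    fix x assume "x \<in> {- (pi / 2)<..<pi / 2}"
    then obtain s where "x = gd s" using gd_surj by auto
    then show "pd3 lu (x, \<theta>, t) \<le> 0"
      using pd3_ell_nonneg[OF t, of s \<theta>] by (simp add: pd_ell[OF t])
  qed
  obtain y k where y: "\<psi> + pi / 2 = y + 2 * pi * of_int k" "0 \<le> y" "y \<le> 2 * pi"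
    by (rule ex_period_representative)
  have "\<psi> = (y - pi / 2) + 2 * pi * of_int k" using y(1) by simp
  moreover have "pd3 lu ((y - pi / 2) + 2 * pi * of_int k, \<theta> + 2 * pi * of_int 0, t) = pd3 lu (y - pi / 2, \<theta>, t)"
    using doubly_periodic_pd(3)[OF smooth_lu periodic_lu] t unfolding doubly_periodic_def by blast
  ultimately have p: "pd3 lu (\<psi>, \<theta>, t) = pd3 lu (y - pi / 2, \<theta>, t)" by simp
  show ?thesis
  proof (cases "y \<le> pi")
    case True
    then show ?thesis using cl[of "y - pi / 2" \<theta>] y p by simp
  next
    case False
    let ?z = "y - pi / 2"
    have "((\<lambda>t. lu (?z, \<theta>, t)) has_real_derivative pd3 lu (pi - ?z, \<theta> + pi, t)) (at t)"
      using pd3_deriv[OF smooth_lu t, of "pi - ?z" "\<theta> + pi"] unfolding lu_antipodal_meridian .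
    then have "pd3 lu (?z, \<theta>, t) = pd3 lu (pi - ?z, \<theta> + pi, t)"
      using DERIV_unique[OF pd3_deriv[OF smooth_lu t]] by blast
    also have "\<dots> \<le> 0" using False y by (intro cl) auto
    finally show ?thesis using p by simp
  qed
qed

end

context ancient_sphere_flow
begin

lemma Rm_lu: "t < 0 \<Longrightarrow> Rm (s, \<theta>, t) = - pd3 lu (gd s, \<theta>, t)"
  by (simp add: Rm_def pd_ell)

lemma pd_Rm:
  assumes t: "t < 0"
  shows "pd1 Rm (s, \<theta>, t) = - (pd1 (pd3 lu) (gd s, \<theta>, t) / cosh s)"
    "pd3 Rm (s, \<theta>, t) = - pd3 (pd3 lu) (gd s, \<theta>, t)"
proof -
  have "((\<lambda>s. - pd3 lu (gd s, \<theta>, t)) has_real_derivative - (pd1 (pd3 lu) (gd s, \<theta>, t) * (1 / cosh s))) (at s)"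
    by (rule DERIV_minus[OF DERIV_chain2[OF pd1_deriv[OF smooth_slab_pd(3)[OF smooth_lu] t] DERIV_gd[OF DERIV_ident]]])
  then show "pd1 Rm (s, \<theta>, t) = - (pd1 (pd3 lu) (gd s, \<theta>, t) / cosh s)"
    using DERIV_unique[OF pd1_deriv[OF smooth_Rm t, of \<theta> s, unfolded Rm_lu[OF t]]] by simp
  have "((\<lambda>t. Rm (s, \<theta>, t)) has_real_derivative - pd3 (pd3 lu) (gd s, \<theta>, t)) (at t)"
    by (rule has_field_derivative_transform_within_open[where S = "{..<0}"
          and f = "\<lambda>t. - pd3 lu (gd s, \<theta>, t)"])
      (use t Rm_lu in \<open>auto intro!: DERIV_minus pd3_deriv smooth_slab_pd smooth_lu\<close>)
  then show "pd3 Rm (s, \<theta>, t) = - pd3 (pd3 lu) (gd s, \<theta>, t)"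
    by (rule DERIV_unique[OF pd3_deriv[OF smooth_Rm t]])
qed

text \<open>The last bound is what makes the Harnack quotient bounded uniformly in \<epsilon>. The
  growth \<open>cosh^2\<close> of \<open>exp ell\<close> cancels against the square of the factor 1
  / cosh s in \<open>pd1 Rm\<close>, so that a bound in the latitude coordinate suffices.\<close>

lemma Rm_bounds:
  assumes t1: "t1 < 0"
  obtains K where "K > 0" "\<And>s \<theta> t. T \<le> t \<Longrightarrow> t \<le> t1 \<Longrightarrow> Rm (s, \<theta>, t) \<le> K"
    "\<And>s \<theta> t. T \<le> t \<Longrightarrow> t \<le> t1 \<Longrightarrow> \<bar>pd3 Rm (s, \<theta>, t)\<bar> \<le> K"
    "\<And>s \<theta> t. T \<le> t \<Longrightarrow> t \<le> t1 \<Longrightarrow> exp (ell (s, \<theta>, t)) * (pd1 Rm (s, \<theta>, t))\<^sup>2 \<le> K * Rm (s, \<theta>, t)"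
proof -
  note sm = smooth_lu smooth_slab_pd
  note per = periodic_lu doubly_periodic_pd
  have bnd: "\<exists>B>0. \<forall>s \<theta> t. T \<le> t \<longrightarrow> t \<le> t1 \<longrightarrow> \<bar>f (s, \<theta>, t)\<bar> \<le> B"
    if "smooth_slab f" "doubly_periodic f" for f
    by (rule doubly_periodic_bounded[OF C_infinity_onD(3)[OF that(1)] that(2) t1, of T]) blast
  have "\<exists>B>0. \<forall>s \<theta> t. T \<le> t \<longrightarrow> t \<le> t1 \<longrightarrow> \<bar>pd3 lu (s, \<theta>, t)\<bar> \<le> B"
    by (intro bnd sm per)
  then obtain B1 where B1: "B1 > 0" "\<And>s \<theta> t. T \<le> t \<Longrightarrow> t \<le> t1 \<Longrightarrow> \<bar>pd3 lu (s, \<theta>, t)\<bar> \<le> B1" by blast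
  have "\<exists>B>0. \<forall>s \<theta> t. T \<le> t \<longrightarrow> t \<le> t1 \<longrightarrow> \<bar>pd3 (pd3 lu) (s, \<theta>, t)\<bar> \<le> B"
    by (intro bnd sm per)
  then obtain B2 where B2: "B2 > 0" "\<And>s \<theta> t. T \<le> t \<Longrightarrow> t \<le> t1 \<Longrightarrow> \<bar>pd3 (pd3 lu) (s, \<theta>, t)\<bar> \<le> B2" by blast
  have "\<exists>B>0. \<forall>s \<theta> t. T \<le> t \<longrightarrow> t \<le> t1 \<longrightarrow> \<bar>pd1 (pd1 (pd3 lu)) (s, \<theta>, t)\<bar> \<le> B"
    by (intro bnd sm per)
  then obtain B3 where B3: "B3 > 0" "\<And>s \<theta> t. T \<le> t \<Longrightarrow> t \<le> t1 \<Longrightarrow> \<bar>pd1 (pd1 (pd3 lu)) (s, \<theta>, t)\<bar> \<le> B3" by blast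
  obtain M where M: "M > 0" "\<And>s \<theta> t. T \<le> t \<Longrightarrow> t \<le> t1 \<Longrightarrow> exp (ell (s, \<theta>, t)) \<le> M * (cosh s)\<^sup>2"
    by (rule exp_ell_bounds[OF t1, of T]) blast
  define K where "K = B1 + B2 + M * (2 * B3)"
  have K: "B1 \<le> K" "B2 \<le> K" "M * (2 * B3) \<le> K"
    using B1(1) B2(1) B3(1) M(1) by (simp_all add: K_def)
  show ?thesis
  proof
    show "K > 0" using B1 K by simp
    fix s \<theta> t assume t: "T \<le> t" "t \<le> t1"
    have tn: "t < 0" using t t1 by simp
    show "Rm (s, \<theta>, t) \<le> K" using B1(2)[OF t, of "gd s" \<theta>] K unfolding Rm_lu[OF tn] by linarith
    show "\<bar>pd3 Rm (s, \<theta>, t)\<bar> \<le> K" using B2(2)[OF t, of "gd s" \<theta>] K by (simp add: pd_Rm[OF tn])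
    \<comment> \<open>Applied in \<psi> rather than in s, where the second derivative is bounded on
      the whole line by periodicity.\<close>
    have "(- pd1 (pd3 lu) (gd s, \<theta>, t))\<^sup>2 \<le> 2 * B3 * (- pd3 lu (gd s, \<theta>, t))"
    proof (rule nonneg_C2_gradient_bound[where r = "\<lambda>x. - pd3 lu (x, \<theta>, t)"
          and r' = "\<lambda>x. - pd1 (pd3 lu) (x, \<theta>, t)" and r'' = "\<lambda>x. - pd1 (pd1 (pd3 lu)) (x, \<theta>, t)"])
      show "((\<lambda>x. - pd3 lu (x, \<theta>, t)) has_real_derivative - pd1 (pd3 lu) (x, \<theta>, t)) (at x)"
        "((\<lambda>x. - pd1 (pd3 lu) (x, \<theta>, t)) has_real_derivative - pd1 (pd1 (pd3 lu)) (x, \<theta>, t)) (at x)" for x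
        by (intro DERIV_minus pd1_deriv sm tn)+
      show "0 \<le> - pd3 lu (x, \<theta>, t)" for x using pd3_lu_nonpos[OF tn] by simp
      show "- pd1 (pd1 (pd3 lu)) (x, \<theta>, t) \<le> B3" for x using B3(2)[OF t, of x \<theta>] by linarith
    qed (rule B3(1))
    then have g: "(pd1 (pd3 lu) (gd s, \<theta>, t))\<^sup>2 \<le> 2 * B3 * Rm (s, \<theta>, t)" by (simp add: Rm_lu[OF tn])
    have c: "(cosh s)\<^sup>2 > 0" using cosh_real_pos[of s] by simp
    have "exp (ell (s, \<theta>, t)) * (pd1 Rm (s, \<theta>, t))\<^sup>2 \<le> (M * (cosh s)\<^sup>2) * (pd1 Rm (s, \<theta>, t))\<^sup>2"
      using M(2)[OF t] by (intro mult_right_mono) auto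
    also have "\<dots> = M * (pd1 (pd3 lu) (gd s, \<theta>, t))\<^sup>2"
      using c by (simp add: pd_Rm[OF tn] power_divide)
    also have "\<dots> \<le> M * (2 * B3 * Rm (s, \<theta>, t))" using g M(1) by simp
    also have "\<dots> = (M * (2 * B3)) * Rm (s, \<theta>, t)" by simp
    also have "\<dots> \<le> K * Rm (s, \<theta>, t)" using K(3) Rm_nonneg[OF tn] by (rule mult_right_mono)
    finally show "exp (ell (s, \<theta>, t)) * (pd1 Rm (s, \<theta>, t))\<^sup>2 \<le> K * Rm (s, \<theta>, t)" .
  qed
qed

lemma smooth_harnack:
  assumes "\<epsilon> > 0" shows "smooth_slab (harnack \<epsilon>)"
proof -
  have pos: "Rm x + \<epsilon> > 0" if "x \<in> slab" for x
    using that Rm_nonneg assms by (cases x) (simp add: add_nonneg_pos)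
  show ?thesis
    unfolding harnack_def[abs_def] power2_eq_square
    by (intro smooth_intros smooth_Rm smooth_ell open_slab pos)
qed

lemma harnack_eq:
  "t < 0 \<Longrightarrow> harnack \<epsilon> (s, \<theta>, t) = pd3 Rm (s, \<theta>, t)
     - exp (ell (s, \<theta>, t)) * (pd1 Rm (s, \<theta>, t))\<^sup>2 / (Rm (s, \<theta>, t) + \<epsilon>) + \<epsilon> * Rm (s, \<theta>, t)"
  by (simp add: harnack_def pd3_Rm divide_inverse)

text \<open>The maximum principle shows that Z + \<rho> / \<sigma> cannot fall below the
  exponentially growing multiple - \<eta> exp(A (t - T)) of \<epsilon>, which absorbs the errors of
  the regularized computation. Here \<open>K\<close> is fixed independently of \<epsilon>.\<close>

lemma harnack_lower_bound:
  assumes T: "T < \<tau>" "\<tau> < 0" and \<epsilon>: "\<epsilon> > 0"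
    and K: "K > 0" "\<And>s \<theta> t. T \<le> t \<Longrightarrow> t \<le> \<tau> \<Longrightarrow> Rm (s, \<theta>, t) \<le> K"
    "\<And>s \<theta> t. T \<le> t \<Longrightarrow> t \<le> \<tau> \<Longrightarrow> \<bar>pd3 Rm (s, \<theta>, t)\<bar> \<le> K"
    "\<And>s \<theta> t. T \<le> t \<Longrightarrow> t \<le> \<tau> \<Longrightarrow> exp (ell (s, \<theta>, t)) * (pd1 Rm (s, \<theta>, t))\<^sup>2 \<le> K * Rm (s, \<theta>, t)"
  shows "pd3 Rm (s, \<theta>0, \<tau>) + \<epsilon> * Rm (s, \<theta>0, \<tau>) + (Rm (s, \<theta>0, \<tau>) + \<epsilon>) / (\<tau> - T)
    \<ge> - (\<epsilon> * (1 + K) * exp ((2 * K + K\<^sup>2) * (\<tau> - T)))"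
proof -
  obtain Z1 Z2 Z3 where
    Z1: "\<And>s \<theta> t. t < 0 \<Longrightarrow> ((\<lambda>s. harnack \<epsilon> (s, \<theta>, t)) has_real_derivative Z1 (s, \<theta>, t)) (at s)" and
    Z2: "\<And>s \<theta> t. t < 0 \<Longrightarrow> ((\<lambda>s. Z1 (s, \<theta>, t)) has_real_derivative Z2 (s, \<theta>, t)) (at s)" and
    Z3: "\<And>s \<theta> t. t < 0 \<Longrightarrow> ((\<lambda>t. harnack \<epsilon> (s, \<theta>, t)) has_real_derivative Z3 (s, \<theta>, t)) (at t)" and
    Z: "\<And>s \<theta> t. t < 0 \<Longrightarrow> Z3 (s, \<theta>, t) \<ge> exp (ell (s, \<theta>, t)) * Z2 (s, \<theta>, t)
       + (harnack \<epsilon> (s, \<theta>, t))\<^sup>2 / (Rm (s, \<theta>, t) + \<epsilon>) + Rm (s, \<theta>, t) * harnack \<epsilon> (s, \<theta>, t)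
       - \<epsilon> * (Rm (s, \<theta>, t))\<^sup>2
       - \<epsilon> * Rm (s, \<theta>, t) * (exp (ell (s, \<theta>, t)) * (pd1 Rm (s, \<theta>, t))\<^sup>2) / (Rm (s, \<theta>, t) + \<epsilon>)\<^sup>2"
    by (rule harnack_deriv[OF \<epsilon>]) blast
  obtain M where M: "M > 0" "\<And>s \<theta> t. T \<le> t \<Longrightarrow> t \<le> \<tau> \<Longrightarrow> exp (ell (s, \<theta>, t)) \<le> M * (cosh s)\<^sup>2"
    by (rule exp_ell_bounds[OF T(2), of T]) blast
  note sm = smooth_Rm smooth_slab_pd
  have lower: "harnack \<epsilon> (s, \<theta>, t) \<ge> - (2 * K)" if t: "T \<le> t" "t \<le> \<tau>" for s \<theta> t
  proof -
    have tn: "t < 0" using t T by simp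
    have r: "Rm (s, \<theta>, t) \<ge> 0" by (rule Rm_nonneg[OF tn])
    have "exp (ell (s, \<theta>, t)) * (pd1 Rm (s, \<theta>, t))\<^sup>2 / (Rm (s, \<theta>, t) + \<epsilon>) \<le> K * Rm (s, \<theta>, t) / (Rm (s, \<theta>, t) + \<epsilon>)"
      using K(4)[OF t] r \<epsilon> by (intro divide_right_mono) auto
    also have "\<dots> \<le> K" using r \<epsilon> K(1) by (simp add: field_simps)
    finally show ?thesis
      using K(3)[OF t, of s \<theta>] mult_nonneg_nonneg[of \<epsilon> "Rm (s, \<theta>, t)"] \<epsilon> r
      unfolding harnack_eq[OF tn] by linarith
  qed
  \<comment> \<open>Shifting the clock by \<kappa> avoids the singularity of 1 / (t - T). At time T
    the term \<rho> / \<kappa> is at least \<epsilon> / \<kappa> = 2 K, which outweighs the lower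
    bound -2 K for the Harnack quantity.\<close>
  define \<kappa> where "\<kappa> = \<epsilon> / (2 * K)"
  have \<kappa>: "\<kappa> > 0" using \<epsilon> K by (simp add: \<kappa>_def)
  define A where "A = 2 * K + K\<^sup>2"
  define \<eta> where "\<eta> = \<epsilon> * (1 + K)"
  have \<eta>: "\<eta> > 0" using \<epsilon> K by (simp add: \<eta>_def)
  define \<sigma> where "\<sigma> t = t - T + \<kappa>" for t
  have \<sigma>: "\<sigma> t > 0" if "T \<le> t" for t using that \<kappa> by (simp add: \<sigma>_def)
  \<comment> \<open>The longitude is frozen at \<theta>0, so f is constant in \<theta> and the
    two-dimensional maximum principle applies with vanishing \<theta>-derivatives.\<close>
  define f where "f = (\<lambda>(s, \<theta>::real, t). - (harnack \<epsilon> (s, \<theta>0, t) + (Rm (s, \<theta>0, t) + \<epsilon>) / \<sigma> t)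
    - \<eta> * exp (A * (t - T)))"
  define f1 where "f1 = (\<lambda>(s, \<theta>::real, t). - (Z1 (s, \<theta>0, t) + pd1 Rm (s, \<theta>0, t) / \<sigma> t))"
  define f11 where "f11 = (\<lambda>(s, \<theta>::real, t). - (Z2 (s, \<theta>0, t) + pd1 (pd1 Rm) (s, \<theta>0, t) / \<sigma> t))"
  define f3 where "f3 = (\<lambda>(s, \<theta>::real, t). - (Z3 (s, \<theta>0, t) + (pd3 Rm (s, \<theta>0, t) * \<sigma> t - (Rm (s, \<theta>0, t) + \<epsilon>)) / (\<sigma> t)\<^sup>2)
            - \<eta> * A * exp (A * (t - T)))"
  define V where "V = (\<lambda>(s, \<theta>::real, t). exp (ell (s, \<theta>0, t)))"
  have "f (s, \<theta>0, \<tau>) \<le> 0"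
  proof (rule parabolic_max_principle[where f = f and ?t0.0 = T and ?t1.0 = \<tau> and M = "2 * K"
        and ?f1.0 = f1 and ?f11.0 = f11 and ?f2.0 = "\<lambda>_. 0" and ?f22.0 = "\<lambda>_. 0"
        and ?f3.0 = f3 and a = V and B = K and B' = M])
    have nz: "\<sigma> (snd (snd x)) \<noteq> 0" if "x \<in> UNIV \<times> UNIV \<times> {T..\<tau>}" for x :: "real \<times> real \<times> real"
      using \<sigma>[of "snd (snd x)"] that by auto
    let ?D = "UNIV \<times> UNIV \<times> {T..\<tau>} :: (real \<times> real \<times> real) set"
    have c1: "continuous_on ?D (\<lambda>x. harnack \<epsilon> (fst x, \<theta>0, snd (snd x)))"
      by (intro smooth_slab_cont smooth_harnack \<epsilon> continuous_intros) (use T in auto)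
    have c2: "continuous_on ?D (\<lambda>x. Rm (fst x, \<theta>0, snd (snd x)))"
      by (intro smooth_slab_cont smooth_Rm continuous_intros) (use T in auto)
    have c3: "continuous_on ?D (\<lambda>x. \<sigma> (snd (snd x)))" unfolding \<sigma>_def by (intro continuous_intros)
    have c4: "continuous_on ?D (\<lambda>x. \<eta> * exp (A * (snd (snd x) - T)))" by (intro continuous_intros)
    have "continuous_on ?D (\<lambda>x. - (harnack \<epsilon> (fst x, \<theta>0, snd (snd x))
        + (Rm (fst x, \<theta>0, snd (snd x)) + \<epsilon>) / \<sigma> (snd (snd x))) - \<eta> * exp (A * (snd (snd x) - T)))"
      by (intro continuous_on_diff continuous_on_minus continuous_on_add continuous_on_divide
          continuous_on_const c1 c2 c3 c4 ballI nz)
    then show "continuous_on (UNIV \<times> UNIV \<times> {T..\<tau>}) f" by (simp add: f_def split_beta)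
    fix s \<theta> t
    {
      fix k assume "T \<le> t" "t \<le> \<tau>"
      show "f (s, \<theta> + 2 * pi * of_int k, t) = f (s, \<theta>, t)" by (simp add: f_def)
    next
      assume t: "T \<le> t" "t \<le> \<tau>"
      have "(Rm (s, \<theta>0, t) + \<epsilon>) / \<sigma> t \<ge> 0" using Rm_nonneg[of t s \<theta>0] t T \<sigma>[OF t(1)] \<epsilon> by simp
      moreover have "\<eta> * exp (A * (t - T)) \<ge> 0" using \<eta> by simp
      ultimately show "f (s, \<theta>, t) \<le> 2 * K" using lower[OF t, of s \<theta>0] unfolding f_def prod.case by linarith
    next
      have "2 * K \<le> (Rm (s, \<theta>0, T) + \<epsilon>) / \<kappa>"
      proof -
        have "2 * K * \<kappa> = \<epsilon>" using K(1) by (simp add: \<kappa>_def)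
        then show ?thesis using Rm_nonneg[of T s \<theta>0] T \<kappa> by (simp add: pos_le_divide_eq)
      qed
      moreover have "\<eta> * exp (A * (T - T)) \<ge> 0" using \<eta> by simp
      ultimately show "f (s, \<theta>, T) \<le> 0"
        using lower[of T s \<theta>0] T unfolding f_def prod.case \<sigma>_def by simp
    next
      assume t: "T < t" "t \<le> \<tau>"
      have n: "t < 0" using t T by simp
      have s0: "\<sigma> t > 0" "\<sigma> t \<noteq> 0" using \<sigma>[of t] t by simp_all
      have d\<sigma>: "(\<sigma> has_real_derivative 1) (at t)" unfolding \<sigma>_def by (auto intro!: derivative_eq_intros)
      show "((\<lambda>s. f (s, \<theta>, t)) has_real_derivative f1 (s, \<theta>, t)) (at s)"
      proof -
        have "((\<lambda>s. (Rm (s, \<theta>0, t) + \<epsilon>) / \<sigma> t) has_real_derivative (pd1 Rm (s, \<theta>0, t) + 0) / \<sigma> t) (at s)"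
          by (intro DERIV_cdivide DERIV_add pd1_deriv smooth_Rm n DERIV_const)
        then have "((\<lambda>s. f (s, \<theta>, t)) has_real_derivative
            - (Z1 (s, \<theta>0, t) + (pd1 Rm (s, \<theta>0, t) + 0) / \<sigma> t) - 0) (at s)"
          unfolding f_def prod.case by (intro DERIV_diff DERIV_minus DERIV_add Z1 n DERIV_const)
        then show ?thesis by (simp add: f1_def)
      qed
      show "((\<lambda>s. f1 (s, \<theta>, t)) has_real_derivative f11 (s, \<theta>, t)) (at s)"
        unfolding f1_def f11_def prod.case
        by (intro DERIV_minus DERIV_add DERIV_cdivide Z2 pd1_deriv sm n)
      show "((\<lambda>\<theta>. f (s, \<theta>, t)) has_real_derivative 0) (at \<theta>)" by (simp add: f_def)
      show "((\<lambda>\<theta>. 0) has_real_derivative 0) (at \<theta>)" by simp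
      show "((\<lambda>t. f (s, \<theta>, t)) has_real_derivative f3 (s, \<theta>, t)) (at t)"
      proof -
        have d1: "((\<lambda>t. (Rm (s, \<theta>0, t) + \<epsilon>) / \<sigma> t) has_real_derivative
            (pd3 Rm (s, \<theta>0, t) * \<sigma> t - (Rm (s, \<theta>0, t) + \<epsilon>)) / (\<sigma> t)\<^sup>2) (at t)"
          using DERIV_divide[OF DERIV_add[OF pd3_deriv[OF smooth_Rm n, of s \<theta>0] DERIV_const[of \<epsilon>]] d\<sigma> s0(2)]
          by (simp add: power2_eq_square)
        have d2: "((\<lambda>t. \<eta> * exp (A * (t - T))) has_real_derivative \<eta> * A * exp (A * (t - T))) (at t)"
          by (auto intro!: derivative_eq_intros)
        show ?thesis unfolding f_def f3_def prod.case
          by (intro DERIV_diff DERIV_minus DERIV_add Z3 d1 d2 n)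
      qed
      show "0 \<le> V (s, \<theta>, t)" by (simp add: V_def)
      show "V (s, \<theta>, t) \<le> M * (cosh s)\<^sup>2" using M(2) t by (simp add: V_def)
      assume pos: "f (s, \<theta>, t) > 0"
      have E: "exp (A * (t - T)) \<ge> 1" using K(1) t by (simp add: A_def)
      have t': "T \<le> t" using t by simp
      have "- (Z3 (s, \<theta>0, t) + (pd3 Rm (s, \<theta>0, t) * \<sigma> t - (Rm (s, \<theta>0, t) + \<epsilon>)) / (\<sigma> t)\<^sup>2)
            - \<eta> * A * exp (A * (t - T))
          \<le> exp (ell (s, \<theta>0, t)) * (- (Z2 (s, \<theta>0, t) + pd1 (pd1 Rm) (s, \<theta>0, t) / \<sigma> t)) + K * f (s, \<theta>, t)"
        by (rule harnack_step[OF Z[OF n] pd3_Rm[OF n] refl \<epsilon> Rm_nonneg[OF n] K(2)[OF t' t(2)] K(4)[OF t' t(2)]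
              s0(1) E \<eta>_def A_def _ pos]) (simp add: f_def)
      then show "f3 (s, \<theta>, t) \<le> V (s, \<theta>, t) * (f11 (s, \<theta>, t) + 0) + K * f (s, \<theta>, t)"
        by (simp add: f3_def f11_def V_def)
    }
  qed (use T K M in auto)
  then have le: "- (\<eta> * exp (A * (\<tau> - T))) \<le> harnack \<epsilon> (s, \<theta>0, \<tau>) + (Rm (s, \<theta>0, \<tau>) + \<epsilon>) / \<sigma> \<tau>"
    by (simp add: f_def)
  have r: "Rm (s, \<theta>0, \<tau>) \<ge> 0" by (rule Rm_nonneg[OF T(2)])
  have "(Rm (s, \<theta>0, \<tau>) + \<epsilon>) / \<sigma> \<tau> \<le> (Rm (s, \<theta>0, \<tau>) + \<epsilon>) / (\<tau> - T)"
    using r \<epsilon> \<kappa> T by (intro divide_left_mono) (auto simp: \<sigma>_def)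
  moreover have "harnack \<epsilon> (s, \<theta>0, \<tau>) \<le> pd3 Rm (s, \<theta>0, \<tau>) + \<epsilon> * Rm (s, \<theta>0, \<tau>)"
    using r \<epsilon> unfolding harnack_eq[OF T(2)] by simp
  ultimately show ?thesis using le unfolding \<eta>_def A_def by linarith
qed

text \<open>With the interval length d fixed, \<epsilon> tends to 0 and gives R_t + R / d >= 0; only
  then does d tend to infinity, since \<open>K\<close> depends on d.\<close>

lemma pd3_Rm_nonneg:
  assumes "\<tau> < 0"
  shows "pd3 Rm (s, \<theta>, \<tau>) \<ge> 0"
proof -
  have *: "pd3 Rm (s, \<theta>, \<tau>) + Rm (s, \<theta>, \<tau>) / d \<ge> 0" if d: "d > 0" for d
  proof -
    define T where "T = \<tau> - d"
    have T: "T < \<tau>" "\<tau> - T = d" using d by (auto simp: T_def)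
    obtain K where K: "K > 0" "\<And>s \<theta> t. T \<le> t \<Longrightarrow> t \<le> \<tau> \<Longrightarrow> Rm (s, \<theta>, t) \<le> K"
      "\<And>s \<theta> t. T \<le> t \<Longrightarrow> t \<le> \<tau> \<Longrightarrow> \<bar>pd3 Rm (s, \<theta>, t)\<bar> \<le> K"
      "\<And>s \<theta> t. T \<le> t \<Longrightarrow> t \<le> \<tau> \<Longrightarrow> exp (ell (s, \<theta>, t)) * (pd1 Rm (s, \<theta>, t))\<^sup>2 \<le> K * Rm (s, \<theta>, t)"
      by (rule Rm_bounds[OF assms, of T]) blast
    \<comment> \<open>The total coefficient of \<epsilon> in \<open>harnack_lower_bound\<close>, so
      that \<epsilon> = e / X costs exactly e.\<close>
    define X where "X = Rm (s, \<theta>, \<tau>) + 1 / d + (1 + K) * exp ((2 * K + K\<^sup>2) * d)"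
    have X: "X > 0" using Rm_nonneg[OF assms, of s \<theta>] d K(1) unfolding X_def
      by (intro add_nonneg_pos add_nonneg_nonneg mult_pos_pos) auto
    have "0 \<le> (pd3 Rm (s, \<theta>, \<tau>) + Rm (s, \<theta>, \<tau>) / d) + e" if e: "e > 0" for e
    proof -
      have "- (e / X * (1 + K) * exp ((2 * K + K\<^sup>2) * (\<tau> - T))) \<le> pd3 Rm (s, \<theta>, \<tau>) + e / X * Rm (s, \<theta>, \<tau>)
          + (Rm (s, \<theta>, \<tau>) + e / X) / (\<tau> - T)"
        by (rule harnack_lower_bound[OF T(1) assms _ K]) (use e X in simp)
      then have "0 \<le> pd3 Rm (s, \<theta>, \<tau>) + Rm (s, \<theta>, \<tau>) / d + e / X * X"
        unfolding T(2) X_def by (simp add: algebra_simps add_divide_distrib)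
      then show ?thesis using X by simp
    qed
    then show ?thesis by (rule field_le_epsilon)
  qed
  show ?thesis
  proof (rule field_le_epsilon)
    fix e :: real assume e: "e > 0"
    have r: "Rm (s, \<theta>, \<tau>) \<ge> 0" by (rule Rm_nonneg[OF assms])
    define d where "d = (Rm (s, \<theta>, \<tau>) + 1) / e"
    have d: "d > 0" using r e by (simp add: d_def)
    have "Rm (s, \<theta>, \<tau>) / d \<le> e" using r e by (simp add: d_def field_simps)
    then show "0 \<le> pd3 Rm (s, \<theta>, \<tau>) + e" using *[OF d] by linarith
  qed
qed

lemma Rm_mono:
  assumes "t \<le> t0" "t0 < 0"
  shows "Rm (s, \<theta>, t) \<le> Rm (s, \<theta>, t0)"
proof (rule DERIV_nonneg_imp_nondecreasing[OF assms(1)])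
  fix x assume "t \<le> x" "x \<le> t0"
  then have "x < 0" using assms by simp
  then show "\<exists>y. ((\<lambda>t. Rm (s, \<theta>, t)) has_real_derivative y) (at x) \<and> 0 \<le> y"
    using pd3_deriv[OF smooth_Rm] pd3_Rm_nonneg by blast
qed

end

section \<open>Derivative bounds\<close>

text \<open>The derivative of \<Phi> = 4 - m^2 - 2 K exp(-l) is 2 m exp(-l) (K - k), nonnegative
  from s onwards because m is nondecreasing and starts nonnegative. As \<Phi> tends to 0 at the
  pole, it is nonpositive at s.\<close>

lemma tip_estimate:
  fixes l m k :: "real \<Rightarrow> real"
  assumes dl: "\<And>x. (l has_real_derivative m x) (at x)"
    and dm: "\<And>x. (m has_real_derivative exp (- l x) * k x) (at x)"
    and k: "\<And>x. 0 \<le> k x" "\<And>x. k x \<le> K"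
    and m_lim: "(m \<longlongrightarrow> 2) at_top" and l_lim: "((\<lambda>x. exp (- l x)) \<longlongrightarrow> 0) at_top"
    and M: "\<And>x. exp (l x) \<le> M * (cosh x)\<^sup>2" and s: "m s \<ge> 0"
  shows "m s \<le> 2" "\<bar>exp (l s) * (m s - 2 * tanh s)\<bar> \<le> K + 4 * M"
proof -
  have mono: "m x \<le> m y" if "x \<le> y" for x y
    by (rule DERIV_nonneg_imp_nondecreasing[OF that]) (use dm k in \<open>meson exp_ge_zero mult_nonneg_nonneg\<close>)
  have ev: "\<forall>\<^sub>F x in at_top. s \<le> x" by (rule eventually_ge_at_top)
  show m2: "m s \<le> 2"
    by (rule tendsto_lowerbound[OF m_lim eventually_mono[OF ev mono]]) auto
  define \<Phi> where "\<Phi> x = 4 - (m x)\<^sup>2 - 2 * K * exp (- l x)" for x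
  have d\<Phi>: "(\<Phi> has_real_derivative 2 * m x * exp (- l x) * (K - k x)) (at x)" for x
    unfolding \<Phi>_def by (auto intro!: derivative_eq_intros dl dm simp: algebra_simps)
  have "\<Phi> s \<le> \<Phi> x" if "s \<le> x" for x
  proof (rule DERIV_nonneg_imp_nondecreasing[OF that])
    fix y assume "s \<le> y"
    then have "m y \<ge> 0" using mono s by (meson order_trans)
    then have "2 * m y * exp (- l y) * (K - k y) \<ge> 0" using k(2)[of y] by simp
    then show "\<exists>d. (\<Phi> has_real_derivative d) (at y) \<and> 0 \<le> d" using d\<Phi> by blast
  qed
  note \<Phi>_mono = this
  have \<Phi>_lim: "(\<Phi> \<longlongrightarrow> 4 - 2\<^sup>2 - 2 * K * 0) at_top"
    unfolding \<Phi>_def by (intro tendsto_intros m_lim l_lim)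
  have "\<Phi> s \<le> 4 - 2\<^sup>2 - 2 * K * 0"
    by (rule tendsto_lowerbound[OF \<Phi>_lim eventually_mono[OF ev \<Phi>_mono]]) auto
  then have "4 - (m s)\<^sup>2 \<le> 2 * K * exp (- l s)" by (simp add: \<Phi>_def)
  then have "exp (l s) * (4 - (m s)\<^sup>2) \<le> exp (l s) * (2 * K * exp (- l s))"
    by (rule mult_left_mono) simp
  also have "\<dots> = 2 * K * (exp (l s) * exp (- l s))" by (simp only: mult_ac)
  also have "exp (l s) * exp (- l s) = 1" by (simp flip: exp_add)
  finally have h: "exp (l s) * (4 - (m s)\<^sup>2) \<le> 2 * K" by simp
  \<comment> \<open>Dividing 4 - m^2 by 2 + m >= 2 turns the quadratic estimate into one for 2 -
    m.\<close>
  have "(2 - m s) * 2 \<le> (2 - m s) * (2 + m s)" using s m2 by (intro mult_left_mono) auto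
  also have "\<dots> = 4 - (m s)\<^sup>2" by (simp add: power2_eq_square algebra_simps)
  finally have "exp (l s) * ((2 - m s) * 2) \<le> exp (l s) * (4 - (m s)\<^sup>2)" by (intro mult_left_mono) auto
  moreover have "exp (l s) * ((2 - m s) * 2) = 2 * (exp (l s) * (2 - m s))" by (simp only: mult_ac)
  ultimately have a: "exp (l s) * (2 - m s) \<le> K" using h by linarith
  have K: "K \<ge> 0" using k[of 0] by simp
  have M0: "exp (l 0) \<le> M" using M[of 0] by simp
  then have M_pos: "M > 0" using exp_gt_zero[of "l 0"] by linarith
  have e: "exp (l s) > 0" by simp
  show "\<bar>exp (l s) * (m s - 2 * tanh s)\<bar> \<le> K + 4 * M"
  proof (cases "s \<ge> 0")
    case True
    have c: "cosh s > 0" by (rule cosh_real_pos)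
    have t1: "tanh s \<le> 1" using tanh_real_lt_1[of s] by simp
    have "cosh s * (cosh s - sinh s) \<le> (cosh s + sinh s) * (cosh s - sinh s)"
      using True by (intro mult_right_mono) (auto simp: cosh_minus_sinh)
    also have "\<dots> = 1" by (simp add: cosh_plus_sinh cosh_minus_sinh flip: exp_add)
    finally have c1: "(cosh s)\<^sup>2 * (1 - tanh s) \<le> 1"
      using c by (simp add: tanh_def power2_eq_square algebra_simps)
    have "exp (l s) * (2 - 2 * tanh s) \<le> M * (cosh s)\<^sup>2 * (2 - 2 * tanh s)"
      using M[of s] t1 by (intro mult_right_mono) auto
    also have "\<dots> = 2 * M * ((cosh s)\<^sup>2 * (1 - tanh s))" by (simp add: algebra_simps)
    also have "\<dots> \<le> 2 * M * 1" using c1 M_pos by (intro mult_left_mono) auto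
    finally have b: "exp (l s) * (2 - 2 * tanh s) \<le> 2 * M" by simp
    have "exp (l s) * (m s - 2 * tanh s) = exp (l s) * (2 - 2 * tanh s) - exp (l s) * (2 - m s)"
      by (simp add: algebra_simps)
    moreover have "exp (l s) * (2 - 2 * tanh s) \<ge> 0" "exp (l s) * (2 - m s) \<ge> 0" using t1 m2 by simp_all
    ultimately show ?thesis using a b K M_pos by (simp add: abs_le_iff)
  next
    \<comment> \<open>The sign of m and that of s may disagree. Then l is nondecreasing from s to 0,
      so exp l at s is already bounded by its bound at the equator.\<close>
    case False
    then have "s \<le> 0" by simp
    then have "l s \<le> l 0"
    proof (rule DERIV_nonneg_imp_nondecreasing)
      fix x assume "s \<le> x"
      then have "m x \<ge> 0" using mono s by (meson order_trans)
      then show "\<exists>d. (l has_real_derivative d) (at x) \<and> 0 \<le> d" using dl by blast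
    qed
    then have "exp (l s) \<le> exp (l 0)" by simp
    with M0 have "exp (l s) \<le> M" by linarith
    moreover have "\<bar>m s - 2 * tanh s\<bar> \<le> 4"
    proof -
      have "tanh s \<le> 0" "tanh s > -1" using False tanh_real_gt_neg1[of s] by simp_all
      then have "m s - 2 * tanh s \<le> 4" "- (m s - 2 * tanh s) \<le> 4" using s m2 by linarith+
      then show ?thesis by (rule abs_leI)
    qed
    ultimately have "\<bar>exp (l s)\<bar> * \<bar>m s - 2 * tanh s\<bar> \<le> M * 4"
      using M_pos by (intro mult_mono) auto
    then show ?thesis using K by (simp add: abs_mult)
  qed
qed

section \<open>Bounds for the derivatives of v\<close>

context ancient_sphere_flow
begin

text \<open>The constants are bounds at the single time t0. Both R and \<open>ell\<close> are
  nondecreasing in time, so the same constants serve for all earlier times.\<close>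

lemma conformal_flux_bound:
  assumes t: "t \<le> t0" "t0 < 0"
    and K: "\<And>s \<theta>. Rm (s, \<theta>, t0) \<le> K"
    and M: "\<And>s \<theta>. exp (ell (s, \<theta>, t0)) \<le> M * (cosh s)\<^sup>2"
  shows "\<bar>pd1 ell (s, \<theta>, t)\<bar> \<le> 2"
    "\<bar>exp (ell (s, \<theta>, t)) * (pd1 ell (s, \<theta>, t) - 2 * tanh s)\<bar> \<le> K + 4 * M"
proof -
  have tn: "t < 0" using t by simp
  define l where "l x = ell (x, \<theta>, t)" for x
  define m where "m x = pd1 ell (x, \<theta>, t)" for x
  define k where "k x = Rm (x, \<theta>, t)" for x
  have dl: "(l has_real_derivative m x) (at x)" for x
    unfolding l_def m_def by (rule pd1_deriv[OF smooth_ell tn])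
  have dm: "(m has_real_derivative exp (- l x) * k x) (at x)" for x
    unfolding l_def m_def k_def pd1_pd1_ell[OF tn, symmetric]
    by (rule pd1_deriv[OF smooth_slab_pd(1)[OF smooth_ell] tn])
  have k: "0 \<le> k x" "k x \<le> K" for x
    using Rm_nonneg[OF tn] order.trans[OF Rm_mono[OF t] K] by (simp_all add: k_def)
  have Ml: "exp (l x) \<le> M * (cosh x)\<^sup>2" for x
    unfolding l_def using ell_mono[OF t, of x \<theta>] order.trans[OF _ M] by (metis exp_le_cancel_iff)
  \<comment> \<open>\<open>B\<close> and \<open>N\<close> depend on t, but they enter only the
    limits at the poles and not the final constant.\<close>
  obtain B where B: "B > 0" "\<And>\<psi> \<theta> s. t \<le> s \<Longrightarrow> s \<le> t \<Longrightarrow> \<bar>pd1 lu (\<psi>, \<theta>, s)\<bar> \<le> B"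
    by (rule doubly_periodic_bounded[OF C_infinity_onD(3)[OF smooth_slab_pd(1)[OF smooth_lu]]
        doubly_periodic_pd(1)[OF smooth_lu periodic_lu] tn, of t]) blast
  obtain N where N: "N > 0" "\<And>s \<theta> s'. t \<le> s' \<Longrightarrow> s' \<le> t \<Longrightarrow> (cosh s)\<^sup>2 \<le> N * exp (ell (s, \<theta>, s'))"
    by (rule exp_ell_bounds[OF tn, of t]) blast
  have c: "((\<lambda>x::real. inverse (cosh x)) \<longlongrightarrow> 0) at_top"
    by (rule tendsto_inverse_0_at_top[OF cosh_real_at_top])
  have g0: "((\<lambda>x. pd1 lu (f x, \<theta>, t) / cosh x) \<longlongrightarrow> 0) at_top" for f :: "real \<Rightarrow> real"
  proof (rule Lim_null_comparison)
    show "\<forall>\<^sub>F x in at_top. norm (pd1 lu (f x, \<theta>, t) / cosh x) \<le> B * inverse (cosh x)"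
    proof (intro always_eventually allI)
      fix x :: real
      have "\<bar>pd1 lu (f x, \<theta>, t)\<bar> / cosh x \<le> B / cosh x"
        using B(2)[of t "f x" \<theta>] cosh_real_pos[of x] by (intro divide_right_mono) auto
      then show "norm (pd1 lu (f x, \<theta>, t) / cosh x) \<le> B * inverse (cosh x)"
        using cosh_real_pos[of x] by (simp add: abs_divide flip: divide_inverse)
    qed
    show "((\<lambda>x. B * inverse (cosh x)) \<longlongrightarrow> 0) at_top" using tendsto_mult_left[OF c, of B] by simp
  qed
  have e0: "((\<lambda>x. exp (- ell (f x, \<theta>, t))) \<longlongrightarrow> 0) at_top" if f: "\<And>x. cosh (f x) = cosh x" for f :: "real \<Rightarrow> real"
  proof (rule Lim_null_comparison)
    show "\<forall>\<^sub>F x in at_top. norm (exp (- ell (f x, \<theta>, t))) \<le> N * inverse (cosh x)"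
    proof (intro always_eventually allI)
      fix x :: real
      have c1: "cosh x \<ge> 1" by (rule cosh_real_ge_1)
      then have "cosh x \<le> (cosh x)\<^sup>2" by (simp add: power2_eq_square)
      also have "\<dots> \<le> N * exp (ell (f x, \<theta>, t))" using N(2)[of t "f x" \<theta>] f by simp
      finally show "norm (exp (- ell (f x, \<theta>, t))) \<le> N * inverse (cosh x)"
        using c1 by (simp add: exp_minus field_simps)
    qed
    show "((\<lambda>x. N * inverse (cosh x)) \<longlongrightarrow> 0) at_top" using tendsto_mult_left[OF c, of N] by simp
  qed
  show "\<bar>pd1 ell (s, \<theta>, t)\<bar> \<le> 2"
    "\<bar>exp (ell (s, \<theta>, t)) * (pd1 ell (s, \<theta>, t) - 2 * tanh s)\<bar> \<le> K + 4 * M"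
  proof (atomize (full), cases "m s \<ge> 0")
    case True
    have "((\<lambda>x. 2 * tanh x - pd1 lu (gd x, \<theta>, t) / cosh x) \<longlongrightarrow> 2 * 1 - 0) at_top"
      by (intro tendsto_diff tendsto_mult_left tanh_real_at_top g0)
    then have m_lim: "(m \<longlongrightarrow> 2) at_top" unfolding m_def pd_ell[OF tn] by simp
    have l_lim: "((\<lambda>x. exp (- l x)) \<longlongrightarrow> 0) at_top" unfolding l_def by (rule e0) simp
    from tip_estimate[OF dl dm k m_lim l_lim Ml True] True
    show "\<bar>pd1 ell (s, \<theta>, t)\<bar> \<le> 2 \<and> \<bar>exp (ell (s, \<theta>, t)) * (pd1 ell (s, \<theta>, t) - 2 * tanh s)\<bar> \<le> K + 4 * M"
      by (simp add: m_def l_def)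
  next
    case False
    \<comment> \<open>Reflecting s to -s exchanges the poles and makes the slope nonnegative, so
      that \<open>tip_estimate\<close> applies again.\<close>
    have dl': "((\<lambda>x. l (- x)) has_real_derivative - m (- x)) (at x)" for x
      using DERIV_chain2[OF dl[of "- x"] DERIV_minus[OF DERIV_ident]] by simp
    have dm': "((\<lambda>x. - m (- x)) has_real_derivative exp (- l (- x)) * k (- x)) (at x)" for x
      using DERIV_minus[OF DERIV_chain2[OF dm[of "- x"] DERIV_minus[OF DERIV_ident]]] by simp
    have "((\<lambda>x. 2 * tanh x + pd1 lu (gd (- x), \<theta>, t) / cosh x) \<longlongrightarrow> 2 * 1 + 0) at_top"
      by (intro tendsto_add tendsto_mult_left tanh_real_at_top g0)
    then have m_lim: "((\<lambda>x. - m (- x)) \<longlongrightarrow> 2) at_top"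
      unfolding m_def pd_ell[OF tn] by (simp add: add.commute)
    have l_lim: "((\<lambda>x. exp (- l (- x))) \<longlongrightarrow> 0) at_top" unfolding l_def by (rule e0) simp
    have M': "exp (l (- x)) \<le> M * (cosh x)\<^sup>2" for x using Ml[of "- x"] by simp
    have s': "- m (- (- s)) \<ge> 0" using False by simp
    have "- m s - 2 * tanh (- s) = - (m s - 2 * tanh s)" by simp
    with tip_estimate[OF dl' dm' k m_lim l_lim M' s'] False
    show "\<bar>pd1 ell (s, \<theta>, t)\<bar> \<le> 2 \<and> \<bar>exp (ell (s, \<theta>, t)) * (pd1 ell (s, \<theta>, t) - 2 * tanh s)\<bar> \<le> K + 4 * M"
      by (simp only: minus_minus mult_minus_right abs_minus_cancel m_def l_def) simp
  qed
qed

lemma v_derivs: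
  assumes t: "t < 0"
  shows "deriv (\<lambda>s. inverse (u (sphere_point s \<theta>) t)) \<psi> = - (exp (- lu (\<psi>, \<theta>, t)) * pd1 lu (\<psi>, \<theta>, t))"
    "(deriv ^^ 2) (\<lambda>s. inverse (u (sphere_point s \<theta>) t)) \<psi>
      = exp (- lu (\<psi>, \<theta>, t)) * ((pd1 lu (\<psi>, \<theta>, t))\<^sup>2 - pd1 (pd1 lu) (\<psi>, \<theta>, t))"
proof -
  have v: "(\<lambda>s. inverse (u (sphere_point s \<theta>) t)) = (\<lambda>s. exp (- lu (s, \<theta>, t)))"
    by (simp add: exp_minus exp_lu[OF t])
  have d1: "((\<lambda>s. exp (- lu (s, \<theta>, t))) has_real_derivative - (exp (- lu (\<psi>, \<theta>, t)) * pd1 lu (\<psi>, \<theta>, t))) (at \<psi>)" for \<psi>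
    using DERIV_fun_exp[OF DERIV_minus[OF pd1_deriv[OF smooth_lu t]]] by simp
  have d: "deriv (\<lambda>s. exp (- lu (s, \<theta>, t))) = (\<lambda>s. - (exp (- lu (s, \<theta>, t)) * pd1 lu (s, \<theta>, t)))"
    using DERIV_imp_deriv[OF d1] by blast
  show "deriv (\<lambda>s. inverse (u (sphere_point s \<theta>) t)) \<psi> = - (exp (- lu (\<psi>, \<theta>, t)) * pd1 lu (\<psi>, \<theta>, t))"
    unfolding v d ..
  have "((\<lambda>s. - (exp (- lu (s, \<theta>, t)) * pd1 lu (s, \<theta>, t))) has_real_derivative
      exp (- lu (\<psi>, \<theta>, t)) * ((pd1 lu (\<psi>, \<theta>, t))\<^sup>2 - pd1 (pd1 lu) (\<psi>, \<theta>, t))) (at \<psi>)"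
    using DERIV_minus[OF DERIV_mult[OF d1 pd1_deriv[OF smooth_slab_pd(1)[OF smooth_lu] t]]]
    by (simp add: power2_eq_square algebra_simps)
  then show "(deriv ^^ 2) (\<lambda>s. inverse (u (sphere_point s \<theta>) t)) \<psi>
      = exp (- lu (\<psi>, \<theta>, t)) * ((pd1 lu (\<psi>, \<theta>, t))\<^sup>2 - pd1 (pd1 lu) (\<psi>, \<theta>, t))"
    unfolding v by (simp add: numeral_2_eq_2 d DERIV_imp_deriv)
qed

lemma v_derivative_bound:
  assumes t0: "t0 < 0"
  obtains C2 where "C2 > 0" "\<And>t \<psi> \<theta>. t \<le> t0 \<Longrightarrow> - (pi / 2) < \<psi> \<Longrightarrow> \<psi> < pi / 2 \<Longrightarrow>
    \<bar>(deriv ^^ 2) (\<lambda>s. inverse (u (sphere_point s \<theta>) t)) \<psi>\<bar>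
      + \<bar>(1 / cos \<psi>) * deriv (\<lambda>s. inverse (u (sphere_point s \<theta>) t)) \<psi>\<bar> \<le> C2"
proof -
  \<comment> \<open>The time interval is the single instant t0; monotonicity carries the bounds to
    all earlier times.\<close>
  obtain K where K: "K > 0" "\<And>s \<theta> t. t0 \<le> t \<Longrightarrow> t \<le> t0 \<Longrightarrow> Rm (s, \<theta>, t) \<le> K"
    by (rule Rm_bounds[OF t0, of t0]) blast
  obtain M where M: "M > 0" "\<And>s \<theta> t. t0 \<le> t \<Longrightarrow> t \<le> t0 \<Longrightarrow> exp (ell (s, \<theta>, t)) \<le> M * (cosh s)\<^sup>2"
    by (rule exp_ell_bounds[OF t0, of t0]) blast
  define B where "B = K + 4 * M"
  have B: "B > 0" using K M by (simp add: B_def)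
  show ?thesis
  proof
    \<comment> \<open>The second derivative costs K + 2 M + 5 B: 4 B for v p^2, K for the curvature,
      B for the tangent term and 2 M for 2 v. The first derivative adds B.\<close>
    show "K + 2 * M + 6 * B > 0" using K(1) M(1) B by simp
    fix t \<psi> \<theta> assume t: "t \<le> t0" and psi: "- (pi / 2) < \<psi>" "\<psi> < pi / 2"
    have tn: "t < 0" using t t0 by simp
    obtain s where s: "\<psi> = gd s" using gd_surj[OF psi] by blast
    define c where "c = cosh s"
    define v where "v = exp (- lu (\<psi>, \<theta>, t))"
    define p where "p = pd1 lu (\<psi>, \<theta>, t)"
    define m where "m = pd1 ell (s, \<theta>, t) - 2 * tanh s"
    have c: "c > 0" by (simp add: c_def cosh_real_pos)
    have v: "v > 0" by (simp add: v_def)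
    have E: "exp (ell (s, \<theta>, t)) = c\<^sup>2 * v"
      by (simp add: exp_ell[OF tn] v_def exp_minus exp_lu[OF tn] c_def s divide_inverse)
    have m: "m = - (p / c)" by (simp add: m_def pd_ell[OF tn] p_def s c_def)
    note flux = conformal_flux_bound[OF t t0 K(2)[OF order_refl order_refl] M(2)[OF order_refl order_refl], of s \<theta>]
    have sec: "(1 / cos \<psi>) * (- (v * p)) = exp (ell (s, \<theta>, t)) * m"
      unfolding E m s using c by (simp add: c_def[symmetric] field_simps power2_eq_square)
    have b1: "\<bar>(1 / cos \<psi>) * (- (v * p))\<bar> \<le> B"
      unfolding sec m_def B_def by (rule flux(2))
    have m4: "\<bar>m\<bar> \<le> 4"
      unfolding m_def using flux(1) tanh_real_lt_1[of s] tanh_real_gt_neg1[of s] by (simp add: abs_le_iff)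
    have "v * p\<^sup>2 = exp (ell (s, \<theta>, t)) * m * m"
      unfolding E m using c by (simp add: field_simps power2_eq_square)
    then have "\<bar>v * p\<^sup>2\<bar> = \<bar>exp (ell (s, \<theta>, t)) * m\<bar> * \<bar>m\<bar>" by (simp add: abs_mult)
    also have "\<dots> \<le> B * 4" using b1 m4 B unfolding sec by (intro mult_mono) auto
    finally have b2: "\<bar>v * p\<^sup>2\<bar> \<le> 4 * B" by simp
    have b3: "\<bar>v * (tan \<psi> * p)\<bar> \<le> B"
    proof -
      have "v * (tan \<psi> * p) = - (sin \<psi> * ((1 / cos \<psi>) * (- (v * p))))" by (simp add: tan_def)
      then have "\<bar>v * (tan \<psi> * p)\<bar> = \<bar>sin \<psi>\<bar> * \<bar>(1 / cos \<psi>) * (- (v * p))\<bar>" by (simp only: abs_minus_cancel abs_mult)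
      also have "\<dots> \<le> 1 * B" using b1 B by (intro mult_mono) auto
      finally show ?thesis by simp
    qed
    have b4: "\<bar>2 * v\<bar> \<le> 2 * M"
    proof -
      have "exp (ell (s, \<theta>, t)) \<le> exp (ell (s, \<theta>, t0))" using ell_mono[OF t t0] by simp
      also have "\<dots> \<le> M * c\<^sup>2" unfolding c_def by (rule M(2)) auto
      finally have "v \<le> M" unfolding E using c by (simp add: mult.commute)
      then show ?thesis using v by simp
    qed
    have r: "0 \<le> Rm (s, \<theta>, t)" "Rm (s, \<theta>, t) \<le> K"
      using Rm_nonneg[OF tn] order.trans[OF Rm_mono[OF t t0] K(2)] by auto
    have uv: "u (sphere_point \<psi> \<theta>) t = inverse v" by (simp add: v_def exp_minus exp_lu[OF tn])
    \<comment> \<open>With the longitude derivative gone, the flow equation can be solved for the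
      second \<psi>-derivative.\<close>
    have "inverse v * pd3 lu (\<psi>, \<theta>, t) = pd1 (pd1 lu) (\<psi>, \<theta>, t) - tan \<psi> * p - 2"
      using lu_eq[OF tn psi, of \<theta>] pd_ell(4)[OF tn, of s \<theta>] pd2_pd2_ell[OF tn, of s \<theta>]
      by (simp add: uv p_def flip: s)
    then have "v * (inverse v * pd3 lu (\<psi>, \<theta>, t)) = v * (pd1 (pd1 lu) (\<psi>, \<theta>, t) - tan \<psi> * p - 2)" by simp
    then have "pd3 lu (\<psi>, \<theta>, t) = v * pd1 (pd1 lu) (\<psi>, \<theta>, t) - v * (tan \<psi> * p) - 2 * v"
      using v by (simp add: right_diff_distrib flip: mult.assoc)
    then have "v * (p\<^sup>2 - pd1 (pd1 lu) (\<psi>, \<theta>, t)) = v * p\<^sup>2 + Rm (s, \<theta>, t) - v * (tan \<psi> * p) - 2 * v"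
      using Rm_lu[OF tn, of s \<theta>] by (simp add: right_diff_distrib flip: s)
    then have "\<bar>v * (p\<^sup>2 - pd1 (pd1 lu) (\<psi>, \<theta>, t))\<bar> \<le> 4 * B + K + B + 2 * M"
      using b2 b3 b4 r by linarith
    then have "\<bar>v * (p\<^sup>2 - pd1 (pd1 lu) (\<psi>, \<theta>, t))\<bar> + \<bar>(1 / cos \<psi>) * (- (v * p))\<bar> \<le> K + 2 * M + 6 * B"
      using b1 by linarith
    moreover have "(deriv ^^ 2) (\<lambda>s. inverse (u (sphere_point s \<theta>) t)) \<psi> = v * (p\<^sup>2 - pd1 (pd1 lu) (\<psi>, \<theta>, t))"
      "deriv (\<lambda>s. inverse (u (sphere_point s \<theta>) t)) \<psi> = - (v * p)"
      unfolding v_derivs[OF tn] v_def p_def by (rule refl)+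
    ultimately show "\<bar>(deriv ^^ 2) (\<lambda>s. inverse (u (sphere_point s \<theta>) t)) \<psi>\<bar>
      + \<bar>(1 / cos \<psi>) * deriv (\<lambda>s. inverse (u (sphere_point s \<theta>) t)) \<psi>\<bar> \<le> K + 2 * M + 6 * B"
      by (simp only:)
  qed
qed

text \<open>Mercator's coordinate misses the poles; there the point itself does not depend on the
  longitude.\<close>

lemma u_rotation_invariant:
  assumes "t < 0" "- (pi / 2) \<le> \<psi>" "\<psi> \<le> pi / 2"
  shows "u (sphere_point \<psi> \<theta>\<^sub>1) t = u (sphere_point \<psi> \<theta>\<^sub>2) t"
proof (cases "cos \<psi> = 0")
  case True
  then show ?thesis by (simp add: sphere_point_def)
next
  case False
  then have "\<psi> \<noteq> pi / 2" "\<psi> \<noteq> - (pi / 2)" using cos_pi_half by (metis, metis cos_minus)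
  then obtain s where s: "\<psi> = gd s" using gd_surj[of \<psi>] assms(2,3) by auto
  have "ell (s, \<theta>\<^sub>2 + (\<theta>\<^sub>1 - \<theta>\<^sub>2), t) = ell (s, \<theta>\<^sub>2, t)" by (rule rotation_invariant[OF assms(1)])
  then have "lu (\<psi>, \<theta>\<^sub>1, t) = lu (\<psi>, \<theta>\<^sub>2, t)" by (simp add: ell_def s)
  then show ?thesis using exp_lu[OF assms(1)] by metis
qed

end

theorem corollary4:
  fixes u :: "real^3 \<Rightarrow> real \<Rightarrow> real"
    and v :: "real \<Rightarrow> real \<Rightarrow> real \<Rightarrow> real"
    and C0 a T0 C :: real
  assumes u_smooth: "smooth_on (sphere 0 1 \<times> {..<0}) (\<lambda>(p, t). u p t)"
    and u_pos: "\<forall>p\<in>sphere 0 1. \<forall>t<0. u p t > 0"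
    and ricci_flow: "ricci_flow_on coord_strip {..<0} (conformal_metric u)"
    and singular: "becomes_singular_at coord_strip 0 (conformal_metric u)"
    and u_eq: "\<forall>t<0. \<forall>\<psi>\<in>{-pi/2<..<pi/2}. \<forall>\<theta>\<in>{0..2*pi}.
        ((\<lambda>s. u (sphere_point \<psi> \<theta>) s) has_real_derivative
           sphere_laplacian (\<lambda>\<psi>' \<theta>'. ln (u (sphere_point \<psi>' \<theta>') t)) \<psi> \<theta> - 2) (at t)"
    and v_def: "v = (\<lambda>\<psi> \<theta> t. inverse (u (sphere_point \<psi> \<theta>) t))"
    and C0_pos: "C0 > 0"
    and v_lim: "\<forall>\<psi>\<in>{-pi/2..pi/2}. \<forall>\<theta>\<in>{0..2*pi}.
        ((\<lambda>t. v \<psi> \<theta> t) \<longlongrightarrow> C0 * (cos \<psi>)\<^sup>2) at_bot"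
    and a_bounds: "0 < a" "a < 3"
    and T0_neg: "T0 < 0"
    and C_pos: "C > 0"
    and v_theta_bound: "\<forall>t\<le>T0. \<forall>\<psi>\<in>{-pi/2..pi/2}. \<forall>\<theta>\<in>{0..2*pi}.
        (deriv (\<lambda>s. v \<psi> s t) \<theta>)\<^sup>2 \<le> C * v \<psi> \<theta> t powr (1 + a) * (cos \<psi>)\<^sup>2"
  shows "(\<forall>t<0. \<forall>\<psi>\<in>{-pi/2..pi/2}. \<forall>\<theta>\<^sub>1\<in>{0..2*pi}. \<forall>\<theta>\<^sub>2\<in>{0..2*pi}. v \<psi> \<theta>\<^sub>1 t = v \<psi> \<theta>\<^sub>2 t) \<and>
    (\<forall>t0<0. \<exists>C2>0. \<forall>t\<le>t0. \<forall>\<psi>\<in>{-pi/2<..<pi/2}. \<forall>\<theta>\<in>{0..2*pi}.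
        \<bar>(deriv ^^ 2) (\<lambda>s. v s \<theta> t) \<psi>\<bar> + \<bar>(1 / cos \<psi>) * deriv (\<lambda>s. v s \<theta> t) \<psi>\<bar> \<le> C2)"
proof -
  interpret ancient_sphere_flow u C0 a T0 C
    by unfold_locales (fact u_smooth u_pos u_eq C0_pos a_bounds T0_neg C_pos
        v_lim[unfolded v_def] v_theta_bound[unfolded v_def])+
  show ?thesis
  proof (intro conjI allI impI ballI)
    fix t \<psi> \<theta>\<^sub>1 \<theta>\<^sub>2 :: real assume "t < 0" "\<psi> \<in> {-pi/2..pi/2}"
    then show "v \<psi> \<theta>\<^sub>1 t = v \<psi> \<theta>\<^sub>2 t"
      using u_rotation_invariant[of t \<psi> \<theta>\<^sub>1 \<theta>\<^sub>2] by (simp add: v_def)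
  next
    fix t0 :: real assume "t0 < 0"
    then obtain C2 where C2: "C2 > 0" "\<And>t \<psi> \<theta>. t \<le> t0 \<Longrightarrow> - (pi / 2) < \<psi> \<Longrightarrow> \<psi> < pi / 2 \<Longrightarrow>
      \<bar>(deriv ^^ 2) (\<lambda>s. inverse (u (sphere_point s \<theta>) t)) \<psi>\<bar>
        + \<bar>(1 / cos \<psi>) * deriv (\<lambda>s. inverse (u (sphere_point s \<theta>) t)) \<psi>\<bar> \<le> C2"
      by (rule v_derivative_bound) blast
    show "\<exists>C2>0. \<forall>t\<le>t0. \<forall>\<psi>\<in>{-pi/2<..<pi/2}. \<forall>\<theta>\<in>{0..2*pi}.
        \<bar>(deriv ^^ 2) (\<lambda>s. v s \<theta> t) \<psi>\<bar> + \<bar>(1 / cos \<psi>) * deriv (\<lambda>s. v s \<theta> t) \<psi>\<bar> \<le> C2"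
      unfolding v_def using C2 by (intro exI[of _ C2] conjI allI impI ballI) auto
  qed
qed

end
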